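(* Let $M$ be a compact smooth manifold, $n=\dim(M)$, let $p$ be a natural number, and consider on $\mathcal M(M)$ the Sobolev metric $$G_g(h,k)=\int_Mg^0_2\big((1+\Delta^g)^ph,k\big)\operatorname{vol}(g).$$ Then for every $g_0\in\mathcal M(M)$ the set $\mathbb R_{>0}\,g_0$ is a totally geodesic submanifold, and the equation for geodesics of the form $r(t)g_0$ is the same as for the $L^2$-metric $\int_Mg^0_2(h,k)\operatorname{vol}(g)$, namely $$r''=\frac{r'^2}{r}\Big(1-\frac n4\Big).$$ In particular, $\mathcal M(M)$ is geodesically incomplete for each of these Sobolev metrics.
   Context: $\mathcal M(M)=\Gamma(S^2_+T^*M)$ is the space of all smooth Riemannian metrics on $M$, an open convex subset of the Fréchet space $\Gamma(S^2T^*M)$ of smooth symmetric $\binom02$-tensor fields. For symmetric $h,k$: $g^0_2(h,k)=\operatorname{Tr}(g^{-1}hg^{-1}k)$; $\operatorname{vol}(g)$ is the volume density; $\Delta^gh=\nabla^*\nabla h=-\operatorname{Tr}^g(\nabla^2h)$ is the Bochner Laplacian of $g$. With $P_g=(1+\Delta^g)^p$, the geodesic equation of $G$ is $$(P_gg_t)_t=\tfrac12(D_{(g,\cdot)}P\,g_t)^*(g_t)+\tfrac14\,g\operatorname{Tr}(g^{-1}P_gg_t\,g^{-1}g_t)+\tfrac12 g_tg^{-1}P_gg_t+\tfrac12P_gg_t\,g^{-1}g_t-\tfrac12\operatorname{Tr}(g^{-1}g_t)P_gg_t ,$$ where $D_{(g,m)}$ is the directional derivative at $g$ in direction $m$ and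 $(D_{(g,\cdot)}P\,h)^*(k)\in\Gamma(S^2T^*M)$ is defined by $\int_M g^0_2((D_{(g,m)}P)h,k)\operatorname{vol}(g)=\int_M g^0_2(m,(D_{(g,\cdot)}P\,h)^*(k))\operatorname{vol}(g)$ for all $m\in\Gamma(S^2T^*M)$. Writing the equation as $g_{tt}=\Gamma_g(g_t,g_t)$ with $\Gamma_g$ symmetric bilinear, a submanifold $\mathcal N\subset\mathcal M(M)$ is totally geodesic if $\Gamma_g(h,k)\in T_g\mathcal N$ for all $g\in\mathcal N$, $h,k\in T_g\mathcal N$. Geodesically incomplete means that some geodesic cannot be extended to all times. *)

theory Defs
  imports "HOL-Analysis.Analysis"
begin

section \<open>Smooth functions\<close>

primrec C_k_on :: "nat \<Rightarrow> 'a::euclidean_space set \<Rightarrow> ('a \<Rightarrow> 'b::real_normed_vector) \<Rightarrow> bool" where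
  "C_k_on 0 S f \<longleftrightarrow> continuous_on S f"
| "C_k_on (Suc k) S f \<longleftrightarrow> (\<forall>x\<in>S. f differentiable (at x)) \<and>
     (\<forall>v. C_k_on k S (\<lambda>x. frechet_derivative f (at x) v))"

text \<open>Only meaningful for open sets \<open>S\<close>, since derivatives are taken at \<open>x\<close> and not within \<open>S\<close>.\<close>

definition smooth_on :: "'a::euclidean_space set \<Rightarrow> ('a \<Rightarrow> 'b::real_normed_vector) \<Rightarrow> bool" where
  "smooth_on S f \<longleftrightarrow> (\<forall>k. C_k_on k S f)"

definition pd :: "'n::finite \<Rightarrow> (real^'n \<Rightarrow> 'b::real_normed_vector) \<Rightarrow> real^'n \<Rightarrow> 'b" where
  "pd i f x = frechet_derivative f (at x) (axis i 1)"

fun pds :: "'n::finite list \<Rightarrow> (real^'n \<Rightarrow> 'b::real_normed_vector) \<Rightarrow> real^'n \<Rightarrow> 'b" where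
  "pds [] f = f"
| "pds (i # is) f = pd i (pds is f)"


section \<open>Smooth manifolds and symmetric tensor fields\<close>

text \<open>A chart is a pair of its domain and its coordinate map; the values of the coordinate map
  outside the domain are irrelevant.\<close>

type_synonym ('m, 'n) chart = "'m set \<times> ('m \<Rightarrow> real^'n)"

definition cdom :: "('m, 'n::finite) chart \<Rightarrow> 'm set" where
  "cdom c = fst c"

definition cmap :: "('m, 'n::finite) chart \<Rightarrow> 'm \<Rightarrow> real^'n" where
  "cmap c = snd c"

definition cimg :: "('m, 'n::finite) chart \<Rightarrow> (real^'n) set" where
  "cimg c = cmap c ` cdom c"

definition cinv :: "('m, 'n::finite) chart \<Rightarrow> real^'n \<Rightarrow> 'm" where
  "cinv c = inv_into (cdom c) (cmap c)"

definition transition :: "('m, 'n::finite) chart \<Rightarrow> ('m, 'n) chart \<Rightarrow> real^'n \<Rightarrow> real^'n" where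
  "transition c d = cmap d \<circ> cinv c"

definition smooth_manifold :: "'m::t2_space set \<Rightarrow> ('m, 'n::finite) chart set \<Rightarrow> bool" where
  "smooth_manifold M A \<longleftrightarrow>
     (\<Union>c\<in>A. cdom c) = M \<and>
     (\<forall>c\<in>A. openin (top_of_set M) (cdom c) \<and> open (cimg c) \<and>
             homeomorphism (cdom c) (cimg c) (cmap c) (cinv c)) \<and>
     (\<forall>c\<in>A. \<forall>d\<in>A. smooth_on (cmap c ` (cdom c \<inter> cdom d)) (transition c d))"

text \<open>A \<open>(0,2)\<close>-tensor field is given by its matrix of components in every chart of the atlas, as
  a function of the coordinates, subject to the usual transformation law.  It is set to zero
  wherever it has no meaning, so that equality of tensor fields is equality of functions.\<close>

type_synonym ('m, 'n) tensor = "('m, 'n) chart \<Rightarrow> real^'n \<Rightarrow> real^'n^'n"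

definition sym_tensors :: "('m, 'n::finite) chart set \<Rightarrow> ('m, 'n) tensor set" where
  "sym_tensors A = {h.
     (\<forall>c\<in>A. smooth_on (cimg c) (h c)) \<and>
     (\<forall>c\<in>A. \<forall>x\<in>cimg c. transpose (h c x) = h c x) \<and>
     (\<forall>c\<in>A. \<forall>d\<in>A. \<forall>x\<in>cmap c ` (cdom c \<inter> cdom d).
        let J = matrix (frechet_derivative (transition c d) (at x))
        in h c x = transpose J ** h d (transition c d x) ** J) \<and>
     (\<forall>c x. \<not> (c \<in> A \<and> x \<in> cimg c) \<longrightarrow> h c x = 0)}"

definition riem_metrics :: "('m, 'n::finite) chart set \<Rightarrow> ('m, 'n) tensor set" where
  "riem_metrics A = {g \<in> sym_tensors A.
     \<forall>c\<in>A. \<forall>x\<in>cimg c. \<forall>v. v \<noteq> 0 \<longrightarrow> v \<bullet> (g c x *v v) > 0}"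

definition tadd :: "('m, 'n::finite) tensor \<Rightarrow> ('m, 'n) tensor \<Rightarrow> ('m, 'n) tensor" where
  "tadd h k = (\<lambda>c x. h c x + k c x)"

definition tscale :: "real \<Rightarrow> ('m, 'n::finite) tensor \<Rightarrow> ('m, 'n) tensor" where
  "tscale r h = (\<lambda>c x. r *\<^sub>R h c x)"


section \<open>The Bochner Laplacian\<close>

text \<open>The next four definitions are coordinate formulas; \<open>g\<close> and \<open>h\<close> are matrices of components
  in one chart.  \<open>cov1 g h a i j\<close> is \<open>\<nabla>\<^sub>a h\<^sub>i\<^sub>j\<close> and \<open>cov2 g h a b i j\<close> is
  \<open>(\<nabla>\<^sup>2 h)\<^sub>a\<^sub>b\<^sub>i\<^sub>j = (\<nabla>\<^sub>a (\<nabla>h))\<^sub>b\<^sub>i\<^sub>j\<close>.\<close>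

definition christoffel_symbol ::
  "(real^'n \<Rightarrow> real^'n^'n) \<Rightarrow> 'n::finite \<Rightarrow> 'n \<Rightarrow> 'n \<Rightarrow> real^'n \<Rightarrow> real" where
  "christoffel_symbol g l i j x = (1/2) * (\<Sum>m\<in>UNIV. matrix_inv (g x) $ l $ m *
     (pd i (\<lambda>y. g y $ j $ m) x + pd j (\<lambda>y. g y $ i $ m) x - pd m (\<lambda>y. g y $ i $ j) x))"

definition cov1 :: "(real^'n \<Rightarrow> real^'n^'n) \<Rightarrow> (real^'n \<Rightarrow> real^'n^'n) \<Rightarrow>
    'n::finite \<Rightarrow> 'n \<Rightarrow> 'n \<Rightarrow> real^'n \<Rightarrow> real" where
  "cov1 g h a i j x = pd a (\<lambda>y. h y $ i $ j) x
     - (\<Sum>l\<in>UNIV. christoffel_symbol g l a i x * h x $ l $ j)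
     - (\<Sum>l\<in>UNIV. christoffel_symbol g l a j x * h x $ i $ l)"

definition cov2 :: "(real^'n \<Rightarrow> real^'n^'n) \<Rightarrow> (real^'n \<Rightarrow> real^'n^'n) \<Rightarrow>
    'n::finite \<Rightarrow> 'n \<Rightarrow> 'n \<Rightarrow> 'n \<Rightarrow> real^'n \<Rightarrow> real" where
  "cov2 g h a b i j x = pd a (cov1 g h b i j) x
     - (\<Sum>l\<in>UNIV. christoffel_symbol g l a b x * cov1 g h l i j x)
     - (\<Sum>l\<in>UNIV. christoffel_symbol g l a i x * cov1 g h b l j x)
     - (\<Sum>l\<in>UNIV. christoffel_symbol g l a j x * cov1 g h b i l x)"

definition bochner_local ::
  "(real^'n \<Rightarrow> real^'n^'n) \<Rightarrow> (real^'n \<Rightarrow> real^'n^'n) \<Rightarrow> real^'n \<Rightarrow> real^'n^'n::finite" where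
  "bochner_local g h x =
     (\<chi> i j. - (\<Sum>a\<in>UNIV. \<Sum>b\<in>UNIV. matrix_inv (g x) $ a $ b * cov2 g h a b i j x))"

definition bochner_laplacian ::
  "('m, 'n::finite) chart set \<Rightarrow> ('m, 'n) tensor \<Rightarrow> ('m, 'n) tensor \<Rightarrow> ('m, 'n) tensor" where
  "bochner_laplacian A g h =
     (\<lambda>c x. if c \<in> A \<and> x \<in> cimg c then bochner_local (g c) (h c) x else 0)"

definition sobolev_op ::
  "('m, 'n::finite) chart set \<Rightarrow> nat \<Rightarrow> ('m, 'n) tensor \<Rightarrow> ('m, 'n) tensor \<Rightarrow> ('m, 'n) tensor" where
  "sobolev_op A p g = (\<lambda>h. tadd h (bochner_laplacian A g h)) ^^ p"


section \<open>Integration and weak Riemannian metrics on the space of metrics\<close>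

definition vol :: "('m::t2_space, 'n::finite) chart set \<Rightarrow> ('m, 'n) tensor \<Rightarrow> 'm measure" where
  "vol A g = (THE \<mu>. sets \<mu> = sets (restrict_space borel (\<Union>c\<in>A. cdom c)) \<and>
     (\<forall>c\<in>A. \<forall>B\<in>sets \<mu>. B \<subseteq> cdom c \<longrightarrow>
        emeasure \<mu> B = (\<integral>\<^sup>+x\<in>cmap c ` B. ennreal (sqrt (det (g c x))) \<partial>lborel)))"

text \<open>\<open>g\<^sup>0\<^sub>2(h,k) = Tr(g\<^sup>-\<^sup>1 h g\<^sup>-\<^sup>1 k)\<close> in the coordinates of the chart \<open>c\<close>.  This number does not
  depend on the chart, which is why the choice of a chart in \<open>g02\<close> is immaterial.\<close>

definition g02_local :: "('m, 'n::finite) tensor \<Rightarrow> ('m, 'n) tensor \<Rightarrow> ('m, 'n) tensor \<Rightarrow>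
    ('m, 'n) chart \<Rightarrow> real^'n \<Rightarrow> real" where
  "g02_local g h k c x = trace (matrix_inv (g c x) ** h c x ** matrix_inv (g c x) ** k c x)"

definition g02 :: "('m, 'n::finite) chart set \<Rightarrow> ('m, 'n) tensor \<Rightarrow> ('m, 'n) tensor \<Rightarrow>
    ('m, 'n) tensor \<Rightarrow> 'm \<Rightarrow> real" where
  "g02 A g h k q = (let c = (SOME c. c \<in> A \<and> q \<in> cdom c) in g02_local g h k c (cmap c q))"

type_synonym ('m, 'n) weak_metric =
  "('m, 'n) tensor \<Rightarrow> ('m, 'n) tensor \<Rightarrow> ('m, 'n) tensor \<Rightarrow> real"

definition L2_metric ::
  "('m::t2_space, 'n::finite) chart set \<Rightarrow> ('m, 'n) weak_metric" where
  "L2_metric A g h k = (\<integral>q. g02 A g h k q \<partial>(vol A g))"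

definition sobolev_metric ::
  "('m::t2_space, 'n::finite) chart set \<Rightarrow> nat \<Rightarrow> ('m, 'n) weak_metric" where
  "sobolev_metric A p g h k = (\<integral>q. g02 A g (sobolev_op A p g h) k q \<partial>(vol A g))"

text \<open>The operator \<open>P\<^sub>g\<close> with \<open>G\<^sub>g(h,k) = \<integral> g\<^sup>0\<^sub>2(P\<^sub>g h, k) vol(g)\<close>; it is unique because the
  \<open>L\<^sup>2\<close>-metric is positive definite.  For the Sobolev metric this is \<open>(1 + \<Delta>\<^sup>g)\<^sup>p\<close>.\<close>

definition metric_op :: "('m::t2_space, 'n::finite) chart set \<Rightarrow> ('m, 'n) weak_metric \<Rightarrow>
    ('m, 'n) tensor \<Rightarrow> ('m, 'n) tensor \<Rightarrow> ('m, 'n) tensor" where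
  "metric_op A G g h =
     (THE s. s \<in> sym_tensors A \<and> (\<forall>k\<in>sym_tensors A. G g h k = L2_metric A g s k))"


section \<open>The geodesic equation\<close>

text \<open>\<open>op_deriv P g m h\<close> is \<open>(D\<^bsub>(g,m)\<^esub> P) h\<close>, and \<open>op_deriv_adjoint A P g h k\<close> is
  \<open>(D\<^bsub>(g,\<cdot>)\<^esub> P h)\<^sup>*(k)\<close>.\<close>

definition op_deriv :: "(('m, 'n::finite) tensor \<Rightarrow> ('m, 'n) tensor \<Rightarrow> ('m, 'n) tensor) \<Rightarrow>
    ('m, 'n) tensor \<Rightarrow> ('m, 'n) tensor \<Rightarrow> ('m, 'n) tensor \<Rightarrow> ('m, 'n) tensor" where
  "op_deriv P g m h =
     (\<lambda>c x. vector_derivative (\<lambda>s. P (tadd g (tscale s m)) h c x) (at 0))"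

definition op_deriv_adjoint :: "('m::t2_space, 'n::finite) chart set \<Rightarrow>
    (('m, 'n) tensor \<Rightarrow> ('m, 'n) tensor \<Rightarrow> ('m, 'n) tensor) \<Rightarrow>
    ('m, 'n) tensor \<Rightarrow> ('m, 'n) tensor \<Rightarrow> ('m, 'n) tensor \<Rightarrow> ('m, 'n) tensor" where
  "op_deriv_adjoint A P g h k =
     (THE a. a \<in> sym_tensors A \<and>
        (\<forall>m\<in>sym_tensors A. L2_metric A g (op_deriv P g m h) k = L2_metric A g m a))"

definition geodesic_rhs :: "('m::t2_space, 'n::finite) chart set \<Rightarrow>
    (('m, 'n) tensor \<Rightarrow> ('m, 'n) tensor \<Rightarrow> ('m, 'n) tensor) \<Rightarrow>
    ('m, 'n) tensor \<Rightarrow> ('m, 'n) tensor \<Rightarrow> ('m, 'n) tensor" where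
  "geodesic_rhs A P g h = (\<lambda>c x.
     (1/2) *\<^sub>R op_deriv_adjoint A P g h h c x
     + ((1/4) * g02_local g (P g h) h c x) *\<^sub>R g c x
     + (1/2) *\<^sub>R (h c x ** matrix_inv (g c x) ** P g h c x)
     + (1/2) *\<^sub>R (P g h c x ** matrix_inv (g c x) ** h c x)
     - ((1/2) * trace (matrix_inv (g c x) ** h c x)) *\<^sub>R P g h c x)"

text \<open>A map from an open subset of a Euclidean space to the Frechet space of symmetric tensor
  fields is smooth iff it is jointly smooth in the parameter and the coordinates.\<close>

definition smooth_family :: "('m, 'n::finite) chart set \<Rightarrow> 'e::euclidean_space set \<Rightarrow>
    ('e \<Rightarrow> ('m, 'n) tensor) \<Rightarrow> bool" where
  "smooth_family A U \<phi> \<longleftrightarrow> (\<forall>u\<in>U. \<phi> u \<in> sym_tensors A) \<and>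
     (\<forall>c\<in>A. smooth_on (U \<times> cimg c) (\<lambda>(u, x). \<phi> u c x))"

definition velocity :: "(real \<Rightarrow> ('m, 'n::finite) tensor) \<Rightarrow> real \<Rightarrow> ('m, 'n) tensor" where
  "velocity \<gamma> t = (\<lambda>c x. vector_derivative (\<lambda>s. \<gamma> s c x) (at t))"

definition geodesic_on :: "('m::t2_space, 'n::finite) chart set \<Rightarrow> ('m, 'n) weak_metric \<Rightarrow>
    real set \<Rightarrow> (real \<Rightarrow> ('m, 'n) tensor) \<Rightarrow> bool" where
  "geodesic_on A G I \<gamma> \<longleftrightarrow>
     open I \<and> is_interval I \<and> I \<noteq> {} \<and>
     smooth_family A I \<gamma> \<and> (\<forall>t\<in>I. \<gamma> t \<in> riem_metrics A) \<and>
     (\<forall>t\<in>I. \<forall>c\<in>A. \<forall>x\<in>cimg c.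
        ((\<lambda>s. metric_op A G (\<gamma> s) (velocity \<gamma> s) c x) has_vector_derivative
           geodesic_rhs A (metric_op A G) (\<gamma> t) (velocity \<gamma> t) c x) (at t))"

definition geodesically_incomplete ::
  "('m::t2_space, 'n::finite) chart set \<Rightarrow> ('m, 'n) weak_metric \<Rightarrow> bool" where
  "geodesically_incomplete A G \<longleftrightarrow> (\<exists>I \<gamma>. geodesic_on A G I \<gamma> \<and>
     \<not> (\<exists>\<gamma>'. geodesic_on A G UNIV \<gamma>' \<and> (\<forall>t\<in>I. \<gamma>' t = \<gamma> t)))"

text \<open>By the product rule \<open>(P\<^sub>g g\<^sub>t)\<^sub>t = P\<^sub>g g\<^sub>t\<^sub>t + (D\<^bsub>(g,g\<^sub>t)\<^esub> P) g\<^sub>t\<close>, so \<open>geodesic_accel A G g h\<close> is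
  \<open>\<Gamma>\<^sub>g(h,h)\<close>; the symmetric bilinear \<open>\<Gamma>\<^sub>g\<close> is recovered by polarization.\<close>

definition geodesic_accel :: "('m::t2_space, 'n::finite) chart set \<Rightarrow> ('m, 'n) weak_metric \<Rightarrow>
    ('m, 'n) tensor \<Rightarrow> ('m, 'n) tensor \<Rightarrow> ('m, 'n) tensor" where
  "geodesic_accel A G g h = (THE l. l \<in> sym_tensors A \<and>
     (\<forall>c\<in>A. \<forall>x\<in>cimg c.
        metric_op A G g l c x + op_deriv (metric_op A G) g h h c x
        = geodesic_rhs A (metric_op A G) g h c x))"

definition Gamma_form :: "('m::t2_space, 'n::finite) chart set \<Rightarrow> ('m, 'n) weak_metric \<Rightarrow>
    ('m, 'n) tensor \<Rightarrow> ('m, 'n) tensor \<Rightarrow> ('m, 'n) tensor \<Rightarrow> ('m, 'n) tensor" where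
  "Gamma_form A G g h k = tscale (1/4)
     (tadd (geodesic_accel A G g (tadd h k))
           (tscale (-1) (geodesic_accel A G g (tadd h (tscale (-1) k)))))"


section \<open>Totally geodesic submanifolds\<close>

text \<open>The Frechet (i.e. \<open>C\<^sup>\<infinity>\<close>) topology: uniform convergence on compact sets of all partial
  derivatives of the components.\<close>

definition Cinf_topology :: "('m, 'n::finite) chart set \<Rightarrow> ('m, 'n) tensor topology" where
  "Cinf_topology A = topology_generated_by
     {{k \<in> sym_tensors A. \<forall>x\<in>K. norm (pds is (k c) x - pds is (h c) x) < \<epsilon>} | h c K is \<epsilon>.
        h \<in> sym_tensors A \<and> c \<in> A \<and> compact K \<and> K \<subseteq> cimg c \<and> \<epsilon> > 0}"

text \<open>Submanifolds of the space of metrics, of finite dimension \<open>DIM('e)\<close>: locally they are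
  topologically embedded images of smooth immersions.  As finite-dimensional subspaces
  of a Frechet space are complemented, this agrees with the definition by slice charts.\<close>

definition submanifold_of_metrics ::
  "'e::euclidean_space itself \<Rightarrow> ('m, 'n::finite) chart set \<Rightarrow> ('m, 'n) tensor set \<Rightarrow> bool" where
  "submanifold_of_metrics E A N \<longleftrightarrow> N \<subseteq> riem_metrics A \<and>
     (\<forall>g\<in>N. \<exists>(U :: 'e set) \<phi>. open U \<and> g \<in> \<phi> ` U \<and>
        openin (subtopology (Cinf_topology A) N) (\<phi> ` U) \<and>
        homeomorphic_map (top_of_set U) (subtopology (Cinf_topology A) (\<phi> ` U)) \<phi> \<and>
        smooth_family A U \<phi> \<and>
        (\<forall>u\<in>U. \<forall>v. v \<noteq> 0 \<longrightarrow>
           (\<exists>c\<in>A. \<exists>x\<in>cimg c. frechet_derivative (\<lambda>u. \<phi> u c x) (at u) v \<noteq> 0)))"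

definition tangent_space ::
  "('m, 'n::finite) chart set \<Rightarrow> ('m, 'n) tensor set \<Rightarrow> ('m, 'n) tensor \<Rightarrow> ('m, 'n) tensor set" where
  "tangent_space A N g = {h. \<exists>\<epsilon>>0. \<exists>\<gamma>. smooth_family A {-\<epsilon><..<\<epsilon>} \<gamma> \<and>
     (\<forall>t\<in>{-\<epsilon><..<\<epsilon>}. \<gamma> t \<in> N) \<and> \<gamma> 0 = g \<and> velocity \<gamma> 0 = h}"

definition totally_geodesic :: "'e::euclidean_space itself \<Rightarrow> ('m::t2_space, 'n::finite) chart set \<Rightarrow>
    ('m, 'n) weak_metric \<Rightarrow> ('m, 'n) tensor set \<Rightarrow> bool" where
  "totally_geodesic E A G N \<longleftrightarrow> submanifold_of_metrics E A N \<and>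
     (\<forall>g\<in>N. \<forall>h\<in>tangent_space A N g. \<forall>k\<in>tangent_space A N g.
        Gamma_form A G g h k \<in> tangent_space A N g)"

end

theory Submission
  imports Defs
begin

text \<open>Write \<open>P\<^sub>g = (1 + \<Delta>\<^sup>g)\<^sup>p\<close>.  Everything rests on the fact that a metric is parallel for its own
  Levi-Civita connection (\<open>cov_deriv_metric\<close>).  Hence \<open>\<Delta>\<^sup>g g = 0\<close> and \<open>P\<^sub>g(ag) = ag\<close> for every number
  \<open>a\<close> (\<open>sobolev_op_scaled_metric\<close>), so on multiples of \<open>g\<close> the terms of the geodesic equation in which
  \<open>P\<close> is not differentiated are those of the \<open>L\<^sup>2\<close>-metric, where \<open>P\<close> is the identity.

  The adjoint term vanishes as well.  For a tensor field \<open>m\<close> let \<open>P(s)\<close> be the operator of the metric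
  \<open>g + sm\<close>.  As \<open>P(s)\<close> fixes \<open>g + sm\<close>, it sends \<open>g\<close> to \<open>g + s(m - P(s) m)\<close>, and the derivative of \<open>P\<close>
  at \<open>g\<close> in the direction \<open>m\<close> maps \<open>g\<close> to \<open>m - P\<^sub>g m\<close> (\<open>op_deriv_metric\<close>).  The pairing of this with \<open>g\<close>
  is zero, because \<open>\<langle>\<Delta>k, g\<rangle> = \<Delta> Tr k\<close> is a divergence and integrates to zero over \<open>M\<close> for every \<open>k\<close>
  (\<open>L2_bochner\<close>, \<open>L2_sobolev_op\<close>, \<open>op_deriv_adjoint_metric\<close>).  What remains is
  \<open>\<Gamma>\<^sub>g(ag, bg) = ab(1 - n/4) g\<close> (\<open>geodesic_rhs_metric\<close>, \<open>Gamma_form_metric\<close>).  Since the tangent space of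
  the ray at \<open>g\<close> is \<open>\<real>g\<close> (\<open>tangent_space_ray\<close>), the ray is totally geodesic, and for \<open>r(t) g\<close> the geodesic
  equation becomes the ordinary differential equation (\<open>geodesic_on_ray\<close>).  Its solution \<open>(1 + t)\<close> to
  the power \<open>4/n\<close> reaches the zero tensor at time \<open>-1\<close>, so the geodesic cannot be extended
  (\<open>incomplete\<close>).

  The objects in the equation are given by unique existence, and this is where most of the work lies.

  \<^item> \<open>\<Delta>\<^sup>g\<close> maps tensor fields to tensor fields: the Christoffel symbols of two charts are related by
    the usual law since both describe the unique torsion-free metric connection
    (\<open>levi_civita_unique\<close>, \<open>pull_connection_eq\<close>, \<open>bochner_pull\<close>).

  \<^item> The Riemannian volume exists: the densities \<open>\<surd>det g\<close> of two charts agree on overlaps by the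
    change of variables formula (\<open>chart_vol_compat\<close>, \<open>is_vol_vol\<close>).  Every non-empty open set has
    positive volume, so the \<open>L\<^sup>2\<close>-metric is definite and determines \<open>P\<^sub>g\<close> and the adjoint
    (\<open>L2_definite\<close>, \<open>metric_op_sobolev\<close>).

  \<^item> \<open>\<Gamma>\<^sub>g\<close> is determined because \<open>P\<^sub>g\<close> is injective.  If \<open>h + \<Delta>h = 0\<close>, then the Bochner formula gives
    \<open>\<Delta>|h|\<^sup>2 \<le> 2\<langle>\<Delta>h, h\<rangle> = -2|h|\<^sup>2\<close>, and integration shows \<open>h = 0\<close>
    (\<open>bochner_norm_le\<close>, \<open>one_plus_bochner_inj\<close>).

  \<^item> Riemannian metrics exist, by adding Euclidean metrics of charts cut off with bump functions
    (\<open>metric_exists\<close>).\<close>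

section \<open>Smooth functions on open sets\<close>

lemma C_k_on_subset: "C_k_on k S f \<Longrightarrow> T \<subseteq> S \<Longrightarrow> C_k_on k T f"
  by (induction k arbitrary: f) (auto intro: continuous_on_subset)

lemma smooth_on_subset: "smooth_on S f \<Longrightarrow> T \<subseteq> S \<Longrightarrow> smooth_on T f"
  unfolding smooth_on_def using C_k_on_subset by blast

lemma C_k_on_cong:
  assumes "open S" "\<And>x. x \<in> S \<Longrightarrow> f x = g x" "C_k_on k S f"
  shows "C_k_on k S g"
  using assms(2,3)
proof (induction k arbitrary: f g)
  case 0
  then show ?case by (simp cong: continuous_on_cong)
next
  case (Suc k)
  have hd: "(g has_derivative frechet_derivative f (at x)) (at x)" if "x \<in> S" for x
  proof (rule has_derivative_transform_within_open[OF _ assms(1) that])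
    show "(f has_derivative frechet_derivative f (at x)) (at x)"
      using Suc.prems(2) that by (simp add: frechet_derivative_works[symmetric])
  qed (use Suc.prems(1) in blast)
  show ?case
  proof (simp, intro conjI ballI allI)
    fix x assume "x \<in> S" then show "g differentiable at x"
      using hd by (auto simp: differentiable_def)
  next
    fix v
    have 1: "C_k_on k S (\<lambda>x. frechet_derivative f (at x) v)" using Suc.prems by simp
    have 2: "frechet_derivative f (at x) v = frechet_derivative g (at x) v" if "x \<in> S" for x
      using frechet_derivative_at[OF hd[OF that]] by (rule fun_cong)
    show "C_k_on k S (\<lambda>x. frechet_derivative g (at x) v)"
      by (rule Suc.IH[OF 2 1])
  qed
qed

lemma smooth_on_cong:
  assumes "open S" "\<And>x. x \<in> S \<Longrightarrow> f x = g x" "smooth_on S f"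
  shows "smooth_on S g"
  using assms C_k_on_cong unfolding smooth_on_def by blast

lemma C_k_on_SucI:
  assumes "open S" "\<And>x. x \<in> S \<Longrightarrow> (f has_derivative D x) (at x)"
    "\<And>v. C_k_on k S (\<lambda>x. D x v)"
  shows "C_k_on (Suc k) S f"
proof -
  have D: "frechet_derivative f (at x) = D x" if "x \<in> S" for x
    using frechet_derivative_at[OF assms(2)[OF that]] by simp
  have "C_k_on k S (\<lambda>x. frechet_derivative f (at x) v)" for v
    by (rule C_k_on_cong[OF assms(1) _ assms(3)[of v]]) (simp add: D)
  then show ?thesis using assms(2) by (auto simp: differentiable_def)
qed

lemma C_k_on_SucD:
  assumes "C_k_on (Suc k) S f"
  shows "\<And>x. x \<in> S \<Longrightarrow> (f has_derivative frechet_derivative f (at x)) (at x)"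
    "\<And>v. C_k_on k S (\<lambda>x. frechet_derivative f (at x) v)"
  using assms by (auto simp: frechet_derivative_works[symmetric])

lemma C_k_on_Suc_imp: "C_k_on (Suc k) S f \<Longrightarrow> C_k_on k S f"
proof (induction k arbitrary: f)
  case 0
  then show ?case
    by (auto intro!: continuous_at_imp_continuous_on differentiable_imp_continuous_within)
next
  case (Suc k)
  have "C_k_on k S (\<lambda>x. frechet_derivative f (at x) v)" for v
    by (rule Suc.IH) (rule C_k_on_SucD(2)[OF Suc.prems])
  then show ?case using Suc.prems by simp
qed

lemma smooth_onI:
  assumes "open S" "\<And>x. x \<in> S \<Longrightarrow> (f has_derivative D x) (at x)"
    "\<And>v. smooth_on S (\<lambda>x. D x v)"
  shows "smooth_on S f"
  unfolding smooth_on_def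
proof
  fix k show "C_k_on k S f"
  proof (rule C_k_on_Suc_imp, rule C_k_on_SucI[OF assms(1,2)])
    show "C_k_on k S (\<lambda>x. D x v)" for v using assms(3)[of v] by (auto simp: smooth_on_def)
  qed
qed

lemma smooth_onD:
  assumes "smooth_on S f"
  shows smooth_on_continuous: "continuous_on S f"
    and smooth_on_has_derivative:
      "\<And>x. x \<in> S \<Longrightarrow> (f has_derivative frechet_derivative f (at x)) (at x)"
    and smooth_on_differentiable: "\<And>x. x \<in> S \<Longrightarrow> f differentiable at x"
    and smooth_on_derivative: "\<And>v. smooth_on S (\<lambda>x. frechet_derivative f (at x) v)"
proof -
  have 1: "C_k_on (Suc k) S f" for k using assms unfolding smooth_on_def by blast
  show "continuous_on S f" using assms by (auto simp: smooth_on_def dest: spec[where x=0])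
  show "(f has_derivative frechet_derivative f (at x)) (at x)" if "x \<in> S" for x
    using C_k_on_SucD(1)[OF 1 that] .
  then show "f differentiable at x" if "x \<in> S" for x
    using that by (auto simp: differentiable_def)
  show "smooth_on S (\<lambda>x. frechet_derivative f (at x) v)" for v
    unfolding smooth_on_def using C_k_on_SucD(2)[OF 1] by blast
qed

lemma smooth_on_open_cover:
  assumes "\<And>x. x \<in> S \<Longrightarrow> \<exists>T. open T \<and> x \<in> T \<and> smooth_on T f"
  shows "smooth_on S f"
  unfolding smooth_on_def
proof
  fix k
  have "\<forall>x\<in>S. \<exists>T. open T \<and> x \<in> T \<and> C_k_on k T f"
    using assms by (meson smooth_on_def)
  then show "C_k_on k S f"
  proof (induction k arbitrary: f)
    case 0
    have "continuous (at x) f" if xS: "x \<in> S" for x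
    proof -
      obtain T where "open T" "x \<in> T" "continuous_on T f"
        using 0 xS by auto
      then show ?thesis by (simp add: continuous_on_eq_continuous_at)
    qed
    then show ?case by (simp add: continuous_at_imp_continuous_on)
  next
    case (Suc k)
    have "\<forall>x\<in>S. \<exists>T. open T \<and> x \<in> T \<and> C_k_on k T (\<lambda>x. frechet_derivative f (at x) v)" for v
    proof
      fix x assume "x \<in> S"
      then obtain T where "open T" "x \<in> T" "C_k_on (Suc k) T f" using Suc.prems by auto
      then show "\<exists>T. open T \<and> x \<in> T \<and> C_k_on k T (\<lambda>x. frechet_derivative f (at x) v)"
        by (intro exI[of _ T]) (simp add: C_k_on_SucD(2))
    qed
    then have "C_k_on k S (\<lambda>x. frechet_derivative f (at x) v)" for v
      by (rule Suc.IH)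
    moreover have "f differentiable at x" if "x \<in> S" for x
      using Suc.prems that by auto
    ultimately show ?case by simp
  qed
qed

lemma smooth_on_const: "smooth_on S (\<lambda>x. c)"
proof -
  have "C_k_on k S (\<lambda>x. c)" for k
    by (induction k arbitrary: c) auto
  then show ?thesis by (auto simp: smooth_on_def)
qed

lemma smooth_on_bounded_linear:
  assumes "open S" "bounded_linear L" "smooth_on S f"
  shows "smooth_on S (\<lambda>x. L (f x))"
proof -
  have "C_k_on k S f \<Longrightarrow> C_k_on k S (\<lambda>x. L (f x))" for k f
  proof (induction k arbitrary: f)
    case 0
    then show ?case by (auto intro: bounded_linear.continuous_on[OF assms(2)])
  next
    case (Suc k)
    show ?case
      by (rule C_k_on_SucI[OF assms(1), where D="\<lambda>x v. L (frechet_derivative f (at x) v)"])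
        (use Suc in \<open>auto intro!: bounded_linear.has_derivative[OF assms(2)]
           simp: frechet_derivative_works[symmetric]\<close>)
  qed
  then show ?thesis using assms(3) by (auto simp: smooth_on_def)
qed

lemma smooth_on_ident: "open S \<Longrightarrow> smooth_on S (\<lambda>x. x)"
  by (rule smooth_onI[where D="\<lambda>x v. v"]) (auto intro: smooth_on_const)

lemma smooth_on_linear: "open S \<Longrightarrow> bounded_linear L \<Longrightarrow> smooth_on S L"
  using smooth_on_bounded_linear[OF _ _ smooth_on_ident] by blast

lemma C_k_on_add:
  assumes "open S" "C_k_on k S f" "C_k_on k S g"
  shows "C_k_on k S (\<lambda>x. f x + g x)"
  using assms(2,3)
proof (induction k arbitrary: f g)
  case 0
  then show ?case by (auto intro: continuous_on_add)
next
  case (Suc k)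
  show ?case
    by (rule C_k_on_SucI[OF assms(1),
        where D="\<lambda>x v. frechet_derivative f (at x) v + frechet_derivative g (at x) v"])
      (use Suc in \<open>auto intro!: has_derivative_add simp: frechet_derivative_works[symmetric]\<close>)
qed

lemma smooth_on_add: "open S \<Longrightarrow> smooth_on S f \<Longrightarrow> smooth_on S g \<Longrightarrow> smooth_on S (\<lambda>x. f x + g x)"
  using C_k_on_add unfolding smooth_on_def by blast

lemma smooth_on_sum:
  assumes "open S" "\<And>i. i \<in> I \<Longrightarrow> smooth_on S (f i)"
  shows "smooth_on S (\<lambda>x. \<Sum>i\<in>I. f i x)"
  using assms(2)
  by (induction I rule: infinite_finite_induct)
    (auto intro!: smooth_on_const smooth_on_add[OF assms(1)])

lemma C_k_on_bilinear:
  assumes "open S" "bounded_bilinear B" "C_k_on k S f" "C_k_on k S g"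
  shows "C_k_on k S (\<lambda>x. B (f x) (g x))"
  using assms(3,4)
proof (induction k arbitrary: f g)
  case 0
  then show ?case by (auto intro: bounded_bilinear.continuous_on[OF assms(2)])
next
  case (Suc k)
  note fg = C_k_on_SucD[OF Suc.prems(1)] C_k_on_SucD[OF Suc.prems(2)]
  show ?case
    by (rule C_k_on_SucI[OF assms(1),
        where D="\<lambda>x v. B (f x) (frechet_derivative g (at x) v) + B (frechet_derivative f (at x) v) (g x)"])
      (use fg C_k_on_Suc_imp[OF Suc.prems(1)] C_k_on_Suc_imp[OF Suc.prems(2)] Suc.IH in
       \<open>auto intro!: bounded_bilinear.FDERIV[OF assms(2)] C_k_on_add[OF assms(1)]\<close>)
qed

lemma smooth_on_bilinear:
  "open S \<Longrightarrow> bounded_bilinear B \<Longrightarrow> smooth_on S f \<Longrightarrow> smooth_on S g \<Longrightarrow> smooth_on S (\<lambda>x. B (f x) (g x))"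
  using C_k_on_bilinear unfolding smooth_on_def by blast

lemma smooth_on_scaleR:
  "open S \<Longrightarrow> smooth_on S f \<Longrightarrow> smooth_on S g \<Longrightarrow> smooth_on S (\<lambda>x. f x *\<^sub>R g x)"
  by (rule smooth_on_bilinear[OF _ bounded_bilinear_scaleR])

lemma smooth_on_mult:
  fixes f g :: "'a::euclidean_space \<Rightarrow> 'b::real_normed_algebra"
  shows "open S \<Longrightarrow> smooth_on S f \<Longrightarrow> smooth_on S g \<Longrightarrow> smooth_on S (\<lambda>x. f x * g x)"
  by (rule smooth_on_bilinear[OF _ bounded_bilinear_mult])

lemma smooth_on_minus: "open S \<Longrightarrow> smooth_on S f \<Longrightarrow> smooth_on S (\<lambda>x. - f x)"
  using smooth_on_bounded_linear[OF _ bounded_linear_minus[OF bounded_linear_ident]] by auto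

lemma smooth_on_diff: "open S \<Longrightarrow> smooth_on S f \<Longrightarrow> smooth_on S g \<Longrightarrow> smooth_on S (\<lambda>x. f x - g x)"
  using smooth_on_add[OF _ _ smooth_on_minus] by fastforce

lemma smooth_on_prod:
  fixes f :: "'i \<Rightarrow> 'a::euclidean_space \<Rightarrow> 'b::{real_normed_algebra_1,comm_ring_1}"
  assumes "open S" "\<And>i. i \<in> I \<Longrightarrow> smooth_on S (f i)"
  shows "smooth_on S (\<lambda>x. \<Prod>i\<in>I. f i x)"
  using assms(2)
  by (induction I rule: infinite_finite_induct)
    (auto intro!: smooth_on_const smooth_on_mult[OF assms(1)])

text \<open>The derivative of \<open>1/f\<close> is \<open>-f'\<close> times the square of \<open>1/f\<close>, so the order of smoothness of \<open>1/f\<close>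
  bootstraps.  The same works for the square root below.\<close>

lemma C_k_on_inverse:
  fixes f :: "'a::euclidean_space \<Rightarrow> real"
  assumes "open S" "\<And>x. x \<in> S \<Longrightarrow> f x \<noteq> 0"
  shows "C_k_on k S f \<Longrightarrow> C_k_on k S (\<lambda>x. inverse (f x))"
  proof (induction k)
    case 0
    then show ?case using assms(2) by (auto intro: continuous_on_inverse)
  next
    case (Suc k)
    have 1: "C_k_on k S (\<lambda>x. inverse (f x))"
      using Suc.IH C_k_on_Suc_imp[OF Suc.prems] .
    show ?case
    proof (rule C_k_on_SucI[OF assms(1),
          where D="\<lambda>x v. (- frechet_derivative f (at x) v) * (inverse (f x) * inverse (f x))"])
      fix x assume "x \<in> S"
      from Deriv.has_derivative_inverse[OF assms(2)[OF this] C_k_on_SucD(1)[OF Suc.prems this]]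
      show "((\<lambda>x. inverse (f x)) has_derivative
          (\<lambda>v. (- frechet_derivative f (at x) v) * (inverse (f x) * inverse (f x)))) (at x)"
        by (simp add: mult.commute mult.left_commute)
    next
      fix v
      have "C_k_on k S (\<lambda>x. - frechet_derivative f (at x) v)"
        using C_k_on_bilinear[OF assms(1) bounded_bilinear_mult _ C_k_on_SucD(2)[OF Suc.prems], of "\<lambda>_. -1" v]
          smooth_on_const[of S "-1::real"] by (auto simp: smooth_on_def)
      then show "C_k_on k S (\<lambda>x. (- frechet_derivative f (at x) v) * (inverse (f x) * inverse (f x)))"
        by (intro C_k_on_bilinear[OF assms(1) bounded_bilinear_mult] 1)
    qed
  qed

lemma smooth_on_inverse:
  fixes f :: "'a::euclidean_space \<Rightarrow> real"
  shows "open S \<Longrightarrow> smooth_on S f \<Longrightarrow> (\<And>x. x \<in> S \<Longrightarrow> f x \<noteq> 0) \<Longrightarrow> smooth_on S (\<lambda>x. inverse (f x))"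
  using C_k_on_inverse unfolding smooth_on_def by blast

lemma smooth_on_sqrt:
  fixes f :: "'a::euclidean_space \<Rightarrow> real"
  assumes "open S" "smooth_on S f" "\<And>x. x \<in> S \<Longrightarrow> f x > 0"
  shows "smooth_on S (\<lambda>x. sqrt (f x))"
proof -
  have "C_k_on k S f \<Longrightarrow> C_k_on k S (\<lambda>x. sqrt (f x))" for k
  proof (induction k)
    case 0
    then show ?case by (auto intro: continuous_on_real_sqrt)
  next
    case (Suc k)
    have 1: "C_k_on k S (\<lambda>x. inverse (sqrt (f x)))"
      using C_k_on_inverse[OF assms(1) _ Suc.IH[OF C_k_on_Suc_imp[OF Suc.prems]]] assms(3) by force
    show ?case
    proof (rule C_k_on_SucI[OF assms(1),
          where D="\<lambda>x v. frechet_derivative f (at x) v *\<^sub>R ((1/2) *\<^sub>R inverse (sqrt (f x)))"])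
      fix x assume "x \<in> S"
      from has_derivative_real_sqrt[OF assms(3)[OF this] C_k_on_SucD(1)[OF Suc.prems this]]
      show "((\<lambda>x. sqrt (f x)) has_derivative
          (\<lambda>v. frechet_derivative f (at x) v *\<^sub>R ((1/2) *\<^sub>R inverse (sqrt (f x))))) (at x)"
        by (simp add: field_simps)
    next
      fix v
      have "C_k_on k S (\<lambda>x. 1/2 :: real)"
        using smooth_on_const by (auto simp: smooth_on_def)
      then show "C_k_on k S (\<lambda>x. frechet_derivative f (at x) v *\<^sub>R ((1/2) *\<^sub>R inverse (sqrt (f x))))"
        by (intro C_k_on_bilinear[OF assms(1) bounded_bilinear_scaleR] 1 C_k_on_SucD(2)[OF Suc.prems])
    qed
  qed
  then show ?thesis using assms(2) by (auto simp: smooth_on_def)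
qed

lemma smooth_on_divide:
  fixes f g :: "'a::euclidean_space \<Rightarrow> real"
  shows "open S \<Longrightarrow> smooth_on S f \<Longrightarrow> smooth_on S g \<Longrightarrow> (\<And>x. x \<in> S \<Longrightarrow> g x \<noteq> 0) \<Longrightarrow>
    smooth_on S (\<lambda>x. f x / g x)"
  by (simp add: divide_inverse smooth_on_mult smooth_on_inverse)

text \<open>By the chain rule the derivative of \<open>f \<circ> g\<close> is a combination of functions \<open>(\<partial>\<^sub>b f) \<circ> g\<close> with smooth
  coefficients, and these fall under the induction hypothesis if \<open>f\<close> is kept arbitrary.\<close>

lemma smooth_on_compose:
  fixes f :: "'b::euclidean_space \<Rightarrow> 'c::real_normed_vector" and g :: "'a::euclidean_space \<Rightarrow> 'b"
  assumes "open S" "open T" "smooth_on S g" "smooth_on T f" "\<And>x. x \<in> S \<Longrightarrow> g x \<in> T"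
  shows "smooth_on S (\<lambda>x. f (g x))"
proof -
  have "C_k_on k T f \<Longrightarrow> C_k_on k S (\<lambda>x. f (g x))" for k
  proof (induction k arbitrary: f)
    case 0
    then show ?case
      using smooth_on_continuous[OF assms(3)] assms(5)
      by (auto intro: continuous_on_compose2)
  next
    case (Suc k)
    note f = C_k_on_SucD[OF Suc.prems] and g = smooth_on_has_derivative[OF assms(3)]
    let ?D = "\<lambda>x v. \<Sum>b\<in>Basis. (frechet_derivative g (at x) v \<bullet> b) *\<^sub>R frechet_derivative f (at (g x)) b"
    show ?case
    proof (rule C_k_on_SucI[OF assms(1), where D="?D"])
      fix x assume x: "x \<in> S"
      have lin: "linear (frechet_derivative f (at (g x)))"
        using f(1)[OF assms(5)[OF x]] has_derivative_linear by blast
      have "((\<lambda>x. f (g x)) has_derivative (\<lambda>v. frechet_derivative f (at (g x)) (frechet_derivative g (at x) v))) (at x)"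
        using diff_chain_at[OF g[OF x] f(1)[OF assms(5)[OF x]]] by (simp add: o_def)
      moreover have "frechet_derivative f (at (g x)) w = (\<Sum>b\<in>Basis. (w \<bullet> b) *\<^sub>R frechet_derivative f (at (g x)) b)" for w
      proof -
        have "frechet_derivative f (at (g x)) w = frechet_derivative f (at (g x)) (\<Sum>b\<in>Basis. (w \<bullet> b) *\<^sub>R b)"
          by (simp add: euclidean_representation)
        then show ?thesis by (simp add: linear_sum[OF lin] linear_cmul[OF lin])
      qed
      then have "(\<lambda>v. frechet_derivative f (at (g x)) (frechet_derivative g (at x) v)) = ?D x"
        by (intro ext)
      ultimately show "((\<lambda>x. f (g x)) has_derivative ?D x) (at x)"
        by (rule back_subst)
    next
      fix v
      have "C_k_on k S (\<lambda>x. frechet_derivative g (at x) v \<bullet> b)" for b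
        using smooth_on_bounded_linear[OF assms(1) bounded_linear_inner_left smooth_on_derivative[OF assms(3)]]
        by (auto simp: smooth_on_def)
      then have 1: "C_k_on k S (\<lambda>x. (frechet_derivative g (at x) v \<bullet> b) *\<^sub>R frechet_derivative f (at (g x)) b)" for b
        by (intro C_k_on_bilinear[OF assms(1) bounded_bilinear_scaleR] Suc.IH f(2))
      have "C_k_on k S (\<lambda>x. \<Sum>b\<in>B. (frechet_derivative g (at x) v \<bullet> b) *\<^sub>R frechet_derivative f (at (g x)) b)" for B
        by (induction B rule: infinite_finite_induct)
          (use smooth_on_const[of S 0] 1 in \<open>auto simp: smooth_on_def intro!: C_k_on_add[OF assms(1)]\<close>)
      then show "C_k_on k S (\<lambda>x. ?D x v)" .
    qed
  qed
  then show ?thesis using assms(4) by (auto simp: smooth_on_def)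
qed

lemma smooth_on_Pair:
  assumes "open S" "smooth_on S f" "smooth_on S g"
  shows "smooth_on S (\<lambda>x. (f x, g x))"
proof -
  have "smooth_on S (\<lambda>x. (f x, 0) + (0, g x))"
    by (intro smooth_on_add[OF assms(1)]
        smooth_on_bounded_linear[OF assms(1) bounded_linear_Pair[OF bounded_linear_ident bounded_linear_zero] assms(2)]
        smooth_on_bounded_linear[OF assms(1) bounded_linear_Pair[OF bounded_linear_zero bounded_linear_ident] assms(3)])
  then show ?thesis by simp
qed

lemma smooth_on_vec_iff:
  fixes f :: "'a::euclidean_space \<Rightarrow> ('b::euclidean_space)^'n"
  assumes "open S"
  shows "smooth_on S f \<longleftrightarrow> (\<forall>i. smooth_on S (\<lambda>x. f x $ i))"
proof (intro iffI allI)
  show "smooth_on S (\<lambda>x. f x $ i)" if "smooth_on S f" for i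
    using smooth_on_bounded_linear[OF assms bounded_linear_vec_nth that] .
next
  assume *: "\<forall>i. smooth_on S (\<lambda>x. f x $ i)"
  have bl: "bounded_linear (\<lambda>y. axis i y :: 'b^'n)" for i
    unfolding linear_conv_bounded_linear[symmetric] linear_iff by (simp add: axis_def vec_eq_iff)
  have "smooth_on S (\<lambda>x. \<Sum>i\<in>UNIV. axis i (f x $ i) :: 'b^'n)"
    by (rule smooth_on_sum[OF assms], rule smooth_on_bounded_linear[OF assms bl]) (use * in blast)
  moreover have "(\<Sum>i\<in>UNIV. axis i (f x $ i)) = f x" for x
    by (auto simp: vec_eq_iff axis_def)
  ultimately show "smooth_on S f" by simp
qed

lemma smooth_on_matrix_iff:
  fixes f :: "'a::euclidean_space \<Rightarrow> real^'m^'n"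
  assumes "open S"
  shows "smooth_on S f \<longleftrightarrow> (\<forall>i j. smooth_on S (\<lambda>x. f x $ i $ j))"
  using assms by (simp add: smooth_on_vec_iff)

lemma bounded_bilinear_matrix_mult: "bounded_bilinear ((**) :: real^'n^'m \<Rightarrow> real^'k^'n \<Rightarrow> real^'k^'m)"
  unfolding bilinear_conv_bounded_bilinear[symmetric] bilinear_def linear_iff
  by (simp add: matrix_matrix_mult_def vec_eq_iff sum.distrib sum_distrib_left ring_distribs mult_ac)

interpretation matrix_mult: bounded_bilinear "(**) :: real^'n^'m \<Rightarrow> real^'k^'n \<Rightarrow> real^'k^'m"
  by (rule bounded_bilinear_matrix_mult)

lemma bounded_linear_trace: "bounded_linear (trace :: real^'n^'n \<Rightarrow> real)"
  unfolding linear_conv_bounded_linear[symmetric] linear_iff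
  by (simp add: trace_def sum.distrib sum_distrib_left)

lemma bounded_linear_transpose: "bounded_linear (transpose :: real^'n^'m \<Rightarrow> real^'m^'n)"
  unfolding linear_conv_bounded_linear[symmetric] linear_iff
  by (simp add: transpose_def vec_eq_iff)

lemmas smooth_on_matrix_mult = smooth_on_bilinear[OF _ bounded_bilinear_matrix_mult]
lemmas smooth_on_trace = smooth_on_bounded_linear[OF _ bounded_linear_trace]
lemmas smooth_on_transpose = smooth_on_bounded_linear[OF _ bounded_linear_transpose]

lemma smooth_on_det:
  fixes f :: "'a::euclidean_space \<Rightarrow> real^'n^'n"
  assumes "open S" "smooth_on S f"
  shows "smooth_on S (\<lambda>x. det (f x))"
  unfolding det_def
  using assms(2)[unfolded smooth_on_matrix_iff[OF assms(1)]]
  by (intro smooth_on_sum smooth_on_mult smooth_on_const smooth_on_prod assms(1)) auto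

lemma matrix_inv_eqI:
  fixes A B :: "real^'n^'n"
  assumes "A ** B = mat 1"
  shows "matrix_inv A = B"
proof -
  have BA: "B ** A = mat 1" using assms matrix_left_right_inverse by blast
  have "A ** matrix_inv A = mat 1 \<and> matrix_inv A ** A = mat 1"
    unfolding matrix_inv_def by (rule someI[of _ B]) (simp add: assms BA)
  then have "(B ** A) ** matrix_inv A = B" by (simp add: matrix_mul_assoc[symmetric])
  then show ?thesis using BA by simp
qed

lemma matrix_inv_det:
  fixes A :: "real^'n^'n"
  assumes "det A \<noteq> 0"
  shows "A ** matrix_inv A = mat 1" "matrix_inv A ** A = mat 1"
proof -
  obtain B where B: "A ** B = mat 1" "B ** A = mat 1"
    using assms invertible_det_nz[of A] unfolding invertible_def by blast
  then show "A ** matrix_inv A = mat 1" "matrix_inv A ** A = mat 1"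
    using matrix_inv_eqI[OF B(1)] by simp_all
qed

lemma matrix_inv_component:
  fixes A :: "real^'n^'n"
  assumes "det A \<noteq> 0"
  shows "matrix_inv A $ k $ b = det (\<chi> i j. if j = k then axis b 1 $ i else A $ i $ j) / det A"
proof -
  have "A *v (matrix_inv A *v axis b 1) = axis b 1"
    by (simp add: matrix_vector_mul_assoc matrix_inv_det[OF assms])
  then have "matrix_inv A *v axis b 1 = (\<chi> k. det (\<chi> i j. if j = k then axis b 1 $ i else A $ i $ j) / det A)"
    using cramer[OF assms] by blast
  then show ?thesis
    by (simp add: vec_eq_iff matrix_vector_mult_basis column_def)
qed

lemma smooth_on_matrix_inv:
  fixes f :: "'a::euclidean_space \<Rightarrow> real^'n^'n"
  assumes "open S" "smooth_on S f" "\<And>x. x \<in> S \<Longrightarrow> det (f x) \<noteq> 0"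
  shows "smooth_on S (\<lambda>x. matrix_inv (f x))"
  unfolding smooth_on_matrix_iff[OF assms(1)]
proof (intro allI)
  fix i j
  have "smooth_on S (\<lambda>x. if j' = i then axis j 1 $ i' else f x $ i' $ j')" for i' j'
    using assms(2)[unfolded smooth_on_matrix_iff[OF assms(1)]]
    by (cases "j' = i") (simp_all add: smooth_on_const)
  then have "smooth_on S (\<lambda>x. (\<chi> i' j'. if j' = i then axis j 1 $ i' else f x $ i' $ j') :: real^'n^'n)"
    by (simp add: smooth_on_matrix_iff[OF assms(1)])
  then have "smooth_on S (\<lambda>x. det (\<chi> i' j'. if j' = i then axis j 1 $ i' else f x $ i' $ j') / det (f x))"
    by (intro smooth_on_divide smooth_on_det assms)
  then show "smooth_on S (\<lambda>x. matrix_inv (f x) $ i $ j)"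
    by (rule smooth_on_cong[OF assms(1), rotated]) (simp add: matrix_inv_component assms(3))
qed

section \<open>Partial derivatives\<close>

lemma frechet_derivative_cong_open:
  assumes "open S" "x \<in> S" "\<And>y. y \<in> S \<Longrightarrow> f y = g y"
  shows "frechet_derivative f (at x) = frechet_derivative g (at x)"
proof -
  have "(f has_derivative D) (at x) \<longleftrightarrow> (g has_derivative D) (at x)" for D
    using has_derivative_transform_within_open[OF _ assms(1,2), of f D UNIV g]
      has_derivative_transform_within_open[OF _ assms(1,2), of g D UNIV f] assms(3) by auto
  then show ?thesis unfolding frechet_derivative_def by simp
qed

lemma pd_cong:
  assumes "open S" "x \<in> S" "\<And>y. y \<in> S \<Longrightarrow> f y = g y"
  shows "pd i f x = pd i g x"
  unfolding pd_def using frechet_derivative_cong_open[of S x f g, OF assms] by simp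

lemma pd_eqI: "(f has_derivative D) (at x) \<Longrightarrow> pd i f x = D (axis i 1)"
  unfolding pd_def by (simp add: frechet_derivative_at[symmetric])

lemma frechet_derivative_pd:
  assumes "f differentiable at x"
  shows "frechet_derivative f (at x) v = (\<Sum>i\<in>UNIV. v $ i *\<^sub>R pd i f x)"
proof -
  have lin: "linear (frechet_derivative f (at x))" using assms by (rule linear_frechet_derivative)
  have "frechet_derivative f (at x) v = frechet_derivative f (at x) (\<Sum>i\<in>UNIV. v $ i *\<^sub>R axis i 1)"
    using basis_expansion[of v] by (simp add: scalar_mult_eq_scaleR)
  then show ?thesis by (simp add: linear_sum[OF lin] linear_cmul[OF lin] pd_def)
qed

lemma smooth_on_pd: "smooth_on S f \<Longrightarrow> smooth_on S (pd i f)"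
  unfolding pd_def by (rule smooth_on_derivative)

lemma pd_const [simp]: "pd i (\<lambda>y. c) x = 0"
  by (rule pd_eqI[THEN trans]) auto

lemma pd_bounded_linear:
  assumes "bounded_linear L" "f differentiable at x"
  shows "pd i (\<lambda>y. L (f y)) x = L (pd i f x)"
  using pd_eqI[OF bounded_linear.has_derivative[OF assms(1) assms(2)[unfolded frechet_derivative_works]]]
  by (simp add: pd_def)

lemma pd_bilinear:
  assumes "bounded_bilinear B" "f differentiable at x" "g differentiable at x"
  shows "pd i (\<lambda>y. B (f y) (g y)) x = B (f x) (pd i g x) + B (pd i f x) (g x)"
  using pd_eqI[OF bounded_bilinear.FDERIV[OF assms(1) assms(2,3)[unfolded frechet_derivative_works]]]
  by (simp add: pd_def)

lemmas pd_scaleR = pd_bilinear[OF bounded_bilinear_scaleR]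
lemmas pd_matrix_mult = pd_bilinear[OF bounded_bilinear_matrix_mult]
lemmas pd_mult = pd_bilinear[OF bounded_bilinear_mult]
lemmas pd_nth = pd_bounded_linear[OF bounded_linear_vec_nth]

lemma pd_entry:
  fixes f :: "real^'n \<Rightarrow> real^'k^'m"
  shows "f differentiable at x \<Longrightarrow> pd a (\<lambda>y. f y $ i $ j) x = pd a f x $ i $ j"
  using pd_bounded_linear[OF bounded_linear_compose[OF bounded_linear_vec_nth bounded_linear_vec_nth]]
  by blast

lemma pd_add:
  assumes "f differentiable at x" "g differentiable at x"
  shows "pd i (\<lambda>y. f y + g y) x = pd i f x + pd i g x"
  using pd_eqI[OF has_derivative_add[OF assms[unfolded frechet_derivative_works]]] by (simp add: pd_def)

lemma pd_sum:
  assumes "\<And>k. k \<in> I \<Longrightarrow> f k differentiable at x"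
  shows "pd i (\<lambda>y. \<Sum>k\<in>I. f k y) x = (\<Sum>k\<in>I. pd i (f k) x)"
  using pd_eqI[OF has_derivative_sum[of I f "\<lambda>k. frechet_derivative (f k) (at x)"]]
    assms[unfolded frechet_derivative_works] by (simp add: pd_def)

lemma pd_cmult:
  assumes "f differentiable at x"
  shows "pd i (\<lambda>y. c *\<^sub>R f y) x = c *\<^sub>R pd i f x"
  using pd_bounded_linear[OF bounded_linear_scaleR_right assms] .

lemma pd_compose:
  fixes \<phi> :: "real^'n \<Rightarrow> real^'m"
  assumes "\<phi> differentiable at x" "f differentiable at (\<phi> x)"
  shows "pd i (\<lambda>y. f (\<phi> y)) x = (\<Sum>p\<in>UNIV. (pd i \<phi> x $ p) *\<^sub>R pd p f (\<phi> x))"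
proof -
  have "((\<lambda>y. f (\<phi> y)) has_derivative (\<lambda>v. frechet_derivative f (at (\<phi> x)) (frechet_derivative \<phi> (at x) v))) (at x)"
    using diff_chain_at[OF assms[unfolded frechet_derivative_works]] by (simp add: o_def)
  from pd_eqI[OF this, of i] show ?thesis
    unfolding frechet_derivative_pd[OF assms(2)] by (simp add: pd_def)
qed

lemma has_real_derivative_along_line:
  fixes f :: "'a::real_normed_vector \<Rightarrow> real"
  assumes "(f has_derivative D) (at (y + s *\<^sub>R u))"
  shows "((\<lambda>s. f (y + s *\<^sub>R u)) has_real_derivative D u) (at s)"
proof -
  have "((\<lambda>s. y + s *\<^sub>R u) has_derivative (\<lambda>t. t *\<^sub>R u)) (at s)"
    by (auto intro!: derivative_eq_intros)
  from diff_chain_at[OF this assms]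
  have "((\<lambda>s. f (y + s *\<^sub>R u)) has_derivative (\<lambda>t. D (t *\<^sub>R u))) (at s)" by (simp add: o_def)
  moreover have "(\<lambda>t. D (t *\<^sub>R u)) = (\<lambda>t. t * D u)"
    using linear_cmul[OF has_derivative_linear[OF assms]] by auto
  ultimately show ?thesis by (simp add: has_field_derivative_def mult_commute_abs)
qed

text \<open>The second difference of \<open>f\<close> is symmetric in the two directions, and by the mean value
  theorem it is a value of either mixed second derivative near the base point.\<close>

lemma second_difference_mean_value:
  fixes f :: "'a::euclidean_space \<Rightarrow> real"
  assumes f: "smooth_on S f" and S: "\<And>s t. 0 \<le> s \<Longrightarrow> s \<le> h \<Longrightarrow> 0 \<le> t \<Longrightarrow> t \<le> h \<Longrightarrow> x + s *\<^sub>R u + t *\<^sub>R v \<in> S"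
    and h: "h > 0"
  shows "\<exists>s t. 0 < s \<and> s < h \<and> 0 < t \<and> t < h \<and>
    f (x + h *\<^sub>R u + h *\<^sub>R v) - f (x + h *\<^sub>R u) - f (x + h *\<^sub>R v) + f x =
    h * h * frechet_derivative (\<lambda>y. frechet_derivative f (at y) u) (at (x + s *\<^sub>R u + t *\<^sub>R v)) v"
proof -
  let ?D = "\<lambda>y. frechet_derivative f (at y) u"
  let ?E = "\<lambda>y. frechet_derivative ?D (at y) v"
  have fd: "((\<lambda>s. f (y + s *\<^sub>R u)) has_real_derivative ?D (y + s *\<^sub>R u)) (at s)" if "y + s *\<^sub>R u \<in> S" for y s
    by (rule has_real_derivative_along_line) (rule smooth_on_has_derivative[OF f that])
  have Dd: "((\<lambda>t. ?D (y + t *\<^sub>R v)) has_real_derivative ?E (y + t *\<^sub>R v)) (at t)" if "y + t *\<^sub>R v \<in> S" for y t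
    by (rule has_real_derivative_along_line)
      (rule smooth_on_has_derivative[OF smooth_on_derivative[OF f] that])
  let ?p = "\<lambda>s. f ((x + h *\<^sub>R v) + s *\<^sub>R u) - f (x + s *\<^sub>R u)"
  have "(?p has_real_derivative (?D ((x + h *\<^sub>R v) + s *\<^sub>R u) - ?D (x + s *\<^sub>R u))) (at s)"
    if "0 \<le> s" "s \<le> h" for s
    using S[OF that, of 0] S[OF that, of h] h
    by (intro DERIV_diff fd) (auto simp: algebra_simps)
  from MVT2[OF h this]
  obtain s where s: "0 < s" "s < h" "?p h - ?p 0 = h * (?D ((x + h *\<^sub>R v) + s *\<^sub>R u) - ?D (x + s *\<^sub>R u))"
    by auto
  have "((\<lambda>t. ?D ((x + s *\<^sub>R u) + t *\<^sub>R v)) has_real_derivative ?E ((x + s *\<^sub>R u) + t *\<^sub>R v)) (at t)"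
    if "0 \<le> t" "t \<le> h" for t
    by (rule Dd) (use S[of s t] s that in auto)
  from MVT2[OF h this]
  obtain t where t: "0 < t" "t < h"
      "?D ((x + s *\<^sub>R u) + h *\<^sub>R v) - ?D ((x + s *\<^sub>R u) + 0 *\<^sub>R v) = h * ?E ((x + s *\<^sub>R u) + t *\<^sub>R v)"
    by auto
  have "f (x + h *\<^sub>R u + h *\<^sub>R v) - f (x + h *\<^sub>R u) - f (x + h *\<^sub>R v) + f x = ?p h - ?p 0"
    by (simp add: add.commute add.left_commute)
  also have "\<dots> = h * (?D ((x + s *\<^sub>R u) + h *\<^sub>R v) - ?D ((x + s *\<^sub>R u) + 0 *\<^sub>R v))"
    unfolding s(3) by (simp add: add.commute add.left_commute)
  also have "\<dots> = h * h * ?E (x + s *\<^sub>R u + t *\<^sub>R v)"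
    unfolding t(3) by simp
  finally show ?thesis using s t by blast
qed

lemma second_derivative_symmetric:
  fixes f :: "'a::euclidean_space \<Rightarrow> real"
  assumes f: "smooth_on S f" and S: "open S" "x \<in> S"
  shows "frechet_derivative (\<lambda>y. frechet_derivative f (at y) u) (at x) v =
    frechet_derivative (\<lambda>y. frechet_derivative f (at y) v) (at x) u"
proof (rule ccontr)
  let ?A = "\<lambda>x. frechet_derivative (\<lambda>y. frechet_derivative f (at y) u) (at x) v"
  let ?B = "\<lambda>x. frechet_derivative (\<lambda>y. frechet_derivative f (at y) v) (at x) u"
  assume "?A x \<noteq> ?B x"
  define e where "e = \<bar>?A x - ?B x\<bar> / 2"
  have e: "e > 0" using \<open>?A x \<noteq> ?B x\<close> by (simp add: e_def)
  have "continuous_on S ?A" "continuous_on S ?B"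
    by (intro smooth_on_continuous smooth_on_derivative f)+
  then have "continuous (at x) ?A" "continuous (at x) ?B"
    using S by (auto simp: continuous_on_eq_continuous_at)
  then obtain d1 d2 where d: "d1 > 0" "\<And>y. dist y x < d1 \<Longrightarrow> dist (?A y) (?A x) < e"
      "d2 > 0" "\<And>y. dist y x < d2 \<Longrightarrow> dist (?B y) (?B x) < e"
    unfolding continuous_at_eps_delta using e by (smt (verit, ccfv_SIG) dist_commute)
  obtain r where r: "r > 0" "ball x r \<subseteq> S" using S openE by blast
  define m where "m = min r (min d1 d2)"
  have m: "m > 0" using r d by (simp add: m_def)
  define N where "N = norm u + norm v + 1"
  \<comment> \<open>The sides of the square are so short that it lies in the ball where both derivatives vary by
    less than \<open>e\<close>.\<close>
  define h where "h = m / N / 2"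
  have nuv: "N > 0" unfolding N_def by (smt (verit) norm_ge_zero)
  have h: "h > 0" using m nuv by (simp add: h_def)
  have hm: "h * (norm u + norm v) < m"
  proof -
    have "h * (norm u + norm v) \<le> h * N" using h by (simp add: N_def)
    also have "\<dots> = m / 2" using nuv by (simp add: h_def)
    finally show ?thesis using m by simp
  qed
  have near: "dist (x + s *\<^sub>R u + t *\<^sub>R v) x < m" if "0 \<le> s" "s \<le> h" "0 \<le> t" "t \<le> h" for s t
  proof -
    have "dist (x + s *\<^sub>R u + t *\<^sub>R v) x = norm (s *\<^sub>R u + t *\<^sub>R v)" by (simp add: dist_norm algebra_simps)
    also have "\<dots> \<le> s * norm u + t * norm v" using that by (metis abs_of_nonneg norm_scaleR norm_triangle_ineq)
    also have "\<dots> \<le> h * norm u + h * norm v" using that by (intro add_mono mult_right_mono) auto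
    also have "\<dots> < m" using hm by (simp add: distrib_left)
    finally show ?thesis .
  qed
  have near': "x + s *\<^sub>R u + t *\<^sub>R v \<in> S" if "0 \<le> s" "s \<le> h" "0 \<le> t" "t \<le> h" for s t
    using near[OF that] r(2) by (auto simp: m_def dist_commute)
  obtain s t where st: "0 < s" "s < h" "0 < t" "t < h"
    "f (x + h *\<^sub>R u + h *\<^sub>R v) - f (x + h *\<^sub>R u) - f (x + h *\<^sub>R v) + f x = h * h * ?A (x + s *\<^sub>R u + t *\<^sub>R v)"
    using second_difference_mean_value[OF f near' h] by blast
  have "x + s *\<^sub>R v + t *\<^sub>R u \<in> S" if "0 \<le> s" "s \<le> h" "0 \<le> t" "t \<le> h" for s t
    using near'[OF that(3,4,1,2)] by (simp add: algebra_simps)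
  from second_difference_mean_value[OF f this h]
  obtain s' t' where st': "0 < s'" "s' < h" "0 < t'" "t' < h"
    "f (x + h *\<^sub>R v + h *\<^sub>R u) - f (x + h *\<^sub>R v) - f (x + h *\<^sub>R u) + f x = h * h * ?B (x + s' *\<^sub>R v + t' *\<^sub>R u)"
    by blast
  have "h * h * ?A (x + s *\<^sub>R u + t *\<^sub>R v) = h * h * ?B (x + s' *\<^sub>R v + t' *\<^sub>R u)"
    unfolding st(5)[symmetric] st'(5)[symmetric] by (simp add: algebra_simps)
  then have eq: "?A (x + s *\<^sub>R u + t *\<^sub>R v) = ?B (x + t' *\<^sub>R u + s' *\<^sub>R v)"
    using h by (simp add: algebra_simps)
  have "dist (?A (x + s *\<^sub>R u + t *\<^sub>R v)) (?A x) < e"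
    using near[of s t] st by (intro d(2)) (auto simp: m_def)
  moreover have "dist (?B (x + t' *\<^sub>R u + s' *\<^sub>R v)) (?B x) < e"
    using near[of t' s'] st' by (intro d(4)) (auto simp: m_def)
  ultimately have "\<bar>?A x - ?B x\<bar> < 2 * e" unfolding eq dist_real_def by linarith
  then show False by (simp add: e_def)
qed

lemma pd_commute:
  fixes f :: "real^'n \<Rightarrow> real^'m"
  assumes f: "smooth_on S f" and S: "open S" "x \<in> S"
  shows "pd i (pd j f) x = pd j (pd i f) x"
proof -
  have "pd i (pd j f) x $ p = frechet_derivative (\<lambda>y. frechet_derivative (\<lambda>y. f y $ p) (at y) (axis j 1)) (at x) (axis i 1)" for p i j
  proof -
    have "pd i (pd j f) x $ p = pd i (\<lambda>y. pd j f y $ p) x"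
      by (rule pd_nth[symmetric]) (rule smooth_on_differentiable[OF smooth_on_pd[OF f] S(2)])
    also have "\<dots> = pd i (\<lambda>y. pd j (\<lambda>y. f y $ p) y) x"
      by (rule pd_cong[OF S]) (rule pd_nth[symmetric], rule smooth_on_differentiable[OF f])
    finally show ?thesis by (simp add: pd_def)
  qed
  then show ?thesis
    using second_derivative_symmetric[OF smooth_on_bounded_linear[OF S(1) bounded_linear_vec_nth f] S]
    by (simp add: vec_eq_iff)
qed

section \<open>Derivatives of determinant and inverse\<close>

text \<open>In the Leibniz formula a permutation other than the identity moves at least two indices, so its
  term vanishes to second order at the unit matrix.\<close>

lemma has_derivative_det_at_id:
  "(det has_derivative trace) (at (mat 1 :: real^'n^'n))"
proof -
  let ?I = "mat 1 :: real^'n^'n"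
  have entry: "((\<lambda>A. A $ i $ j) has_derivative (\<lambda>B. B $ i $ j)) (at ?I)" for i j :: 'n
    by (rule bounded_linear_imp_has_derivative)
      (rule bounded_linear_compose[OF bounded_linear_vec_nth bounded_linear_vec_nth])
  have 1: "(det has_derivative (\<lambda>B. \<Sum>p\<in>{p. p permutes (UNIV :: 'n set)}. of_int (sign p) *
      (\<Sum>i\<in>UNIV. B $ i $ p i * (\<Prod>j\<in>UNIV - {i}. ?I $ j $ p j)))) (at ?I)"
    unfolding det_def[abs_def]
    by (intro has_derivative_sum has_derivative_mult_right has_derivative_prod entry)
  have 2: "(\<Prod>j\<in>UNIV - {i}. ?I $ j $ p j) = (if p = id then 1 else 0)" if p: "p permutes UNIV" for p :: "'n \<Rightarrow> 'n" and i
  proof (cases "p = id")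
    case True then show ?thesis by (simp add: mat_def)
  next
    case False
    have "\<exists>j. j \<noteq> i \<and> p j \<noteq> j"
    proof (rule ccontr)
      assume "\<nexists>j. j \<noteq> i \<and> p j \<noteq> j"
      then have fixed: "p j = j" if "j \<noteq> i" for j using that by blast
      have "p i = i" using fixed[of "p i"] permutes_inj[OF p] by (metis injD)
      then show False using fixed False by (metis eq_id_iff)
    qed
    then obtain j where "j \<noteq> i" "p j \<noteq> j" by blast
    then show ?thesis using False by (auto intro!: prod_zero bexI[of _ j] simp: mat_def)
  qed
  have "(\<lambda>B. \<Sum>p\<in>{p. p permutes (UNIV :: 'n set)}. of_int (sign p) *
      (\<Sum>i\<in>UNIV. B $ i $ p i * (\<Prod>j\<in>UNIV - {i}. ?I $ j $ p j))) = trace"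
  proof
    fix B :: "real^'n^'n"
    have "(\<Sum>p\<in>{p. p permutes (UNIV :: 'n set)}. of_int (sign p) *
        (\<Sum>i\<in>UNIV. B $ i $ p i * (\<Prod>j\<in>UNIV - {i}. ?I $ j $ p j))) =
      (\<Sum>p\<in>{p. p permutes (UNIV :: 'n set)}. if p = id then trace B else 0)"
      by (rule sum.cong) (auto simp: 2 trace_def)
    also have "\<dots> = trace B"
      by (simp add: sum.delta finite_permutations permutes_id)
    finally show "(\<Sum>p\<in>{p. p permutes (UNIV :: 'n set)}. of_int (sign p) *
        (\<Sum>i\<in>UNIV. B $ i $ p i * (\<Prod>j\<in>UNIV - {i}. ?I $ j $ p j))) = trace B" .
  qed
  then show ?thesis using 1 by simp
qed

text \<open>Jacobi's formula.  It reduces to the derivative at the unit matrix since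
  \<open>det B = det A \<cdot> det (A\<^sup>-\<^sup>1 B)\<close>.\<close>

lemma pd_det:
  fixes f :: "real^'m \<Rightarrow> real^'n^'n"
  assumes f: "f differentiable at x" and det: "det (f x) \<noteq> 0"
  shows "pd i (\<lambda>y. det (f y)) x = det (f x) * trace (matrix_inv (f x) ** pd i f x)"
proof -
  let ?h = "\<lambda>y. matrix_inv (f x) ** f y"
  have h: "(?h has_derivative (\<lambda>v. matrix_inv (f x) ** frechet_derivative f (at x) v)) (at x)"
    by (rule bounded_linear.has_derivative[OF bounded_bilinear.bounded_linear_right[OF bounded_bilinear_matrix_mult]])
      (use f in \<open>simp add: frechet_derivative_works\<close>)
  have "?h x = mat 1" using matrix_inv_det[OF det] by simp
  then have "(det has_derivative trace) (at (?h x))" by (simp add: has_derivative_det_at_id)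
  from diff_chain_at[OF h this]
  have "((\<lambda>y. det (f x) * det (?h y)) has_derivative
      (\<lambda>v. det (f x) * trace (matrix_inv (f x) ** frechet_derivative f (at x) v))) (at x)"
    by (intro has_derivative_mult_right) (simp add: o_def)
  moreover have "(\<lambda>y. det (f x) * det (?h y)) = (\<lambda>y. det (f y))"
    by (rule ext) (simp add: det_mul[symmetric] matrix_mul_assoc matrix_inv_det[OF det])
  ultimately show ?thesis by (auto dest: pd_eqI simp: pd_def)
qed

lemma pd_matrix_inv:
  fixes f :: "real^'m \<Rightarrow> real^'n^'n"
  assumes S: "open S" "x \<in> S" and f: "smooth_on S f" and det: "\<And>y. y \<in> S \<Longrightarrow> det (f y) \<noteq> 0"
  shows "pd i (\<lambda>y. matrix_inv (f y)) x = - (matrix_inv (f x) ** pd i f x ** matrix_inv (f x))"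
proof -
  let ?F = "\<lambda>y. matrix_inv (f y)"
  have F: "?F differentiable at x"
    by (rule smooth_on_differentiable[OF smooth_on_matrix_inv[OF S(1) f det] S(2)])
  have fd: "f differentiable at x" by (rule smooth_on_differentiable[OF f S(2)])
  have "pd i (\<lambda>y. ?F y ** f y) x = pd i (\<lambda>y. mat 1 :: real^'n^'n) x"
    by (rule pd_cong[OF S]) (simp add: matrix_inv_det det)
  then have "?F x ** pd i f x + pd i ?F x ** f x = 0"
    by (simp add: pd_matrix_mult[OF F fd])
  then have "(?F x ** pd i f x + pd i ?F x ** f x) ** ?F x = 0" by simp
  then have "?F x ** pd i f x ** ?F x + pd i ?F x = 0"
    by (simp add: matrix_mult.add_left matrix_mul_assoc[symmetric] matrix_inv_det[OF det[OF S(2)]])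
  then show ?thesis by (simp add: add_eq_0_iff)
qed

section \<open>A smooth bump function\<close>

text \<open>The functions \<open>exp(-1/t) / t\<^sup>n\<close> on the positive half-line, extended by zero.  The whole family is
  considered because the derivative of one member is a combination of two others, which makes
  smoothness at zero an induction.\<close>

definition flat_exp :: "nat \<Rightarrow> real \<Rightarrow> real" where
  "flat_exp n t = (if t > 0 then exp (- inverse t) * inverse t ^ n else 0)"

text \<open>With \<open>x = 1/t\<close> and \<open>m = n + 2\<close> this is \<open>x\<^sup>m \<le> m\<^sup>m exp(x)\<close>, the \<open>m\<close>-th power of
  \<open>x/m \<le> exp(x/m)\<close>.  The factor \<open>t\<^sup>2\<close> gives differentiability at zero.\<close>

lemma flat_exp_bound: "\<bar>flat_exp n t\<bar> \<le> real (n + 2) ^ (n + 2) * t\<^sup>2"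
proof (cases "t > 0")
  case True
  define m where "m = n + 2"
  have m: "m > 0" by (simp add: m_def)
  have "inverse t / real m \<le> exp (inverse t / real m)"
    by (smt (verit) exp_ge_add_one_self)
  then have "(inverse t / real m) ^ m \<le> exp (inverse t / real m) ^ m"
    using True by (intro power_mono) auto
  also have "\<dots> = exp (inverse t)"
    using m by (simp add: exp_of_nat_mult[symmetric])
  finally have "inverse t ^ m \<le> exp (inverse t) * real m ^ m"
    using m by (simp add: power_divide pos_divide_le_eq)
  then have "exp (- inverse t) * inverse t ^ m \<le> real m ^ m"
    using mult_left_mono[of "inverse t ^ m" "exp (inverse t) * real m ^ m" "exp (- inverse t)"]
    by (simp add: exp_minus mult.assoc[symmetric])
  then have le: "(exp (- inverse t) * inverse t ^ m) * t\<^sup>2 \<le> real m ^ m * t\<^sup>2"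
    by (rule mult_right_mono) simp
  have "(exp (- inverse t) * inverse t ^ m) * t\<^sup>2 = flat_exp n t"
    using True by (simp add: m_def flat_exp_def power_add power2_eq_square field_simps)
  with le have "flat_exp n t \<le> real m ^ m * t\<^sup>2" by simp
  moreover have "flat_exp n t \<ge> 0" by (simp add: flat_exp_def)
  ultimately show ?thesis unfolding m_def by (simp only: abs_of_nonneg)
qed (simp add: flat_exp_def)

lemma flat_exp_deriv:
  "(flat_exp n has_real_derivative (flat_exp (n + 2) t - real n * flat_exp (n + 1) t)) (at t)"
proof -
  consider "t > 0" | "t < 0" | "t = 0" by linarith
  then show ?thesis
  proof cases
    case 1
    have "((\<lambda>t. exp (- inverse t) * inverse t ^ n) has_real_derivative
        (flat_exp (n + 2) t - real n * flat_exp (n + 1) t)) (at t)"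
      using 1 by (cases n)
        (auto intro!: derivative_eq_intros simp: flat_exp_def power_add power2_eq_square algebra_simps,
          metis One_nat_def Suc_pred neq0_conv power_Suc)
    then show ?thesis
      by (rule has_field_derivative_transform_within_open[where S="{0<..}"]) (use 1 in \<open>auto simp: flat_exp_def\<close>)
  next
    case 2
    have "((\<lambda>t. 0) has_real_derivative 0) (at t)" by simp
    then have "(flat_exp n has_real_derivative 0) (at t)"
      by (rule has_field_derivative_transform_within_open[where S="{..<0}"]) (use 2 in \<open>auto simp: flat_exp_def\<close>)
    then show ?thesis using 2 by (simp add: flat_exp_def)
  next
    case 3
    have "((\<lambda>h. (flat_exp n (0 + h) - flat_exp n 0) / h) \<longlongrightarrow> 0) (at 0)"
    proof (rule Lim_null_comparison)
      show "\<forall>\<^sub>F h in at 0. norm ((flat_exp n (0 + h) - flat_exp n 0) / h) \<le> real (n + 2) ^ (n + 2) * \<bar>h\<bar>"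
      proof (rule always_eventually, rule allI)
        fix h :: real
        show "norm ((flat_exp n (0 + h) - flat_exp n 0) / h) \<le> real (n + 2) ^ (n + 2) * \<bar>h\<bar>"
        proof (cases "h = 0")
          case False
          then show ?thesis using flat_exp_bound[of n h]
            by (simp add: flat_exp_def[of n 0] divide_simps power2_eq_square abs_mult_self_eq mult.assoc del: of_nat_add power_Suc)
        qed simp
      qed
      show "((\<lambda>h. real (n + 2) ^ (n + 2) * \<bar>h\<bar>) \<longlongrightarrow> 0) (at 0)"
        by (intro tendsto_mult_right_zero tendsto_rabs_zero tendsto_ident_at)
    qed
    then show ?thesis using 3 by (simp add: DERIV_def flat_exp_def[of _ 0])
  qed
qed

lemma smooth_on_flat_exp: "smooth_on UNIV (flat_exp n)"
proof -
  have "C_k_on k UNIV (flat_exp n)" for k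
  proof (induction k arbitrary: n)
    case 0
    show ?case
      using flat_exp_deriv by (auto intro!: continuous_at_imp_continuous_on DERIV_isCont)
  next
    case (Suc k)
    have c: "C_k_on k UNIV (\<lambda>_::real. c :: real)" for c
      using smooth_on_const by (auto simp: smooth_on_def)
    show ?case
    proof (rule C_k_on_SucI[OF open_UNIV, where D="\<lambda>t v. (flat_exp (n + 2) t + (- real n) * flat_exp (n + 1) t) * v"])
      show "(flat_exp n has_derivative (\<lambda>v. (flat_exp (n + 2) t + (- real n) * flat_exp (n + 1) t) * v)) (at t)" for t
        using flat_exp_deriv[of n t] by (simp add: has_field_derivative_def)
      show "C_k_on k UNIV (\<lambda>t. (flat_exp (n + 2) t + (- real n) * flat_exp (n + 1) t) * v)" for v
        by (intro C_k_on_bilinear[OF open_UNIV bounded_bilinear_mult] C_k_on_add[OF open_UNIV] c Suc.IH)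
    qed
  qed
  then show ?thesis by (simp add: smooth_on_def)
qed

definition bump :: "'a::euclidean_space \<Rightarrow> real \<Rightarrow> 'a \<Rightarrow> real" where
  "bump a r x = flat_exp 0 (r\<^sup>2 - (x - a) \<bullet> (x - a))"

lemma smooth_on_bump: "smooth_on UNIV (bump a r)"
  unfolding bump_def[abs_def]
  by (rule smooth_on_compose[OF open_UNIV open_UNIV _ smooth_on_flat_exp])
    (auto intro!: smooth_on_diff smooth_on_const smooth_on_ident smooth_on_bilinear[OF _ bounded_bilinear_inner])

lemma bump_nonneg: "bump a r x \<ge> 0"
  by (simp add: bump_def flat_exp_def)

lemma bump_pos_iff: "r > 0 \<Longrightarrow> bump a r x > 0 \<longleftrightarrow> x \<in> ball a r"
proof -
  assume "r > 0"
  have "(x - a) \<bullet> (x - a) = (dist a x)\<^sup>2" by (simp add: power2_norm_eq_inner[symmetric] dist_norm norm_minus_commute)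
  moreover have "(dist a x)\<^sup>2 < r\<^sup>2 \<longleftrightarrow> dist a x < r"
    using \<open>r > 0\<close> by (simp add: power_mono_iff flip: not_le)
  ultimately show ?thesis by (simp add: bump_def flat_exp_def)
qed

section \<open>Positive definite matrices\<close>

definition posdef :: "real^'n^'n \<Rightarrow> bool" where
  "posdef A \<longleftrightarrow> transpose A = A \<and> (\<forall>v. v \<noteq> 0 \<longrightarrow> v \<bullet> (A *v v) > 0)"

text \<open>Cholesky factorisation by completing the square: subtracting \<open>e e\<^sup>T\<close>, where \<open>e\<close> is the \<open>k\<close>-th column
  divided by the root of its diagonal entry, clears the row and the column \<open>k\<close>.  As the size of a
  matrix is a type, the induction is on the set \<open>I\<close> of indices on which the form lives.\<close>

lemma posdef_matrix_factor_aux: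
  fixes A :: "real^'n^'n"
  assumes "finite I" "transpose A = A" "\<And>i j. i \<notin> I \<Longrightarrow> A $ i $ j = 0"
    "\<And>v. v \<noteq> 0 \<Longrightarrow> (\<forall>i. i \<notin> I \<longrightarrow> v $ i = 0) \<Longrightarrow> v \<bullet> (A *v v) > 0"
  shows "\<exists>E. A = E ** transpose E \<and> (\<forall>i j. j \<notin> I \<longrightarrow> E $ i $ j = 0)"
  using assms
proof (induction I arbitrary: A rule: finite_induct)
  case empty
  have "A = 0 ** transpose 0" using empty(2) by (simp add: vec_eq_iff)
  then show ?case by (intro exI[of _ 0]) auto
next
  case (insert k I)
  have sym: "A $ i $ j = A $ j $ i" for i j
    using insert.prems(1) by (metis transpose_def vec_lambda_beta)
  let ?k = "axis k 1 :: real^'n"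
  have Ak: "A *v ?k = column k A" by (simp add: matrix_vector_mult_basis)
  have kA: "?k \<bullet> (A *v v) = column k A \<bullet> v" for v
  proof -
    have "?k \<bullet> (A *v v) = (A *v v) $ k" by (simp add: inner_axis')
    then show ?thesis by (simp add: matrix_vector_mult_def column_def inner_vec_def sym)
  qed
  have "?k \<noteq> 0" by (simp add: axis_eq_0_iff)
  moreover have "\<forall>i. i \<notin> insert k I \<longrightarrow> ?k $ i = 0" by (auto simp: axis_def)
  ultimately have "?k \<bullet> (A *v ?k) > 0" by (rule insert.prems(3))
  then have akk: "A $ k $ k > 0" by (simp add: kA inner_axis column_def)
  define s where "s = sqrt (A $ k $ k)"
  have s: "s > 0" "s * s = A $ k $ k" using akk by (auto simp: s_def)
  define e where "e = (1 / s) *\<^sub>R column k A"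
  define B where "B = A - (\<chi> i j. e $ i * e $ j)"
  have Bv: "B *v v = A *v v - (e \<bullet> v) *\<^sub>R e" for v
    by (simp add: B_def matrix_vector_mult_diff_rdistrib)
      (simp add: vec_eq_iff matrix_vector_mult_def inner_vec_def sum_distrib_left sum_distrib_right mult_ac)
  have "\<exists>E. B = E ** transpose E \<and> (\<forall>i j. j \<notin> I \<longrightarrow> E $ i $ j = 0)"
  proof (rule insert.IH)
    show "transpose B = B"
      by (simp add: B_def transpose_def vec_eq_iff sym mult.commute)
    show "B $ i $ j = 0" if "i \<notin> I" for i j
    proof (cases "i = k")
      case True
      have "e $ k * e $ j = (A $ k $ k / (s * s)) * A $ j $ k" by (simp add: e_def column_def)
      also have "\<dots> = A $ k $ j" using s akk by (simp add: sym[of k j])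
      finally show ?thesis using True by (simp add: B_def)
    next
      case False
      then have "A $ i $ j = 0" for j using insert.prems(2)[of i j] that by auto
      then show ?thesis by (simp add: B_def e_def column_def)
    qed
    show "v \<bullet> (B *v v) > 0" if v: "v \<noteq> 0" "\<forall>i. i \<notin> I \<longrightarrow> v $ i = 0" for v
    proof -
      \<comment> \<open>The minimum of \<open>A\<close> on the line through \<open>v\<close> in the direction of the \<open>k\<close>-th axis is the value
        of \<open>B\<close> at \<open>v\<close>.\<close>
      define t where "t = (column k A \<bullet> v) / (s * s)"
      define w where "w = v - t *\<^sub>R ?k"
      have vk: "v $ k = 0" using v(2) insert.hyps by auto
      obtain i where i: "v $ i \<noteq> 0" using v(1) by (auto simp: vec_eq_iff)
      then have "w $ i \<noteq> 0" using vk by (auto simp: w_def axis_def)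
      then have "w \<noteq> 0" by auto
      moreover have "\<forall>i. i \<notin> insert k I \<longrightarrow> w $ i = 0"
        using v(2) by (auto simp: w_def axis_def)
      ultimately have "0 < w \<bullet> (A *v w)" by (rule insert.prems(3))
      also have "w \<bullet> (A *v w) = v \<bullet> (A *v v) - 2 * t * (column k A \<bullet> v) + t * t * (s * s)"
        by (simp add: w_def matrix_vector_mult_diff_distrib matrix_vector_mult_scaleR inner_diff_left inner_diff_right
            kA Ak inner_commute[of v "column k A"] s(2))
          (simp add: inner_axis inner_axis' column_def algebra_simps)
      also have "\<dots> = v \<bullet> (A *v v) - (e \<bullet> v) * (e \<bullet> v)"
        using s(1) by (simp add: t_def e_def field_simps)
      also have "\<dots> = v \<bullet> (B *v v)"
        by (simp add: Bv inner_diff_right inner_commute)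
      finally show ?thesis .
    qed
  qed
  then obtain E where E: "B = E ** transpose E" "\<And>i j. j \<notin> I \<Longrightarrow> E $ i $ j = 0" by blast
  define F where "F = (\<chi> i j. if j = k then e $ i else E $ i $ j)"
  have "(F ** transpose F) $ i $ j = A $ i $ j" for i j
  proof -
    have "(F ** transpose F) $ i $ j = F $ i $ k * F $ j $ k + (\<Sum>l\<in>UNIV - {k}. F $ i $ l * F $ j $ l)"
      by (simp add: matrix_matrix_mult_def transpose_def sum.remove[of UNIV k])
    also have "\<dots> = e $ i * e $ j + (\<Sum>l\<in>UNIV - {k}. E $ i $ l * E $ j $ l)"
      by (simp add: F_def)
    also have "(\<Sum>l\<in>UNIV - {k}. E $ i $ l * E $ j $ l) = (\<Sum>l\<in>UNIV. E $ i $ l * E $ j $ l)"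
      using E(2)[of k] insert.hyps by (simp add: sum.remove[of UNIV k])
    also have "\<dots> = B $ i $ j" unfolding E(1) by (simp add: matrix_matrix_mult_def transpose_def)
    finally show ?thesis by (simp add: B_def)
  qed
  then have "A = F ** transpose F" by (simp add: vec_eq_iff)
  moreover have "\<forall>i j. j \<notin> insert k I \<longrightarrow> F $ i $ j = 0" using E(2) by (simp add: F_def)
  ultimately show ?case by blast
qed

lemma posdef_matrix:
  fixes A :: "real^'n^'n"
  assumes A: "posdef A"
  shows posdef_det_pos: "det A > 0"
    and posdef_inv_factor: "\<exists>E. matrix_inv A = E ** transpose E \<and> det E \<noteq> 0"
proof -
  obtain F :: "real^'n^'n" where F: "A = F ** transpose F"
  proof -
    have "\<exists>F :: real^'n^'n. A = F ** transpose F \<and> (\<forall>i j. j \<notin> UNIV \<longrightarrow> F $ i $ j = 0)"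
      by (rule posdef_matrix_factor_aux) (use A in \<open>auto simp: posdef_def\<close>)
    then show ?thesis using that by blast
  qed
  have "det A = (det F)\<^sup>2" unfolding F by (simp add: det_mul power2_eq_square)
  moreover have "det A \<noteq> 0"
  proof -
    have "A *v v = 0 \<Longrightarrow> v = 0" for v using A unfolding posdef_def by (metis inner_zero_right less_irrefl)
    then show ?thesis
      by (metis invertible_det_nz invertible_left_inverse matrix_left_invertible_ker)
  qed
  ultimately show det: "det A > 0" by (metis zero_eq_power2 zero_less_power2)
  then have dF: "det F \<noteq> 0" using \<open>det A = (det F)\<^sup>2\<close> by auto
  let ?E = "transpose (matrix_inv F)"
  have "A ** (?E ** transpose ?E) = F ** (transpose F ** transpose (matrix_inv F)) ** matrix_inv F"
    unfolding F by (simp add: matrix_mul_assoc)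
  also have "\<dots> = mat 1"
    by (simp add: matrix_transpose_mul[symmetric] matrix_inv_det[OF dF] transpose_mat)
  finally have inv: "matrix_inv A = ?E ** transpose ?E" by (rule matrix_inv_eqI)
  have "det (matrix_inv F) * det F = 1" by (simp add: det_mul[symmetric] matrix_inv_det[OF dF])
  then have "det ?E \<noteq> 0" by auto
  then show "\<exists>E. matrix_inv A = E ** transpose E \<and> det E \<noteq> 0" using inv by blast
qed

text \<open>With \<open>g\<^sup>-\<^sup>1 = E E\<^sup>T\<close>, the columns of \<open>E\<close> are a \<open>g\<close>-orthonormal frame, in which the fibre metric
  becomes a sum of squares.\<close>

lemma trace_transpose_mult: "trace (A ** transpose (A :: real^'n^'n)) = (\<Sum>i\<in>UNIV. \<Sum>j\<in>UNIV. (A $ i $ j)\<^sup>2)"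
  by (simp add: trace_def matrix_matrix_mult_def transpose_def power2_eq_square)

lemma trace_frame:
  fixes E K L :: "real^'n^'n"
  shows "trace ((E ** transpose E) ** K ** (E ** transpose E) ** L) =
    trace ((transpose E ** K ** E) ** (transpose E ** L ** E))"
proof -
  have "trace ((E ** transpose E) ** K ** (E ** transpose E) ** L) =
      trace (E ** (transpose E ** K ** (E ** transpose E) ** L))"
    by (simp add: matrix_mul_assoc)
  also have "\<dots> = trace ((transpose E ** K ** (E ** transpose E) ** L) ** E)"
    by (rule trace_mul_sym)
  finally show ?thesis by (simp add: matrix_mul_assoc)
qed

lemma posdef_trace_pos:
  fixes A K :: "real^'n^'n"
  assumes A: "posdef A"
    and K: "transpose K = K"
  shows "trace (matrix_inv A ** K ** matrix_inv A ** K) \<ge> 0"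
    and "trace (matrix_inv A ** K ** matrix_inv A ** K) = 0 \<Longrightarrow> K = 0"
proof -
  obtain E where E: "matrix_inv A = E ** transpose E" "det E \<noteq> 0"
    using posdef_inv_factor[OF A] by blast
  let ?L = "transpose E ** K ** E"
  have "transpose ?L = ?L" using K by (simp add: matrix_transpose_mul matrix_mul_assoc)
  then have eq: "trace (matrix_inv A ** K ** matrix_inv A ** K) = (\<Sum>i\<in>UNIV. \<Sum>j\<in>UNIV. (?L $ i $ j)\<^sup>2)"
    unfolding E trace_frame using trace_transpose_mult[of ?L] by simp
  then show "trace (matrix_inv A ** K ** matrix_inv A ** K) \<ge> 0"
    by (simp add: sum_nonneg)
  assume "trace (matrix_inv A ** K ** matrix_inv A ** K) = 0"
  then have "?L = 0"
    unfolding eq by (simp add: sum_nonneg_eq_0_iff sum_nonneg vec_eq_iff)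
  have "det (transpose E) \<noteq> 0" using E(2) by simp
  have "K = (matrix_inv (transpose E) ** transpose E) ** K ** (E ** matrix_inv E)"
    by (simp add: matrix_inv_det[OF E(2)] matrix_inv_det[OF \<open>det (transpose E) \<noteq> 0\<close>])
  also have "\<dots> = matrix_inv (transpose E) ** ?L ** matrix_inv E" by (simp add: matrix_mul_assoc)
  finally show "K = 0" using \<open>?L = 0\<close> by simp
qed

text \<open>The squared norm of \<open>\<nabla>h\<close> is non-negative: with \<open>g\<^sup>-\<^sup>1 = E E\<^sup>T\<close> also the derivative index is expressed
  in an orthonormal frame.\<close>

lemma posdef_sum_trace_nonneg:
  fixes A :: "real^'n^'n" and K :: "'n \<Rightarrow> real^'n^'n"
  assumes A: "posdef A"
    and K: "\<And>a. transpose (K a) = K a"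
  shows "(\<Sum>a\<in>UNIV. \<Sum>b\<in>UNIV. matrix_inv A $ a $ b * trace (matrix_inv A ** K a ** matrix_inv A ** K b)) \<ge> 0"
proof -
  obtain E :: "real^'n^'n" where E: "matrix_inv A = E ** transpose E"
    using posdef_inv_factor[OF A] by blast
  let ?t = "\<lambda>K L. trace (matrix_inv A ** K ** matrix_inv A ** L)"
  let ?K = "\<lambda>e. \<Sum>a\<in>UNIV. (E $ a $ e) *\<^sub>R K a"
  have "?t (?K e) (?K e) \<ge> 0" for e
  proof (rule posdef_trace_pos(1)[OF A])
    show "transpose (?K e) = ?K e"
      using K by (simp add: linear_sum[OF bounded_linear.linear[OF bounded_linear_transpose]]
          linear_cmul[OF bounded_linear.linear[OF bounded_linear_transpose]])
  qed
  then have "0 \<le> (\<Sum>e\<in>UNIV. ?t (?K e) (?K e))" by (simp add: sum_nonneg)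
  also have "\<dots> = (\<Sum>e\<in>UNIV. \<Sum>a\<in>UNIV. \<Sum>b\<in>UNIV. E $ a $ e * E $ b $ e * ?t (K a) (K b))"
    by (intro sum.cong refl)
      (simp add: matrix_mult.sum_left matrix_mult.sum_right matrix_mult.scaleR_left matrix_mult.scaleR_right
        linear_sum[OF bounded_linear.linear[OF bounded_linear_trace]]
        linear_cmul[OF bounded_linear.linear[OF bounded_linear_trace]] sum_distrib_left mult.assoc,
        subst sum.swap, simp add: mult.left_commute)
  also have "\<dots> = (\<Sum>a\<in>UNIV. \<Sum>b\<in>UNIV. (\<Sum>e\<in>UNIV. E $ a $ e * E $ b $ e) * ?t (K a) (K b))"
    by (subst sum.swap, rule sum.cong[OF refl], subst sum.swap) (simp add: sum_distrib_right)
  also have "\<dots> = (\<Sum>a\<in>UNIV. \<Sum>b\<in>UNIV. matrix_inv A $ a $ b * ?t (K a) (K b))"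
    unfolding E by (simp add: matrix_matrix_mult_def[of E] transpose_def)
  finally show ?thesis .
qed

section \<open>Covariant derivatives in matrix form\<close>

lemmas transpose_linear_simps =
  linear_add[OF bounded_linear.linear[OF bounded_linear_transpose]]
  linear_diff[OF bounded_linear.linear[OF bounded_linear_transpose]]
  linear_neg[OF bounded_linear.linear[OF bounded_linear_transpose]]
  linear_sum[OF bounded_linear.linear[OF bounded_linear_transpose]]
  linear_cmul[OF bounded_linear.linear[OF bounded_linear_transpose]]

lemmas trace_linear_simps =
  linear_0[OF bounded_linear.linear[OF bounded_linear_trace]]
  linear_add[OF bounded_linear.linear[OF bounded_linear_trace]]
  linear_diff[OF bounded_linear.linear[OF bounded_linear_trace]]
  linear_neg[OF bounded_linear.linear[OF bounded_linear_trace]]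
  linear_sum[OF bounded_linear.linear[OF bounded_linear_trace]]
  linear_cmul[OF bounded_linear.linear[OF bounded_linear_trace]]

lemmas matrix_mult_linear_simps =
  matrix_mult.add_left matrix_mult.add_right matrix_mult.diff_left matrix_mult.diff_right
  matrix_mult.minus_left matrix_mult.minus_right matrix_mult.sum_left matrix_mult.sum_right
  matrix_mult.scaleR_left matrix_mult.scaleR_right

text \<open>The connection is used through the matrices \<open>(\<Gamma>\<^sub>a)\<^sup>l\<^sub>i = \<Gamma>\<^sup>l\<^sub>a\<^sub>i\<close>, so that
  \<open>\<nabla>\<^sub>a K = \<partial>\<^sub>a K - \<Gamma>\<^sub>a\<^sup>T K - K \<Gamma>\<^sub>a\<close> is an expression in matrices.  The connection \<open>G\<close> below is arbitrary,
  because the pull back of a connection is considered before it is known to be Levi-Civita.\<close>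

definition christoffel_matrix :: "(real^'n \<Rightarrow> real^'n^'n) \<Rightarrow> 'n::finite \<Rightarrow> real^'n \<Rightarrow> real^'n^'n" where
  "christoffel_matrix g a x = (\<chi> l i. christoffel_symbol g l a i x)"

definition cov_deriv :: "('n::finite \<Rightarrow> real^'n \<Rightarrow> real^'n^'n) \<Rightarrow> (real^'n \<Rightarrow> real^'n^'n) \<Rightarrow> 'n \<Rightarrow> real^'n \<Rightarrow> real^'n^'n" where
  "cov_deriv G K a x = pd a K x - transpose (G a x) ** K x - K x ** G a x"

definition cov_deriv2 :: "('n::finite \<Rightarrow> real^'n \<Rightarrow> real^'n^'n) \<Rightarrow> (real^'n \<Rightarrow> real^'n^'n) \<Rightarrow> 'n \<Rightarrow> 'n \<Rightarrow> real^'n \<Rightarrow> real^'n^'n" where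
  "cov_deriv2 G h a b x = cov_deriv G (cov_deriv G h b) a x - (\<Sum>c\<in>UNIV. (G a x $ c $ b) *\<^sub>R cov_deriv G h c x)"

lemma cov_deriv_cong:
  assumes "open S" "x \<in> S" "\<And>y. y \<in> S \<Longrightarrow> K y = L y"
  shows "cov_deriv G K a x = cov_deriv G L a x"
  unfolding cov_deriv_def using pd_cong[of S x K L, OF assms] assms(2,3) by simp

lemma cov1_eq: "h differentiable at x \<Longrightarrow> cov1 g h a i j x = cov_deriv (christoffel_matrix g) h a x $ i $ j"
  by (simp add: cov1_def cov_deriv_def pd_entry christoffel_matrix_def matrix_matrix_mult_def transpose_def mult.commute)

lemma smooth_on_cov_deriv:
  assumes "open S" "\<And>a. smooth_on S (G a)" "smooth_on S K"
  shows "smooth_on S (cov_deriv G K a)"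
  unfolding cov_deriv_def
  by (intro smooth_on_diff smooth_on_matrix_mult smooth_on_transpose smooth_on_pd assms)

lemma cov_deriv_sum_scaleR:
  assumes "\<And>p. u p differentiable at x" "\<And>p. K p differentiable at x"
  shows "cov_deriv G (\<lambda>y. \<Sum>p\<in>UNIV. u p y *\<^sub>R K p y) a x =
    (\<Sum>p\<in>UNIV. pd a (u p) x *\<^sub>R K p x + u p x *\<^sub>R cov_deriv G (K p) a x)"
proof -
  have "pd a (\<lambda>y. \<Sum>p\<in>UNIV. u p y *\<^sub>R K p y) x = (\<Sum>p\<in>UNIV. u p x *\<^sub>R pd a (K p) x + pd a (u p) x *\<^sub>R K p x)"
    by (simp add: pd_sum pd_scaleR assms)
  then show ?thesis
    by (simp add: cov_deriv_def matrix_mult.sum_left matrix_mult.sum_right matrix_mult.scaleR_left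
        matrix_mult.scaleR_right sum_subtractf[symmetric] algebra_simps)
qed

lemma cov_deriv_scaleR:
  assumes "u differentiable at x" "K differentiable at x"
  shows "cov_deriv G (\<lambda>y. u y *\<^sub>R K y) a x = pd a u x *\<^sub>R K x + u x *\<^sub>R cov_deriv G K a x"
  by (simp add: cov_deriv_def pd_scaleR assms matrix_mult.scaleR_left matrix_mult.scaleR_right algebra_simps)

lemma cov_deriv_add:
  assumes "K differentiable at x" "L differentiable at x"
  shows "cov_deriv G (\<lambda>y. K y + L y) a x = cov_deriv G K a x + cov_deriv G L a x"
  by (simp add: cov_deriv_def pd_add assms matrix_mult.add_left matrix_mult.add_right)

lemma cov_deriv_sym:
  assumes S: "open S" "x \<in> S" and K: "K differentiable at x" "\<And>y. y \<in> S \<Longrightarrow> transpose (K y) = K y"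
  shows "transpose (cov_deriv G K a x) = cov_deriv G K a x"
proof -
  have "transpose (pd a K x) = pd a (\<lambda>y. transpose (K y)) x"
    by (rule pd_bounded_linear[OF bounded_linear_transpose K(1), symmetric])
  also have "\<dots> = pd a K x" by (rule pd_cong[OF S]) (rule K(2))
  finally have 1: "transpose (pd a K x) = pd a K x" .
  then show ?thesis
    using K(2)[OF S(2)] by (simp add: cov_deriv_def transpose_linear_simps matrix_transpose_mul)
qed

locale local_metric =
  fixes S :: "(real^'n) set" and g :: "real^'n \<Rightarrow> real^'n^'n"
  assumes open_domain: "open S" and smooth_metric: "smooth_on S g" and posdef_metric: "\<And>x. x \<in> S \<Longrightarrow> posdef (g x)"
begin

lemma metric_sym: "x \<in> S \<Longrightarrow> transpose (g x) = g x"
  using posdef_metric by (simp add: posdef_def)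

lemma metric_sym_entry: "x \<in> S \<Longrightarrow> g x $ i $ j = g x $ j $ i"
  using arg_cong[OF metric_sym, of x "\<lambda>A. A $ j $ i"] by (simp add: transpose_def)

lemma det_pos: "x \<in> S \<Longrightarrow> det (g x) > 0"
  using posdef_metric posdef_det_pos by blast

lemma det_nz: "x \<in> S \<Longrightarrow> det (g x) \<noteq> 0"
  using det_pos by force

lemmas metric_inv = matrix_inv_det[OF det_nz]

lemma metric_differentiable: "x \<in> S \<Longrightarrow> g differentiable at x"
  using smooth_metric by (rule smooth_on_differentiable)

lemma smooth_inv: "smooth_on S (\<lambda>x. matrix_inv (g x))"
  by (intro smooth_on_matrix_inv open_domain smooth_metric det_nz)

lemma pd_sym: "x \<in> S \<Longrightarrow> pd a g x $ i $ j = pd a g x $ j $ i"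
  using pd_cong[OF open_domain, of x "\<lambda>y. g y $ i $ j" "\<lambda>y. g y $ j $ i" a] metric_sym_entry
  by (simp add: pd_entry metric_differentiable)

text \<open>The Christoffel symbols of the first kind, \<open>g \<Gamma>\<^sub>a\<close>.\<close>

definition lowered :: "'n \<Rightarrow> real^'n \<Rightarrow> real^'n^'n" where
  "lowered a x = (\<chi> m i. (1/2) * (pd a g x $ i $ m + pd i g x $ a $ m - pd m g x $ a $ i))"

lemma christoffel_lowered: "x \<in> S \<Longrightarrow> christoffel_matrix g a x = matrix_inv (g x) ** lowered a x"
  by (simp add: christoffel_matrix_def christoffel_symbol_def lowered_def matrix_matrix_mult_def vec_eq_iff pd_entry metric_differentiable
      sum_distrib_left mult.left_commute)

lemma smooth_christoffel: "smooth_on S (christoffel_matrix g a)"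
proof (rule smooth_on_cong[OF open_domain])
  show "matrix_inv (g x) ** lowered a x = christoffel_matrix g a x" if "x \<in> S" for x
    using christoffel_lowered[OF that] by simp
  have e: "smooth_on S (\<lambda>x. pd m g x $ i $ j)" for m i j
    using smooth_on_pd[OF smooth_metric] open_domain by (simp add: smooth_on_matrix_iff)
  have "smooth_on S (lowered a)"
    unfolding smooth_on_matrix_iff[OF open_domain] lowered_def vec_lambda_beta
    by (intro allI smooth_on_mult smooth_on_const smooth_on_diff smooth_on_add e open_domain)
  then show "smooth_on S (\<lambda>x. matrix_inv (g x) ** lowered a x)"
    by (intro smooth_on_matrix_mult open_domain smooth_inv)
qed

lemma torsion_free: "x \<in> S \<Longrightarrow> christoffel_matrix g a x $ l $ i = christoffel_matrix g i x $ l $ a"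
  unfolding christoffel_lowered by (simp add: matrix_matrix_mult_def lowered_def pd_sym[of x _ a i] add.commute algebra_simps)

lemma metric_times_christoffel: "x \<in> S \<Longrightarrow> g x ** christoffel_matrix g a x = lowered a x"
  by (simp add: christoffel_lowered matrix_mul_assoc metric_inv)

lemma metric_compatible: "x \<in> S \<Longrightarrow> pd a g x = transpose (christoffel_matrix g a x) ** g x + g x ** christoffel_matrix g a x"
proof -
  assume x: "x \<in> S"
  have "transpose (christoffel_matrix g a x) ** g x = transpose (lowered a x)"
    using metric_times_christoffel[OF x, of a, symmetric] by (simp add: matrix_transpose_mul metric_sym x)
  moreover have "pd a g x $ i $ j = lowered a x $ j $ i + lowered a x $ i $ j" for i j
    using pd_sym[OF x, of a i j] pd_sym[OF x, of i a j] pd_sym[OF x, of j a i] by (simp add: lowered_def field_simps)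
  ultimately show ?thesis
    by (simp add: metric_times_christoffel[OF x] transpose_def vec_eq_iff)
qed

lemma cov_deriv_metric: "x \<in> S \<Longrightarrow> cov_deriv (christoffel_matrix g) g a x = 0"
  by (simp add: cov_deriv_def metric_compatible)

text \<open>The Koszul formula.  This uniqueness is what makes the Christoffel symbols transform correctly
  under changes of coordinates.\<close>

lemma levi_civita_unique:
  assumes x: "x \<in> S" and tors: "\<And>a l i. G a $ l $ i = G i $ l $ a"
    and met: "\<And>a. pd a g x = transpose (G a) ** g x + g x ** G a"
  shows "G a = christoffel_matrix g a x"
proof -
  define N where "N a = g x ** G a" for a
  have N: "N a $ m $ i = N i $ m $ a" for a m i
    using tors by (simp add: N_def matrix_matrix_mult_def)
  have "transpose (G a) ** g x = transpose (N a)" for a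
    by (simp add: N_def matrix_transpose_mul metric_sym x)
  then have met': "pd a g x $ i $ m = N a $ m $ i + N a $ i $ m" for a i m
    unfolding met by (simp add: N_def[symmetric] transpose_def)
  have "lowered a x $ m $ i = N a $ m $ i" for m i
    using N[of a m i] N[of a i m] N[of i a m] by (simp add: lowered_def met' field_simps)
  then have "lowered a x = N a" by (simp add: vec_eq_iff)
  then have "christoffel_matrix g a x = matrix_inv (g x) ** (g x ** G a)" using christoffel_lowered[OF x] N_def by simp
  then show ?thesis by (simp add: matrix_mul_assoc metric_inv x)
qed

lemma smooth_cov_deriv: "smooth_on S K \<Longrightarrow> smooth_on S (cov_deriv (christoffel_matrix g) K a)"
  by (rule smooth_on_cov_deriv[OF open_domain smooth_christoffel])

lemma cov2_eq:
  assumes h: "smooth_on S h" and x: "x \<in> S"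
  shows "cov2 g h a b i j x = cov_deriv2 (christoffel_matrix g) h a b x $ i $ j"
proof -
  have c1: "cov1 g h b i j y = cov_deriv (christoffel_matrix g) h b y $ i $ j" if "y \<in> S" for y b i j
    by (rule cov1_eq) (rule smooth_on_differentiable[OF h that])
  have "pd a (cov1 g h b i j) x = pd a (\<lambda>y. cov_deriv (christoffel_matrix g) h b y $ i $ j) x"
    by (rule pd_cong[OF open_domain x]) (rule c1)
  also have "\<dots> = pd a (cov_deriv (christoffel_matrix g) h b) x $ i $ j"
    by (rule pd_entry) (rule smooth_on_differentiable[OF smooth_cov_deriv[OF h] x])
  finally show ?thesis
    by (simp add: cov2_def c1[OF x] cov_deriv2_def cov_deriv_def[of _ "cov_deriv _ _ _"] christoffel_matrix_def matrix_matrix_mult_def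
        transpose_def mult.commute)
qed

lemma bochner_eq:
  assumes h: "smooth_on S h" and x: "x \<in> S"
  shows "bochner_local g h x = - (\<Sum>a\<in>UNIV. \<Sum>b\<in>UNIV. matrix_inv (g x) $ a $ b *\<^sub>R cov_deriv2 (christoffel_matrix g) h a b x)"
  by (simp add: bochner_local_def cov2_eq[OF h x] vec_eq_iff)

lemma bochner_sym:
  assumes h: "smooth_on S h" "\<And>y. y \<in> S \<Longrightarrow> transpose (h y) = h y" and x: "x \<in> S"
  shows "transpose (bochner_local g h x) = bochner_local g h x"
proof -
  have 1: "transpose (cov_deriv (christoffel_matrix g) h b y) = cov_deriv (christoffel_matrix g) h b y" if "y \<in> S" for b y
    by (rule cov_deriv_sym[OF open_domain that smooth_on_differentiable[OF h(1) that] h(2)])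
  then have 2: "transpose (cov_deriv (christoffel_matrix g) (cov_deriv (christoffel_matrix g) h b) a x) = cov_deriv (christoffel_matrix g) (cov_deriv (christoffel_matrix g) h b) a x" for a b
    by (intro cov_deriv_sym[OF open_domain x smooth_on_differentiable[OF smooth_cov_deriv[OF h(1)] x]])
  have "transpose (cov_deriv2 (christoffel_matrix g) h a b x) = cov_deriv2 (christoffel_matrix g) h a b x" for a b
    by (simp add: cov_deriv2_def transpose_linear_simps 1 2 x)
  then show ?thesis
    by (simp add: bochner_eq[OF h(1) x] transpose_linear_simps)
qed

lemma bochner_add_scale:
  assumes h: "smooth_on S h" and k: "smooth_on S k" and x: "x \<in> S"
  shows "bochner_local g (\<lambda>y. h y + c *\<^sub>R k y) x = bochner_local g h x + c *\<^sub>R bochner_local g k x"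
proof -
  have ck: "smooth_on S (\<lambda>y. c *\<^sub>R k y)" if "smooth_on S k" for k :: "real^'n \<Rightarrow> real^'n^'n"
    by (rule smooth_on_scaleR[OF open_domain smooth_on_const that])
  have c0: "cov_deriv (christoffel_matrix g) (\<lambda>y. c *\<^sub>R k y) a y = c *\<^sub>R cov_deriv (christoffel_matrix g) k a y" if "smooth_on S k" "y \<in> S" for k a y
    using cov_deriv_scaleR[OF _ smooth_on_differentiable[OF that], of "\<lambda>_. c"] by simp
  have c1: "cov_deriv (christoffel_matrix g) (\<lambda>y. h y + c *\<^sub>R k y) a y = cov_deriv (christoffel_matrix g) h a y + c *\<^sub>R cov_deriv (christoffel_matrix g) k a y"
    if "smooth_on S h" "smooth_on S k" "y \<in> S" for h k :: "real^'n \<Rightarrow> real^'n^'n" and a y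
    using cov_deriv_add[OF smooth_on_differentiable[OF that(1,3)] smooth_on_differentiable[OF ck[OF that(2)] that(3)]]
      c0[OF that(2,3)] by simp
  have "cov_deriv (christoffel_matrix g) (cov_deriv (christoffel_matrix g) (\<lambda>y. h y + c *\<^sub>R k y) b) a x =
      cov_deriv (christoffel_matrix g) (\<lambda>y. cov_deriv (christoffel_matrix g) h b y + c *\<^sub>R cov_deriv (christoffel_matrix g) k b y) a x" for a b
    by (rule cov_deriv_cong[OF open_domain x]) (rule c1[OF h k])
  then have "cov_deriv2 (christoffel_matrix g) (\<lambda>y. h y + c *\<^sub>R k y) a b x = cov_deriv2 (christoffel_matrix g) h a b x + c *\<^sub>R cov_deriv2 (christoffel_matrix g) k a b x" for a b
    by (simp add: cov_deriv2_def c1[OF h k x] c1[OF smooth_cov_deriv[OF h] smooth_cov_deriv[OF k] x]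
        sum.distrib scaleR_sum_right algebra_simps)
  moreover have "smooth_on S (\<lambda>y. h y + c *\<^sub>R k y)" by (intro smooth_on_add open_domain h ck k)
  ultimately show ?thesis
    by (simp add: bochner_eq h k x sum.distrib scaleR_sum_right scaleR_left_commute algebra_simps)
qed

lemma bochner_metric: "x \<in> S \<Longrightarrow> bochner_local g (\<lambda>y. c *\<^sub>R g y) x = 0"
proof -
  assume x: "x \<in> S"
  have "cov_deriv (christoffel_matrix g) (\<lambda>y. c *\<^sub>R g y) b y = 0" if "y \<in> S" for b y
    using cov_deriv_scaleR[OF _ metric_differentiable[OF that], of "\<lambda>_. c"] cov_deriv_metric[OF that] by simp
  then have "cov_deriv2 (christoffel_matrix g) (\<lambda>y. c *\<^sub>R g y) a b x = 0" for a b
    using cov_deriv_cong[OF open_domain x, of "cov_deriv (christoffel_matrix g) (\<lambda>y. c *\<^sub>R g y) b" "\<lambda>_. 0"] x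
    by (simp add: cov_deriv2_def) (simp add: cov_deriv_def)
  moreover have "smooth_on S (\<lambda>y. c *\<^sub>R g y)" by (intro smooth_on_scaleR open_domain smooth_metric smooth_on_const)
  ultimately show ?thesis using x by (simp add: bochner_eq)
qed

end

section \<open>Behaviour under changes of coordinates\<close>

locale coordinate_change = src: local_metric S g + tgt: local_metric T g'
  for S :: "(real^'n) set" and g and T :: "(real^'n) set" and g' +
  fixes \<phi> :: "real^'n \<Rightarrow> real^'n" and J
  assumes \<phi>: "smooth_on S \<phi>" "\<And>x. x \<in> S \<Longrightarrow> \<phi> x \<in> T"
    and J_def: "\<And>x. J x = matrix (frechet_derivative \<phi> (at x))"
    and J_det: "\<And>x. x \<in> S \<Longrightarrow> det (J x) \<noteq> 0"
    and metric_pull: "\<And>x. x \<in> S \<Longrightarrow> g x = transpose (J x) ** g' (\<phi> x) ** J x"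
begin

lemma J_nth: "J x $ p $ i = pd i \<phi> x $ p"
  by (simp add: J_def matrix_def pd_def)

lemma smooth_J: "smooth_on S J"
  unfolding smooth_on_matrix_iff[OF src.open_domain] J_nth
  using smooth_on_pd[OF \<phi>(1)] by (simp add: smooth_on_vec_iff[OF src.open_domain])

lemma \<phi>_differentiable: "x \<in> S \<Longrightarrow> \<phi> differentiable at x"
  using \<phi>(1) by (rule smooth_on_differentiable)

lemma Jac_differentiable: "x \<in> S \<Longrightarrow> J differentiable at x"
  using smooth_J by (rule smooth_on_differentiable)

lemma smooth_pull: "smooth_on T K \<Longrightarrow> smooth_on S (\<lambda>x. K (\<phi> x))"
  by (rule smooth_on_compose[OF src.open_domain tgt.open_domain \<phi>(1) _ \<phi>(2)])

lemma smooth_pull_matrix: "smooth_on T K \<Longrightarrow> smooth_on S (\<lambda>x. transpose (J x) ** K (\<phi> x) ** J x)"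
  by (intro smooth_on_matrix_mult smooth_on_transpose smooth_J smooth_pull src.open_domain)

lemma pd_pull:
  fixes K :: "real^'n \<Rightarrow> real^'n^'n"
  assumes "smooth_on T K" "x \<in> S"
  shows "pd a (\<lambda>y. K (\<phi> y)) x = (\<Sum>p\<in>UNIV. J x $ p $ a *\<^sub>R pd p K (\<phi> x))"
  using pd_compose[OF \<phi>_differentiable[OF assms(2)] smooth_on_differentiable[OF assms(1) \<phi>(2)[OF assms(2)]]]
  by (simp add: J_nth)

lemma pd_J: "x \<in> S \<Longrightarrow> pd a J x $ p $ i = pd i J x $ p $ a"
proof -
  assume x: "x \<in> S"
  have "pd a J x $ p $ i = pd a (pd i \<phi>) x $ p" for a i
  proof -
    have "pd a J x $ p $ i = pd a (\<lambda>y. J y $ p $ i) x" by (rule pd_entry[OF Jac_differentiable[OF x], symmetric])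
    also have "\<dots> = pd a (\<lambda>y. pd i \<phi> y $ p) x" by (simp add: J_nth)
    also have "\<dots> = pd a (pd i \<phi>) x $ p"
      by (rule pd_nth) (rule smooth_on_differentiable[OF smooth_on_pd[OF \<phi>(1)] x])
    finally show ?thesis .
  qed
  then show ?thesis using pd_commute[OF \<phi>(1) src.open_domain x, of a i] by simp
qed

text \<open>The usual transformation law of connections, taken as a definition: it is shown below that this
  is the Levi-Civita connection of the pulled back metric.\<close>

definition pull_connection :: "'n \<Rightarrow> real^'n \<Rightarrow> real^'n^'n" where
  "pull_connection a x = matrix_inv (J x) ** (pd a J x + (\<Sum>p\<in>UNIV. J x $ p $ a *\<^sub>R (christoffel_matrix g' p (\<phi> x) ** J x)))"

lemma Jac_pull_connection: "x \<in> S \<Longrightarrow>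
    J x ** pull_connection a x = pd a J x + (\<Sum>p\<in>UNIV. J x $ p $ a *\<^sub>R (christoffel_matrix g' p (\<phi> x) ** J x))"
  unfolding pull_connection_def by (simp add: matrix_mul_assoc matrix_inv_det[OF J_det])

text \<open>The first summand of the transformation law cancels the derivatives of the Jacobian that arise
  from the product rule.\<close>

lemma cov_deriv_pull_connection:
  assumes K: "smooth_on T K" and x: "x \<in> S"
  shows "cov_deriv pull_connection (\<lambda>y. transpose (J y) ** K (\<phi> y) ** J y) a x =
    transpose (J x) ** (\<Sum>p\<in>UNIV. J x $ p $ a *\<^sub>R cov_deriv (christoffel_matrix g') K p (\<phi> x)) ** J x"
proof -
  let ?J = "J x" and ?K = "K (\<phi> x)"
  let ?C = "\<Sum>p\<in>UNIV. J x $ p $ a *\<^sub>R christoffel_matrix g' p (\<phi> x)"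
  have Kd: "(\<lambda>y. K (\<phi> y)) differentiable at x"
    by (rule smooth_on_differentiable[OF smooth_pull[OF K] x])
  have Jt: "(\<lambda>y. transpose (J y)) differentiable at x"
    by (rule smooth_on_differentiable[OF smooth_on_transpose[OF src.open_domain smooth_J] x])
  have JK: "(\<lambda>y. transpose (J y) ** K (\<phi> y)) differentiable at x"
    by (rule smooth_on_differentiable[OF smooth_on_matrix_mult[OF src.open_domain smooth_on_transpose[OF src.open_domain smooth_J] smooth_pull[OF K]] x])
  have C: "?J ** pull_connection a x = pd a J x + ?C ** ?J"
    unfolding Jac_pull_connection[OF x] by (simp add: matrix_mult_linear_simps)
  have Ct: "transpose (pull_connection a x) ** transpose ?J = transpose (pd a J x) + transpose ?J ** transpose ?C"
    using arg_cong[OF C, of transpose] by (simp add: matrix_transpose_mul transpose_linear_simps)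
  have "pd a (\<lambda>y. transpose (J y) ** K (\<phi> y) ** J y) x =
      transpose ?J ** ?K ** pd a J x + (transpose ?J ** pd a (\<lambda>y. K (\<phi> y)) x + transpose (pd a J x) ** ?K) ** ?J"
    by (simp add: pd_matrix_mult[OF JK Jac_differentiable[OF x]] pd_matrix_mult[OF Jt Kd]
        pd_bounded_linear[OF bounded_linear_transpose Jac_differentiable[OF x]])
  moreover have "transpose (pull_connection a x) ** (transpose ?J ** ?K ** ?J) =
      (transpose (pd a J x) + transpose ?J ** transpose ?C) ** ?K ** ?J"
    unfolding Ct[symmetric] by (simp add: matrix_mul_assoc)
  moreover have "transpose ?J ** ?K ** ?J ** pull_connection a x = transpose ?J ** ?K ** (pd a J x + ?C ** ?J)"
    unfolding C[symmetric] by (simp add: matrix_mul_assoc)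
  ultimately have "cov_deriv pull_connection (\<lambda>y. transpose (J y) ** K (\<phi> y) ** J y) a x =
      transpose ?J ** (pd a (\<lambda>y. K (\<phi> y)) x - transpose ?C ** ?K - ?K ** ?C) ** ?J"
    unfolding cov_deriv_def by (simp add: matrix_mult.add_left matrix_mult.add_right matrix_mult.diff_left matrix_mult.diff_right matrix_mul_assoc)
  also have "pd a (\<lambda>y. K (\<phi> y)) x - transpose ?C ** ?K - ?K ** ?C =
      (\<Sum>p\<in>UNIV. J x $ p $ a *\<^sub>R cov_deriv (christoffel_matrix g') K p (\<phi> x))"
    unfolding pd_pull[OF K x] cov_deriv_def
    by (simp add: transpose_linear_simps matrix_mult_linear_simps sum_subtractf sum.distrib algebra_simps)
  finally show ?thesis .
qed

text \<open>Torsion-freeness is the symmetry of the second derivatives of \<open>\<phi>\<close>, and the pulled back metric is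
  parallel because the original one is.\<close>

lemma pull_connection_eq: "x \<in> S \<Longrightarrow> pull_connection a x = christoffel_matrix g a x"
proof (rule src.levi_civita_unique[where G="\<lambda>a. pull_connection a x"])
  assume x: "x \<in> S"
  show "pull_connection a x $ l $ i = pull_connection i x $ l $ a" for a l i
  proof -
    have 1: "(J x ** pull_connection a x) $ p $ i = (J x ** pull_connection i x) $ p $ a" for p a i
    proof -
      have *: "(\<Sum>q\<in>UNIV. J x $ q $ a *\<^sub>R (christoffel_matrix g' q (\<phi> x) ** J x)) $ p $ i =
        (\<Sum>q\<in>UNIV. \<Sum>r\<in>UNIV. J x $ q $ a * J x $ r $ i * christoffel_matrix g' q (\<phi> x) $ p $ r)" for a i
        by (simp add: matrix_matrix_mult_def sum_distrib_left mult_ac)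
      have "(\<Sum>q\<in>UNIV. \<Sum>r\<in>UNIV. J x $ q $ a * J x $ r $ i * christoffel_matrix g' q (\<phi> x) $ p $ r) =
        (\<Sum>q\<in>UNIV. \<Sum>r\<in>UNIV. J x $ q $ i * J x $ r $ a * christoffel_matrix g' q (\<phi> x) $ p $ r)"
        by (subst sum.swap) (simp add: tgt.torsion_free[OF \<phi>(2)[OF x], of _ p] mult_ac)
      then show ?thesis
        unfolding Jac_pull_connection[OF x] vector_add_component * using pd_J[OF x] by simp
    qed
    have e: "pull_connection a x = matrix_inv (J x) ** (J x ** pull_connection a x)" for a
      by (simp add: matrix_mul_assoc matrix_inv_det[OF J_det[OF x]])
    have "pull_connection a x $ l $ i = (\<Sum>p\<in>UNIV. matrix_inv (J x) $ l $ p * (J x ** pull_connection a x) $ p $ i)" for a i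
      by (subst e) (simp add: matrix_matrix_mult_def[of "matrix_inv (J x)"])
    then show ?thesis using 1 by simp
  qed
  show "pd a g x = transpose (pull_connection a x) ** g x + g x ** pull_connection a x" for a
  proof -
    have "cov_deriv pull_connection g a x = cov_deriv pull_connection (\<lambda>y. transpose (J y) ** g' (\<phi> y) ** J y) a x"
      by (rule cov_deriv_cong[OF src.open_domain x metric_pull])
    also have "\<dots> = 0"
      unfolding cov_deriv_pull_connection[OF tgt.smooth_metric x] by (simp add: tgt.cov_deriv_metric \<phi>(2) x)
    finally show ?thesis by (simp add: cov_deriv_def algebra_simps)
  qed
qed

lemma cov_deriv_pull:
  assumes K: "smooth_on T K" and x: "x \<in> S"
  shows "cov_deriv (christoffel_matrix g) (\<lambda>y. transpose (J y) ** K (\<phi> y) ** J y) a x =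
    (\<Sum>p\<in>UNIV. J x $ p $ a *\<^sub>R (transpose (J x) ** cov_deriv (christoffel_matrix g') K p (\<phi> x) ** J x))"
  using cov_deriv_pull_connection[OF K x, of a]
  by (simp add: cov_deriv_def[of pull_connection] cov_deriv_def[of "christoffel_matrix g"] pull_connection_eq[OF x] matrix_mult_linear_simps)

lemma christoffel_pull: "x \<in> S \<Longrightarrow> (\<Sum>c\<in>UNIV. J x $ p $ c * christoffel_matrix g a x $ c $ b) =
    pd a J x $ p $ b + (\<Sum>q\<in>UNIV. \<Sum>r\<in>UNIV. J x $ q $ a * J x $ r $ b * christoffel_matrix g' q (\<phi> x) $ p $ r)"
  using arg_cong[OF Jac_pull_connection[of x a], of "\<lambda>A. A $ p $ b"]
  by (simp add: pull_connection_eq matrix_matrix_mult_def sum_distrib_left mult_ac)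

text \<open>The second derivatives of \<open>\<phi>\<close> produced by the outer derivative cancel against those in the law for
  the Christoffel matrix that is contracted with the derivative index.\<close>

lemma cov_deriv2_pull:
  assumes h: "smooth_on T h'" "\<And>x. x \<in> S \<Longrightarrow> h x = transpose (J x) ** h' (\<phi> x) ** J x" and x: "x \<in> S"
  shows "cov_deriv2 (christoffel_matrix g) h a b x =
    (\<Sum>q\<in>UNIV. \<Sum>r\<in>UNIV. (J x $ q $ a * J x $ r $ b) *\<^sub>R (transpose (J x) ** cov_deriv2 (christoffel_matrix g') h' q r (\<phi> x) ** J x))"
proof -
  let ?c = "\<lambda>x M. transpose (J x) ** M ** J x"
  define K where "K p = cov_deriv (christoffel_matrix g') h' p" for p
  have K: "smooth_on T (K p)" for p unfolding K_def by (rule tgt.smooth_cov_deriv[OF h(1)])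
  have 1: "cov_deriv (christoffel_matrix g) h b y = (\<Sum>p\<in>UNIV. J y $ p $ b *\<^sub>R ?c y (K p (\<phi> y)))" if "y \<in> S" for y b
    using cov_deriv_cong[OF src.open_domain that h(2), where G="christoffel_matrix g" and a=b] cov_deriv_pull[OF h(1) that] by (simp add: K_def)
  have "cov_deriv (christoffel_matrix g) (cov_deriv (christoffel_matrix g) h b) a x = cov_deriv (christoffel_matrix g) (\<lambda>y. \<Sum>p\<in>UNIV. J y $ p $ b *\<^sub>R ?c y (K p (\<phi> y))) a x"
    by (rule cov_deriv_cong[OF src.open_domain x 1])
  also have "\<dots> = (\<Sum>p\<in>UNIV. pd a (\<lambda>y. J y $ p $ b) x *\<^sub>R ?c x (K p (\<phi> x)) +
      J x $ p $ b *\<^sub>R cov_deriv (christoffel_matrix g) (\<lambda>y. ?c y (K p (\<phi> y))) a x)"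
  proof (rule cov_deriv_sum_scaleR)
    show "(\<lambda>y. J y $ p $ b) differentiable at x" for p
      using smooth_J src.open_domain x by (intro smooth_on_differentiable[of S]) (auto simp: smooth_on_matrix_iff)
    show "(\<lambda>y. ?c y (K p (\<phi> y))) differentiable at x" for p
      by (rule smooth_on_differentiable[OF smooth_pull_matrix[OF K] x])
  qed
  also have "\<dots> = (\<Sum>p\<in>UNIV. pd a J x $ p $ b *\<^sub>R ?c x (K p (\<phi> x))) +
      (\<Sum>q\<in>UNIV. \<Sum>r\<in>UNIV. (J x $ q $ a * J x $ r $ b) *\<^sub>R ?c x (cov_deriv (christoffel_matrix g') (K r) q (\<phi> x)))"
    by (subst sum.swap)
      (simp add: sum.distrib pd_entry[OF Jac_differentiable[OF x]] cov_deriv_pull[OF K x] scaleR_sum_right mult.commute)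
  finally have A: "cov_deriv (christoffel_matrix g) (cov_deriv (christoffel_matrix g) h b) a x = \<dots>" .
  have "(\<Sum>c\<in>UNIV. christoffel_matrix g a x $ c $ b *\<^sub>R cov_deriv (christoffel_matrix g) h c x) =
      (\<Sum>p\<in>UNIV. (\<Sum>c\<in>UNIV. J x $ p $ c * christoffel_matrix g a x $ c $ b) *\<^sub>R ?c x (K p (\<phi> x)))"
    by (simp add: 1[OF x] scaleR_sum_right scaleR_sum_left, subst sum.swap, simp add: mult.commute)
  also have "\<dots> = (\<Sum>p\<in>UNIV. pd a J x $ p $ b *\<^sub>R ?c x (K p (\<phi> x))) +
      (\<Sum>p\<in>UNIV. \<Sum>q\<in>UNIV. \<Sum>r\<in>UNIV. (J x $ q $ a * J x $ r $ b * christoffel_matrix g' q (\<phi> x) $ p $ r) *\<^sub>R ?c x (K p (\<phi> x)))"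
    unfolding christoffel_pull[OF x] by (simp add: scaleR_add_left sum.distrib scaleR_sum_left)
  also have "(\<Sum>p\<in>UNIV. \<Sum>q\<in>UNIV. \<Sum>r\<in>UNIV. (J x $ q $ a * J x $ r $ b * christoffel_matrix g' q (\<phi> x) $ p $ r) *\<^sub>R ?c x (K p (\<phi> x))) =
      (\<Sum>q\<in>UNIV. \<Sum>r\<in>UNIV. \<Sum>p\<in>UNIV. (J x $ q $ a * J x $ r $ b * christoffel_matrix g' q (\<phi> x) $ p $ r) *\<^sub>R ?c x (K p (\<phi> x)))"
    by (subst sum.swap, rule sum.cong[OF refl], rule sum.swap)
  finally have B: "(\<Sum>c\<in>UNIV. christoffel_matrix g a x $ c $ b *\<^sub>R cov_deriv (christoffel_matrix g) h c x) =
      (\<Sum>p\<in>UNIV. pd a J x $ p $ b *\<^sub>R ?c x (K p (\<phi> x))) +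
      (\<Sum>q\<in>UNIV. \<Sum>r\<in>UNIV. \<Sum>p\<in>UNIV. (J x $ q $ a * J x $ r $ b * christoffel_matrix g' q (\<phi> x) $ p $ r) *\<^sub>R ?c x (K p (\<phi> x)))" .
  show ?thesis
    unfolding cov_deriv2_def[of "christoffel_matrix g"] A B
    by (simp add: cov_deriv2_def K_def[symmetric] matrix_mult_linear_simps scaleR_diff_right scaleR_sum_right
        sum_subtractf)
qed

lemma metric_inv_pull: "x \<in> S \<Longrightarrow> J x ** matrix_inv (g x) ** transpose (J x) = matrix_inv (g' (\<phi> x))"
proof -
  assume x: "x \<in> S"
  have "transpose (J x) ** (g' (\<phi> x) ** (J x ** matrix_inv (g x) ** transpose (J x))) =
      (g x ** matrix_inv (g x)) ** transpose (J x)"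
    unfolding metric_pull[OF x] by (simp add: matrix_mul_assoc)
  also have "\<dots> = transpose (J x)" by (simp add: src.metric_inv x)
  finally have "matrix_inv (transpose (J x)) ** (transpose (J x) ** (g' (\<phi> x) ** (J x ** matrix_inv (g x) ** transpose (J x)))) =
    matrix_inv (transpose (J x)) ** transpose (J x)" by simp
  moreover have "det (transpose (J x)) \<noteq> 0" using J_det[OF x] by simp
  ultimately have "g' (\<phi> x) ** (J x ** matrix_inv (g x) ** transpose (J x)) = mat 1"
    unfolding matrix_mul_assoc by (simp add: matrix_inv_det)
  then show ?thesis by (rule matrix_inv_eqI[symmetric])
qed

lemma bochner_pull:
  assumes h: "smooth_on T h'" "\<And>x. x \<in> S \<Longrightarrow> h x = transpose (J x) ** h' (\<phi> x) ** J x" and x: "x \<in> S"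
  shows "bochner_local g h x = transpose (J x) ** bochner_local g' h' (\<phi> x) ** J x"
proof -
  let ?c = "\<lambda>M. transpose (J x) ** M ** J x"
  have hs: "smooth_on S h"
    by (rule smooth_on_cong[OF src.open_domain h(2)[symmetric] smooth_pull_matrix[OF h(1)]])
  have "(\<Sum>a\<in>UNIV. \<Sum>b\<in>UNIV. matrix_inv (g x) $ a $ b *\<^sub>R cov_deriv2 (christoffel_matrix g) h a b x) =
    (\<Sum>a\<in>UNIV. \<Sum>b\<in>UNIV. \<Sum>q\<in>UNIV. \<Sum>r\<in>UNIV. (J x $ q $ a * matrix_inv (g x) $ a $ b * J x $ r $ b) *\<^sub>R ?c (cov_deriv2 (christoffel_matrix g') h' q r (\<phi> x)))"
    by (simp add: cov_deriv2_pull[OF h x] scaleR_sum_right mult_ac)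
  also have "\<dots> = (\<Sum>a\<in>UNIV. \<Sum>q\<in>UNIV. \<Sum>r\<in>UNIV. \<Sum>b\<in>UNIV. (J x $ q $ a * matrix_inv (g x) $ a $ b * J x $ r $ b) *\<^sub>R ?c (cov_deriv2 (christoffel_matrix g') h' q r (\<phi> x)))"
    by (rule sum.cong[OF refl], subst sum.swap, rule sum.cong[OF refl], rule sum.swap)
  also have "\<dots> = (\<Sum>q\<in>UNIV. \<Sum>r\<in>UNIV. \<Sum>a\<in>UNIV. \<Sum>b\<in>UNIV. (J x $ q $ a * matrix_inv (g x) $ a $ b * J x $ r $ b) *\<^sub>R ?c (cov_deriv2 (christoffel_matrix g') h' q r (\<phi> x)))"
    by (subst sum.swap, rule sum.cong[OF refl], rule sum.swap)
  also have "\<dots> = (\<Sum>q\<in>UNIV. \<Sum>r\<in>UNIV. (J x ** matrix_inv (g x) ** transpose (J x)) $ q $ r *\<^sub>R ?c (cov_deriv2 (christoffel_matrix g') h' q r (\<phi> x)))"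
  proof (intro sum.cong refl)
    fix q r
    have "(J x ** matrix_inv (g x) ** transpose (J x)) $ q $ r = (\<Sum>a\<in>UNIV. \<Sum>b\<in>UNIV. J x $ q $ a * matrix_inv (g x) $ a $ b * J x $ r $ b)"
      by (subst sum.swap) (simp add: matrix_matrix_mult_def transpose_def sum_distrib_right)
    then show "(\<Sum>a\<in>UNIV. \<Sum>b\<in>UNIV. (J x $ q $ a * matrix_inv (g x) $ a $ b * J x $ r $ b) *\<^sub>R ?c (cov_deriv2 (christoffel_matrix g') h' q r (\<phi> x))) =
      (J x ** matrix_inv (g x) ** transpose (J x)) $ q $ r *\<^sub>R ?c (cov_deriv2 (christoffel_matrix g') h' q r (\<phi> x))"
      by (simp add: scaleR_sum_left)
  qed
  finally show ?thesis
    unfolding src.bochner_eq[OF hs x] tgt.bochner_eq[OF h(1) \<phi>(2)[OF x]] metric_inv_pull[OF x]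
    by (simp add: matrix_mult_linear_simps)
qed

end

section \<open>Leibniz rule and divergence\<close>

definition fibre_metric :: "(real^'n \<Rightarrow> real^'n^'n) \<Rightarrow> (real^'n \<Rightarrow> real^'n^'n) \<Rightarrow> (real^'n \<Rightarrow> real^'n^'n) \<Rightarrow> real^'n \<Rightarrow> real" where
  "fibre_metric g h k x = trace (matrix_inv (g x) ** h x ** matrix_inv (g x) ** k x)"

text \<open>The divergence of a covector field, \<open>g\<^sup>a\<^sup>b \<nabla>\<^sub>a W\<^sub>b\<close>.\<close>

definition (in local_metric) div_cov :: "('n \<Rightarrow> real^'n \<Rightarrow> real) \<Rightarrow> real^'n \<Rightarrow> real" where
  "div_cov W x = (\<Sum>a\<in>UNIV. \<Sum>b\<in>UNIV. matrix_inv (g x) $ a $ b * (pd a (W b) x - (\<Sum>c\<in>UNIV. christoffel_matrix g a x $ c $ b * W c x)))"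

context local_metric begin

lemma pd_inv: "x \<in> S \<Longrightarrow> pd a (\<lambda>y. matrix_inv (g y)) x =
    - (matrix_inv (g x) ** transpose (christoffel_matrix g a x)) - christoffel_matrix g a x ** matrix_inv (g x)"
proof -
  assume x: "x \<in> S"
  let ?i = "matrix_inv (g x)" and ?G = "christoffel_matrix g a x"
  have "pd a (\<lambda>y. matrix_inv (g y)) x = - (?i ** pd a g x ** ?i)"
    by (rule pd_matrix_inv[OF open_domain x smooth_metric det_nz])
  also have "?i ** pd a g x ** ?i = ?i ** transpose ?G ** (g x ** ?i) + (?i ** g x) ** ?G ** ?i"
    unfolding metric_compatible[OF x] by (simp add: matrix_mult.add_left matrix_mult.add_right matrix_mul_assoc)
  finally show ?thesis by (simp add: metric_inv x)
qed

lemma smooth_fibre_metric: "smooth_on S h \<Longrightarrow> smooth_on S k \<Longrightarrow> smooth_on S (fibre_metric g h k)"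
  unfolding fibre_metric_def by (intro smooth_on_trace smooth_on_matrix_mult open_domain smooth_inv)

lemma fibre_metric_commute: "x \<in> S \<Longrightarrow> fibre_metric g h k x = fibre_metric g k h x"
  unfolding fibre_metric_def by (metis matrix_mul_assoc trace_mul_sym)

text \<open>The Christoffel matrices enter as a commutator, on which the trace vanishes.\<close>

lemma pd_fibre_metric:
  assumes h: "smooth_on S h" and k: "smooth_on S k" and x: "x \<in> S"
  shows "pd a (fibre_metric g h k) x = fibre_metric g (cov_deriv (christoffel_matrix g) h a) k x + fibre_metric g h (cov_deriv (christoffel_matrix g) k a) x"
proof -
  let ?i = "matrix_inv (g x)" and ?G = "christoffel_matrix g a x" and ?h = "h x" and ?k = "k x"
  let ?H = "cov_deriv (christoffel_matrix g) h a x" and ?K = "cov_deriv (christoffel_matrix g) k a x"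
  note d = smooth_on_differentiable[OF _ x]
  note s1 = smooth_on_matrix_mult[OF open_domain smooth_inv h]
  note s2 = smooth_on_matrix_mult[OF open_domain s1 smooth_inv]
  note s3 = smooth_on_matrix_mult[OF open_domain s2 k]
  have ph: "pd a h x = ?H + transpose ?G ** ?h + ?h ** ?G" by (simp add: cov_deriv_def)
  have pk: "pd a k x = ?K + transpose ?G ** ?k + ?k ** ?G" by (simp add: cov_deriv_def)
  have "pd a (fibre_metric g h k) x = trace (pd a (\<lambda>y. matrix_inv (g y) ** h y ** matrix_inv (g y) ** k y) x)"
    unfolding fibre_metric_def[abs_def] by (rule pd_bounded_linear[OF bounded_linear_trace d[OF s3]])
  also have "pd a (\<lambda>y. matrix_inv (g y) ** h y ** matrix_inv (g y) ** k y) x =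
      ?i ** ?h ** ?i ** pd a k x + (?i ** ?h ** pd a (\<lambda>y. matrix_inv (g y)) x +
        (?i ** pd a h x + pd a (\<lambda>y. matrix_inv (g y)) x ** ?h) ** ?i) ** ?k"
    by (simp add: pd_matrix_mult[OF d[OF s2] d[OF k]] pd_matrix_mult[OF d[OF s1] d[OF smooth_inv]]
        pd_matrix_mult[OF d[OF smooth_inv] d[OF h]])
  also have "\<dots> = ?i ** ?h ** ?i ** ?K + ?i ** ?H ** ?i ** ?k + ((?i ** ?h ** ?i ** ?k) ** ?G - ?G ** (?i ** ?h ** ?i ** ?k))"
    unfolding ph pk pd_inv[OF x]
    by (simp add: matrix_mult.add_left matrix_mult.add_right matrix_mult.diff_left matrix_mult.diff_right
        matrix_mult.minus_left matrix_mult.minus_right matrix_mul_assoc)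
  also have "trace \<dots> = trace (?i ** ?h ** ?i ** ?K) + trace (?i ** ?H ** ?i ** ?k)"
    using trace_mul_sym[of "?i ** ?h ** ?i ** ?k" ?G] by (simp add: trace_linear_simps)
  finally show ?thesis by (simp add: fibre_metric_def[abs_def])
qed

lemma div_fibre_metric:
  assumes h: "smooth_on S h" and k: "smooth_on S k" and x: "x \<in> S"
  shows "div_cov (\<lambda>b. fibre_metric g (cov_deriv (christoffel_matrix g) h b) k) x =
    - fibre_metric g (bochner_local g h) k x +
      (\<Sum>a\<in>UNIV. \<Sum>b\<in>UNIV. matrix_inv (g x) $ a $ b * fibre_metric g (cov_deriv (christoffel_matrix g) h b) (cov_deriv (christoffel_matrix g) k a) x)"
proof -
  have "pd a (fibre_metric g (cov_deriv (christoffel_matrix g) h b) k) x - (\<Sum>c\<in>UNIV. christoffel_matrix g a x $ c $ b * fibre_metric g (cov_deriv (christoffel_matrix g) h c) k x) =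
      fibre_metric g (cov_deriv2 (christoffel_matrix g) h a b) k x + fibre_metric g (cov_deriv (christoffel_matrix g) h b) (cov_deriv (christoffel_matrix g) k a) x" for a b
    unfolding pd_fibre_metric[OF smooth_cov_deriv[OF h] k x]
    by (simp add: fibre_metric_def cov_deriv2_def matrix_mult_linear_simps trace_linear_simps)
  moreover have "- fibre_metric g (bochner_local g h) k x = (\<Sum>a\<in>UNIV. \<Sum>b\<in>UNIV. matrix_inv (g x) $ a $ b * fibre_metric g (cov_deriv2 (christoffel_matrix g) h a b) k x)"
    by (simp add: fibre_metric_def bochner_eq[OF h x] matrix_mult_linear_simps trace_linear_simps)
  ultimately show ?thesis
    by (simp add: div_cov_def distrib_left sum.distrib)
qed

text \<open>The density \<open>\<surd>det g W\<^sup>a\<close> of the vector field dual to \<open>W\<close>; its coordinate divergence is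
  \<open>\<surd>det g div W\<close>, which turns integrals of divergences into integrals of partial derivatives.\<close>

definition vector_density :: "('n \<Rightarrow> real^'n \<Rightarrow> real) \<Rightarrow> 'n \<Rightarrow> real^'n \<Rightarrow> real" where
  "vector_density W a x = sqrt (det (g x)) * (\<Sum>b\<in>UNIV. matrix_inv (g x) $ a $ b * W b x)"

lemma differentiable_sqrt_det: "x \<in> S \<Longrightarrow> (\<lambda>y. sqrt (det (g y))) differentiable at x"
  and pd_sqrt_det: "x \<in> S \<Longrightarrow> pd a (\<lambda>y. sqrt (det (g y))) x = sqrt (det (g x)) * trace (christoffel_matrix g a x)"
proof -
  assume x: "x \<in> S"
  let ?d = "\<lambda>y. det (g y)"
  have dd: "(?d has_derivative frechet_derivative ?d (at x)) (at x)"
    by (rule smooth_on_has_derivative[OF smooth_on_det[OF open_domain smooth_metric] x])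
  have "((\<lambda>y. sqrt (?d y)) has_derivative (\<lambda>v. frechet_derivative ?d (at x) v / (2 * sqrt (?d x)))) (at x)"
    using has_derivative_real_sqrt[OF det_pos[OF x] dd] by (simp add: field_simps)
  then show "(\<lambda>y. sqrt (det (g y))) differentiable at x" by (auto simp: differentiable_def)
  have t: "trace (matrix_inv (g x) ** pd a g x) = 2 * trace (christoffel_matrix g a x)"
  proof -
    have "trace (matrix_inv (g x) ** (transpose (christoffel_matrix g a x) ** g x)) = trace (transpose (christoffel_matrix g a x) ** g x ** matrix_inv (g x))"
      by (rule trace_mul_sym)
    also have "\<dots> = trace (transpose (christoffel_matrix g a x))" by (simp add: matrix_mul_assoc[symmetric] metric_inv x)
    also have "\<dots> = trace (christoffel_matrix g a x)" by (simp add: trace_def transpose_def)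
    finally show ?thesis
      by (simp add: metric_compatible[OF x] matrix_mult.add_right trace_linear_simps)
        (simp add: matrix_mul_assoc metric_inv x)
  qed
  have "pd a (\<lambda>y. sqrt (?d y)) x = pd a ?d x / (2 * sqrt (?d x))"
    using pd_eqI[OF \<open>((\<lambda>y. sqrt (?d y)) has_derivative _) (at x)\<close>, of a] by (simp add: pd_def)
  also have "pd a ?d x = det (g x) * (2 * trace (christoffel_matrix g a x))"
    unfolding pd_det[OF metric_differentiable[OF x] det_nz[OF x]] t ..
  also have "det (g x) * (2 * trace (christoffel_matrix g a x)) / (2 * sqrt (det (g x))) = (det (g x) / sqrt (det (g x))) * trace (christoffel_matrix g a x)"
    by simp
  finally show "pd a (\<lambda>y. sqrt (det (g y))) x = sqrt (det (g x)) * trace (christoffel_matrix g a x)"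
    using det_pos[OF x] by (simp add: real_div_sqrt)
qed

text \<open>The derivative of \<open>\<surd>det g\<close> contributes \<open>\<Gamma>\<^sup>c\<^sub>a\<^sub>c W\<^sup>a\<close> and that of \<open>g\<^sup>-\<^sup>1\<close> contributes \<open>-\<Gamma>\<^sup>a\<^sub>a\<^sub>c W\<^sup>c\<close>; these
  cancel as the connection is torsion-free.\<close>

lemma div_vector_density:
  assumes W: "\<And>b. W b differentiable at x" and x: "x \<in> S"
  shows "(\<Sum>a\<in>UNIV. pd a (vector_density W a) x) = sqrt (det (g x)) * div_cov W x"
proof -
  let ?s = "sqrt (det (g x))" and ?i = "\<lambda>a b. matrix_inv (g x) $ a $ b"
  have id: "(\<lambda>y. matrix_inv (g y)) differentiable at x"
    by (rule smooth_on_differentiable[OF smooth_inv x])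
  have id': "(\<lambda>y. matrix_inv (g y) $ a $ b) differentiable at x" for a b
    using smooth_inv open_domain x by (intro smooth_on_differentiable[of S]) (auto simp: smooth_on_matrix_iff)
  have iWd: "(\<lambda>y. matrix_inv (g y) $ a $ b * W b y) differentiable at x" for a b
    by (intro differentiable_mult id' W)
  have "pd a (vector_density W a) x = ?s * (\<Sum>b\<in>UNIV. ?i a b * pd a (W b) x + pd a (\<lambda>y. matrix_inv (g y) $ a $ b) x * W b x)
      + (?s * trace (christoffel_matrix g a x)) * (\<Sum>b\<in>UNIV. ?i a b * W b x)" for a
    unfolding vector_density_def
    by (subst pd_mult[OF differentiable_sqrt_det[OF x]])
      (auto intro!: differentiable_sum iWd simp: pd_sum[OF iWd] pd_mult[OF id' W] pd_sqrt_det[OF x])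
  then have 1: "(\<Sum>a\<in>UNIV. pd a (vector_density W a) x) = ?s * ((\<Sum>a\<in>UNIV. \<Sum>b\<in>UNIV. ?i a b * pd a (W b) x) +
      ((\<Sum>a\<in>UNIV. \<Sum>b\<in>UNIV. pd a (\<lambda>y. matrix_inv (g y)) x $ a $ b * W b x) +
       (\<Sum>a\<in>UNIV. \<Sum>b\<in>UNIV. trace (christoffel_matrix g a x) * ?i a b * W b x)))"
    by (simp add: sum.distrib sum_distrib_left pd_entry[OF id] algebra_simps)
  have e: "pd a (\<lambda>y. matrix_inv (g y)) x $ a $ b =
      - (\<Sum>c\<in>UNIV. ?i a c * christoffel_matrix g a x $ b $ c) - (\<Sum>c\<in>UNIV. christoffel_matrix g a x $ a $ c * ?i c b)" for a b
    by (simp add: pd_inv[OF x] matrix_matrix_mult_def transpose_def)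
  have "(\<Sum>a\<in>UNIV. \<Sum>b\<in>UNIV. (\<Sum>c\<in>UNIV. christoffel_matrix g a x $ a $ c * ?i c b) * W b x) =
      (\<Sum>a\<in>UNIV. \<Sum>b\<in>UNIV. \<Sum>c\<in>UNIV. christoffel_matrix g c x $ a $ a * ?i c b * W b x)"
    by (simp add: sum_distrib_right torsion_free[OF x, of _ _ ])
  also have "\<dots> = (\<Sum>c\<in>UNIV. \<Sum>b\<in>UNIV. \<Sum>a\<in>UNIV. christoffel_matrix g c x $ a $ a * ?i c b * W b x)"
    by (subst (2) sum.swap, subst sum.swap, rule sum.cong[OF refl], rule sum.swap)
  finally have t: "(\<Sum>a\<in>UNIV. \<Sum>b\<in>UNIV. (\<Sum>c\<in>UNIV. christoffel_matrix g a x $ a $ c * ?i c b) * W b x) =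
      (\<Sum>a\<in>UNIV. \<Sum>b\<in>UNIV. trace (christoffel_matrix g a x) * ?i a b * W b x)"
    by (simp add: trace_def sum_distrib_right)
  have "(\<Sum>a\<in>UNIV. \<Sum>b\<in>UNIV. (\<Sum>c\<in>UNIV. ?i a c * christoffel_matrix g a x $ b $ c) * W b x) =
      (\<Sum>a\<in>UNIV. \<Sum>b\<in>UNIV. ?i a b * (\<Sum>c\<in>UNIV. christoffel_matrix g a x $ c $ b * W c x))"
    by (rule sum.cong[OF refl], simp add: sum_distrib_right sum_distrib_left, subst sum.swap, simp add: mult_ac)
  then show ?thesis
    unfolding 1 e div_cov_def
    by (simp add: left_diff_distrib right_diff_distrib sum_subtractf t sum_negf)
qed

text \<open>Pointwise form of the Bochner formula for \<open>u = |h|\<^sup>2\<close>: since \<open>g\<close> is parallel the left-hand side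
  is \<open>n \<Delta>u\<close>, and \<open>\<Delta>u = 2\<langle>\<Delta>h, h\<rangle> - 2|\<nabla>h|\<^sup>2\<close>.  The formula is stated for the tensor field \<open>ug\<close> in
  order to avoid a separate Laplacian on functions.\<close>

lemma bochner_norm_le:
  assumes h: "smooth_on S h" "\<And>y. y \<in> S \<Longrightarrow> transpose (h y) = h y" and x: "x \<in> S"
  shows "fibre_metric g (bochner_local g (\<lambda>y. fibre_metric g h h y *\<^sub>R g y)) g x \<le> 2 * real CARD('n) * fibre_metric g (bochner_local g h) h x"
proof -
  let ?u = "fibre_metric g h h" and ?n = "real CARD('n)"
  let ?C = "cov_deriv (christoffel_matrix g)"
  have u: "smooth_on S ?u" by (rule smooth_fibre_metric[OF h(1) h(1)])
  have ug: "smooth_on S (\<lambda>y. ?u y *\<^sub>R g y)" by (intro smooth_on_scaleR open_domain u smooth_metric)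
  have Cug: "?C (\<lambda>y. ?u y *\<^sub>R g y) b y = pd b ?u y *\<^sub>R g y" if "y \<in> S" for b y
    using cov_deriv_scaleR[OF smooth_on_differentiable[OF u that] metric_differentiable[OF that]] cov_deriv_metric[OF that] by simp
  have gg: "fibre_metric g g g y = ?n" if "y \<in> S" for y
    by (simp add: fibre_metric_def matrix_mul_assoc[symmetric] metric_inv that) (simp add: matrix_mul_assoc metric_inv that trace_I)
  have W1: "fibre_metric g (?C (\<lambda>y. ?u y *\<^sub>R g y) b) g y = (2 * ?n) * fibre_metric g (?C h b) h y" if "y \<in> S" for b y
  proof -
    have "fibre_metric g (?C (\<lambda>y. ?u y *\<^sub>R g y) b) g y = pd b ?u y * ?n"
      using Cug[OF that] gg[OF that] by (simp add: fibre_metric_def matrix_mult_linear_simps trace_linear_simps)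
    also have "pd b ?u y = 2 * fibre_metric g (?C h b) h y"
      using pd_fibre_metric[OF h(1) h(1) that, of b] fibre_metric_commute[OF that, of h "?C h b"] by simp
    finally show ?thesis by simp
  qed
  have d: "fibre_metric g (?C h b) h differentiable at x" for b
    by (rule smooth_on_differentiable[OF smooth_fibre_metric[OF smooth_cov_deriv[OF h(1)] h(1)] x])
  have "pd a (fibre_metric g (?C (\<lambda>y. ?u y *\<^sub>R g y) b) g) x = (2 * ?n) * pd a (fibre_metric g (?C h b) h) x" for a b
  proof -
    have "pd a (fibre_metric g (?C (\<lambda>y. ?u y *\<^sub>R g y) b) g) x = pd a (\<lambda>y. (2 * ?n) *\<^sub>R fibre_metric g (?C h b) h y) x"
      by (rule pd_cong[OF open_domain x]) (simp add: W1)
    also have "\<dots> = (2 * ?n) *\<^sub>R pd a (fibre_metric g (?C h b) h) x" by (rule pd_cmult[OF d])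
    finally show ?thesis by simp
  qed
  then have "div_cov (\<lambda>b. fibre_metric g (?C (\<lambda>y. ?u y *\<^sub>R g y) b) g) x = (2 * ?n) * div_cov (\<lambda>b. fibre_metric g (?C h b) h) x"
    by (simp add: div_cov_def W1[OF x] sum_distrib_left algebra_simps)
  moreover have "div_cov (\<lambda>b. fibre_metric g (?C (\<lambda>y. ?u y *\<^sub>R g y) b) g) x = - fibre_metric g (bochner_local g (\<lambda>y. ?u y *\<^sub>R g y)) g x"
    unfolding div_fibre_metric[OF ug smooth_metric x] by (simp add: fibre_metric_def[of _ _ "?C g _"] cov_deriv_metric[OF x] trace_linear_simps)
  moreover have "div_cov (\<lambda>b. fibre_metric g (?C h b) h) x \<ge> - fibre_metric g (bochner_local g h) h x"
  proof -
    have "0 \<le> (\<Sum>a\<in>UNIV. \<Sum>b\<in>UNIV. matrix_inv (g x) $ a $ b * fibre_metric g (?C h a) (?C h b) x)"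
      unfolding fibre_metric_def
      by (rule posdef_sum_trace_nonneg[OF posdef_metric[OF x]])
        (rule cov_deriv_sym[OF open_domain x smooth_on_differentiable[OF h(1) x] h(2)])
    also have "\<dots> = (\<Sum>a\<in>UNIV. \<Sum>b\<in>UNIV. matrix_inv (g x) $ a $ b * fibre_metric g (?C h b) (?C h a) x)"
      by (intro sum.cong refl) (simp add: fibre_metric_commute[OF x])
    finally show ?thesis unfolding div_fibre_metric[OF h(1) h(1) x] by simp
  qed
  then have "(2 * ?n) * (- fibre_metric g (bochner_local g h) h x) \<le> (2 * ?n) * div_cov (\<lambda>b. fibre_metric g (?C h b) h) x"
    by (rule mult_left_mono) simp
  ultimately show ?thesis by simp
qed

end

section \<open>Smooth dependence of the Bochner Laplacian on parameters\<close>

lemma pd_snd: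
  fixes F :: "real \<times> (real^'n) \<Rightarrow> 'b::real_normed_vector"
  assumes "F differentiable at (s, x)"
  shows "pd a (\<lambda>y. F (s, y)) x = frechet_derivative F (at (s, x)) (0, axis a 1)"
proof (rule pd_eqI[where D="\<lambda>v. frechet_derivative F (at (s, x)) (0, v)"])
  have "((\<lambda>y. (s, y)) has_derivative (\<lambda>v. (0, v))) (at x)"
    by (auto intro!: derivative_eq_intros)
  from diff_chain_at[OF this assms[unfolded frechet_derivative_works]]
  show "((\<lambda>y. F (s, y)) has_derivative (\<lambda>v. frechet_derivative F (at (s, x)) (0, v))) (at x)"
    by (simp add: o_def)
qed

lemma smooth_on_pd_param:
  fixes F :: "real \<Rightarrow> real^'n \<Rightarrow> 'b::real_normed_vector"
  assumes W: "open W" and F: "smooth_on W (\<lambda>z. F (fst z) (snd z))"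
  shows "smooth_on W (\<lambda>z. pd a (F (fst z)) (snd z))"
proof (rule smooth_on_cong[OF W _ smooth_on_derivative[OF F, of "(0, axis a 1)"]])
  fix z assume "z \<in> W"
  then show "frechet_derivative (\<lambda>z. F (fst z) (snd z)) (at z) (0, axis a 1) = pd a (F (fst z)) (snd z)"
    using pd_snd[of "\<lambda>z. F (fst z) (snd z)" "fst z" "snd z" a] smooth_on_differentiable[OF F, of z] by simp
qed

text \<open>The components of \<open>\<Delta>\<^sup>g h\<close> are rational expressions in those of \<open>g\<close> and \<open>h\<close> and their derivatives.
  Joint smoothness in a parameter is needed for the derivative of the operator with respect to the
  metric.\<close>

lemma smooth_on_bochner_param:
  fixes G H :: "real \<Rightarrow> real^'n \<Rightarrow> real^'n^'n"
  assumes W: "open W" and G: "smooth_on W (\<lambda>z. G (fst z) (snd z))" and H: "smooth_on W (\<lambda>z. H (fst z) (snd z))"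
    and det: "\<And>z. z \<in> W \<Longrightarrow> det (G (fst z) (snd z)) \<noteq> 0"
  shows "smooth_on W (\<lambda>z. bochner_local (G (fst z)) (H (fst z)) (snd z))"
proof -
  note I = smooth_on_sum[OF W] smooth_on_mult[OF W] smooth_on_diff[OF W] smooth_on_add[OF W]
    smooth_on_minus[OF W] smooth_on_const
  note P = smooth_on_pd_param[OF W]
  have Ge: "smooth_on W (\<lambda>z. G (fst z) (snd z) $ i $ j)" for i j
    using G by (simp add: smooth_on_matrix_iff[OF W])
  have He: "smooth_on W (\<lambda>z. H (fst z) (snd z) $ i $ j)" for i j
    using H by (simp add: smooth_on_matrix_iff[OF W])
  have Ie: "smooth_on W (\<lambda>z. matrix_inv (G (fst z) (snd z)) $ i $ j)" for i j
    using smooth_on_matrix_inv[OF W G det] by (simp add: smooth_on_matrix_iff[OF W])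
  have C: "smooth_on W (\<lambda>z. christoffel_symbol (G (fst z)) l i j (snd z))" for l i j
    unfolding christoffel_symbol_def
    by (intro I Ie P[of "\<lambda>s y. G s y $ _ $ _"] Ge)
  have c1: "smooth_on W (\<lambda>z. cov1 (G (fst z)) (H (fst z)) a i j (snd z))" for a i j
    unfolding cov1_def by (intro I C He P[of "\<lambda>s y. H s y $ _ $ _"])
  have c2: "smooth_on W (\<lambda>z. cov2 (G (fst z)) (H (fst z)) a b i j (snd z))" for a b i j
    unfolding cov2_def by (intro I C c1 P[of "\<lambda>s. cov1 (G s) (H s) _ _ _"])
  show ?thesis
    unfolding smooth_on_matrix_iff[OF W] bochner_local_def vec_lambda_beta
    by (intro allI I Ie c2)
qed

lemma (in local_metric) smooth_bochner:
  assumes h: "smooth_on S h"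
  shows "smooth_on S (bochner_local g h)"
proof -
  have W: "open (UNIV \<times> S :: (real \<times> (real^'n)) set)" by (intro open_Times open_UNIV open_domain)
  have snd: "smooth_on (UNIV \<times> S) (\<lambda>z :: real \<times> (real^'n). f (snd z))" if "smooth_on S f" for f :: "real^'n \<Rightarrow> real^'n^'n"
    by (rule smooth_on_compose[OF W open_domain smooth_on_linear[OF W bounded_linear_snd] that]) auto
  have b: "smooth_on (UNIV \<times> S) (\<lambda>z :: real \<times> (real^'n). bochner_local g h (snd z))"
    by (rule smooth_on_bochner_param[OF W snd[OF smooth_metric] snd[OF h]]) (auto simp: det_nz)
  have p: "smooth_on S (\<lambda>x. (0 :: real, x))"
    by (rule smooth_on_Pair[OF open_domain smooth_on_const smooth_on_ident[OF open_domain]])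
  have "smooth_on S (\<lambda>x. bochner_local g h (snd (0 :: real, x)))"
    by (rule smooth_on_compose[OF open_domain W p b]) simp
  then show ?thesis by simp
qed

section \<open>Change of variables\<close>

text \<open>The change of variables theorem \<open>has_absolute_integral_change_of_variables\<close> needs a well-order on
  the index type.  An order on a copy of the type can be chosen arbitrarily without ordering the
  type itself.\<close>

typedef 'n ordered_copy = "UNIV :: 'n::finite set" morphisms orig copy
  by simp

lemma bij_orig: "bij orig" and bij_copy: "bij copy"
  by (auto intro!: bij_betw_byWitness[where f'=copy] bij_betw_byWitness[where f'=orig]
      simp: orig_inverse copy_inverse)

instantiation ordered_copy :: (finite) "{finite, wellorder}"
begin

definition rank_ordered_copy :: "'a ordered_copy \<Rightarrow> nat" where
  "rank_ordered_copy x = (SOME f :: 'a \<Rightarrow> nat. inj f) (orig x)"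

definition "x \<le> y \<longleftrightarrow> rank_ordered_copy x \<le> rank_ordered_copy y"
definition "(x :: 'a ordered_copy) < y \<longleftrightarrow> rank_ordered_copy x < rank_ordered_copy y"

instance
proof
  have "\<exists>f :: 'a \<Rightarrow> nat. inj f" using finite_imp_inj_to_nat_seg[OF finite[of "UNIV :: 'a set"]] by blast
  then have "inj (SOME f :: 'a \<Rightarrow> nat. inj f)" by (rule someI_ex)
  then have inj: "rank_ordered_copy x = rank_ordered_copy y \<Longrightarrow> x = y" for x y :: "'a ordered_copy"
    unfolding rank_ordered_copy_def using orig_inject by (auto dest: injD)
  show "finite (UNIV :: 'a ordered_copy set)"
    using bij_betw_finite[OF bij_orig[where 'a='a]] by simp
  fix x y z :: "'a ordered_copy"
  show "x < y \<longleftrightarrow> x \<le> y \<and> \<not> y \<le> x" "x \<le> x" "x \<le> y \<Longrightarrow> y \<le> z \<Longrightarrow> x \<le> z" "x \<le> y \<or> y \<le> x"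
    by (auto simp: less_eq_ordered_copy_def less_ordered_copy_def)
  show "x \<le> y \<Longrightarrow> y \<le> x \<Longrightarrow> x = y"
    by (auto simp: less_eq_ordered_copy_def intro: inj)
next
  fix P and a :: "'a ordered_copy"
  assume IH: "\<And>x :: 'a ordered_copy. (\<And>y. y < x \<Longrightarrow> P y) \<Longrightarrow> P x"
  show "P a"
    by (induction a rule: measure_induct_rule[where f=rank_ordered_copy])
      (rule IH, simp add: less_ordered_copy_def)
qed

end

definition to_copy :: "'a^'n \<Rightarrow> 'a^'n::finite ordered_copy" where
  "to_copy v = (\<chi> i. v $ orig i)"

definition from_copy :: "'a^'n::finite ordered_copy \<Rightarrow> 'a^'n" where
  "from_copy v = (\<chi> i. v $ copy i)"

lemma from_to_copy [simp]: "from_copy (to_copy v) = v" "to_copy (from_copy w) = w"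
  by (simp_all add: to_copy_def from_copy_def vec_eq_iff copy_inverse orig_inverse)

lemma bounded_linear_copy:
  "bounded_linear (to_copy :: real^'n \<Rightarrow> real^'n ordered_copy)"
  "bounded_linear (from_copy :: real^'n ordered_copy \<Rightarrow> real^'n)"
  unfolding linear_conv_bounded_linear[symmetric] linear_iff
  by (simp_all add: to_copy_def from_copy_def vec_eq_iff)

lemma det_copy:
  fixes A :: "real^'n^'n"
  shows "det (\<chi> i j. A $ orig i $ orig j) = det A"
proof -
  let ?U = "UNIV :: 'n ordered_copy set" and ?V = "UNIV :: 'n set"
  have bij: "bij_betw orig ?U ?V" by (rule bij_orig)
  have mp: "map_permutation ?U orig p = (\<lambda>x. if x \<in> ?V then orig (p (inv_into ?U orig x)) else x)" for p
    by (auto simp: map_permutation_def restrict_id_def fun_eq_iff bij_is_surj[OF bij_orig])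
  have bp: "bij_betw (map_permutation ?U orig) {p. p permutes ?U} {p. p permutes ?V}"
    unfolding mp[abs_def] by (rule bij_betw_permutations[OF bij])
  have "det A = (\<Sum>p\<in>{p. p permutes ?U}. of_int (sign (map_permutation ?U orig p)) *
      (\<Prod>i\<in>?V. A $ i $ map_permutation ?U orig p i))"
    unfolding det_def by (rule sum.reindex_bij_betw[OF bp, symmetric])
  also have "\<dots> = (\<Sum>p\<in>{p. p permutes ?U}. of_int (sign p) * (\<Prod>i\<in>?U. A $ orig i $ orig (p i)))"
  proof (rule sum.cong[OF refl])
    fix p assume p: "p \<in> {p. p permutes ?U}"
    have inj: "inj_on orig ?U" using bij_is_inj[OF bij_orig] .
    have "(\<Prod>i\<in>?V. A $ i $ map_permutation ?U orig p i) = (\<Prod>i\<in>?U. A $ orig i $ map_permutation ?U orig p (orig i))"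
      by (rule prod.reindex_bij_betw[OF bij, symmetric])
    then show "of_int (sign (map_permutation ?U orig p)) * (\<Prod>i\<in>?V. A $ i $ map_permutation ?U orig p i) =
        of_int (sign p) * (\<Prod>i\<in>?U. A $ orig i $ orig (p i))"
      using p by (simp add: map_permutation_apply[OF inj] sign_map_permutation[OF inj])
  qed
  also have "\<dots> = det (\<chi> i j. A $ orig i $ orig j)" by (simp add: det_def)
  finally show ?thesis by simp
qed

lemma lborel_copy: "distr lborel borel (from_copy :: real^'n ordered_copy \<Rightarrow> real^'n) = lborel"
proof (rule sym, rule lborel_eqI)
  have meas: "(from_copy :: real^'n ordered_copy \<Rightarrow> real^'n) \<in> borel_measurable borel"
    by (intro borel_measurable_continuous_onI linear_continuous_on bounded_linear_copy)
  fix l u :: "real^'n" assume lu: "\<And>b. b \<in> Basis \<Longrightarrow> l \<bullet> b \<le> u \<bullet> b"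
  then have lu': "l $ i \<le> u $ i" for i using lu[of "axis i 1"] by (simp add: inner_axis)
  have prod: "(\<Prod>b\<in>Basis. v \<bullet> b) = (\<Prod>i\<in>UNIV. v $ i)" for v :: "real^'k"
  proof -
    have "bij_betw (\<lambda>i. axis i 1 :: real^'k) UNIV Basis"
      by (auto simp: bij_betw_def inj_on_def axis_eq_axis Basis_vec_def)
    from prod.reindex_bij_betw[OF this, of "\<lambda>b. v \<bullet> b"] show ?thesis by (simp add: inner_axis)
  qed
  have "from_copy -` box l u \<inter> space borel = box (to_copy l) (to_copy u)"
    by (auto simp: mem_box_cart from_copy_def to_copy_def) (metis copy_inverse orig_inverse UNIV_I)+
  then have "emeasure (distr lborel borel from_copy) (box l u) = emeasure lborel (box (to_copy l) (to_copy u))"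
    using meas by (subst emeasure_distr) auto
  also have "\<dots> = (\<Prod>b\<in>Basis. (to_copy u - to_copy l) \<bullet> b)"
    by (rule emeasure_lborel_box) (auto simp: Basis_vec_def inner_axis to_copy_def lu')
  also have "\<dots> = (\<Prod>i\<in>UNIV. (u - l) $ orig i)" by (simp add: prod to_copy_def)
  also have "\<dots> = (\<Prod>b\<in>Basis. (u - l) \<bullet> b)"
    unfolding prod using prod.reindex_bij_betw[OF bij_orig, of "\<lambda>i. (u - l) $ i"] by simp
  finally show "emeasure (distr lborel borel from_copy) (box l u) = (\<Prod>b\<in>Basis. (u - l) \<bullet> b)" .
qed simp

text \<open>Links the two notions of integral on non-negative functions, so that a theorem on absolute
  integrability transfers to measures.\<close>

lemma nn_integral_eq_iff_integral:
  fixes f :: "'a::euclidean_space \<Rightarrow> real"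
  assumes f: "\<And>x. x \<in> X \<Longrightarrow> f x \<ge> 0" and meas: "(\<lambda>x. indicator X x * f x) \<in> borel_measurable borel" and r: "r \<ge> 0"
  shows "(\<integral>\<^sup>+x\<in>X. ennreal (f x) \<partial>lborel) = ennreal r \<longleftrightarrow> f absolutely_integrable_on X \<and> integral X f = r"
proof
  have eq: "(\<integral>\<^sup>+x\<in>X. ennreal (f x) \<partial>lborel) = (\<integral>\<^sup>+x. ennreal (indicator X x * f x) \<partial>lborel)"
    by (intro nn_integral_cong) (auto simp: indicator_def)
  assume "(\<integral>\<^sup>+x\<in>X. ennreal (f x) \<partial>lborel) = ennreal r"
  then have "((\<lambda>x. indicator X x * f x) has_integral r) UNIV"
    unfolding eq by (intro nn_integral_has_integral meas r) (auto simp: indicator_def f)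
  moreover have "(\<lambda>x. indicator X x * f x) = (\<lambda>x. if x \<in> X then f x else 0)" by (auto simp: indicator_def)
  ultimately have "(f has_integral r) X" using has_integral_restrict_UNIV[of X f r] by simp
  then show "f absolutely_integrable_on X \<and> integral X f = r"
    using absolutely_integrable_on_iff_nonneg[of X f] f by (auto simp: has_integral_iff)
next
  assume *: "f absolutely_integrable_on X \<and> integral X f = r"
  then have "(f has_integral r) X"
    by (simp add: has_integral_iff absolutely_integrable_on_def)
  then show "(\<integral>\<^sup>+x\<in>X. ennreal (f x) \<partial>lborel) = ennreal r"
    using nn_integral_has_integral_lebesgue'[of X f r] f by simp
qed

lemma nn_integral_change_of_variables_ordered:
  fixes \<phi> :: "real^'n::{finite,wellorder} \<Rightarrow> real^'n::_"
  assumes B: "B \<in> sets borel" and der: "\<And>x. x \<in> B \<Longrightarrow> (\<phi> has_derivative \<phi>' x) (at x)" and inj: "inj_on \<phi> B"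
    and f: "\<And>y. y \<in> \<phi> ` B \<Longrightarrow> f y \<ge> 0"
    and m1: "(\<lambda>y. indicator (\<phi> ` B) y * f y) \<in> borel_measurable borel"
    and m2: "(\<lambda>x. indicator B x * (\<bar>det (matrix (\<phi>' x))\<bar> * f (\<phi> x))) \<in> borel_measurable borel"
  shows "(\<integral>\<^sup>+y\<in>\<phi> ` B. ennreal (f y) \<partial>lborel) = (\<integral>\<^sup>+x\<in>B. ennreal (\<bar>det (matrix (\<phi>' x))\<bar> * f (\<phi> x)) \<partial>lborel)"
    (is "?L = ?R")
proof -
  have "B \<in> sets lebesgue" using B by simp
  from has_absolute_integral_change_of_variables[OF this _ inj, of \<phi>' "\<lambda>x. vec (f x) :: real^1" "vec b" for b]
  have cov: "((\<lambda>x. \<bar>det (matrix (\<phi>' x))\<bar> * f (\<phi> x)) absolutely_integrable_on B \<and>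
      integral B (\<lambda>x. \<bar>det (matrix (\<phi>' x))\<bar> * f (\<phi> x)) = b) \<longleftrightarrow>
      (f absolutely_integrable_on \<phi> ` B \<and> integral (\<phi> ` B) f = b)" for b
    using der unfolding absolutely_integrable_on_1_iff integral_on_1_eq
    by (simp add: has_derivative_at_withinI)
  \<comment> \<open>Both sides take the same finite values, hence also the value infinity simultaneously.\<close>
  have iff: "?L = ennreal r \<longleftrightarrow> ?R = ennreal r" if "r \<ge> 0" for r
    using nn_integral_eq_iff_integral[OF f m1 that] nn_integral_eq_iff_integral[OF _ m2 that] f cov by auto
  show ?thesis
  proof (cases ?L rule: ennreal_cases)
    case (real r)
    then show ?thesis using iff by auto
  next
    case top
    then show ?thesis using iff by (cases ?R rule: ennreal_cases) auto
  qed
qed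

lemma nn_integral_change_of_variables:
  fixes \<phi> :: "real^'n \<Rightarrow> real^'n"
  assumes B: "B \<in> sets borel" and der: "\<And>x. x \<in> B \<Longrightarrow> (\<phi> has_derivative \<phi>' x) (at x)" and inj: "inj_on \<phi> B"
    and f: "\<And>y. y \<in> \<phi> ` B \<Longrightarrow> f y \<ge> 0"
    and m1: "(\<lambda>y. indicator (\<phi> ` B) y * f y) \<in> borel_measurable borel"
    and m2: "(\<lambda>x. indicator B x * (\<bar>det (matrix (\<phi>' x))\<bar> * f (\<phi> x))) \<in> borel_measurable borel"
  shows "(\<integral>\<^sup>+y\<in>\<phi> ` B. ennreal (f y) \<partial>lborel) = (\<integral>\<^sup>+x\<in>B. ennreal (\<bar>det (matrix (\<phi>' x))\<bar> * f (\<phi> x)) \<partial>lborel)"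
proof -
  let ?T = "from_copy :: real^'n ordered_copy \<Rightarrow> real^'n" and ?C = "to_copy :: real^'n \<Rightarrow> real^'n ordered_copy"
  have T: "?T \<in> borel_measurable borel"
    by (intro borel_measurable_continuous_onI linear_continuous_on bounded_linear_copy)
  have transfer: "(\<integral>\<^sup>+x\<in>X. ennreal (h x) \<partial>lborel) = (\<integral>\<^sup>+x\<in>?T -` X. ennreal (h (?T x)) \<partial>lborel)"
    if "(\<lambda>x. indicator X x * h x) \<in> borel_measurable borel" for X and h :: "real^'n \<Rightarrow> real"
  proof -
    have "(\<integral>\<^sup>+x\<in>X. ennreal (h x) \<partial>lborel) = (\<integral>\<^sup>+x. ennreal (indicator X x * h x) \<partial>distr lborel borel ?T)"
      unfolding lborel_copy by (intro nn_integral_cong) (auto simp: indicator_def)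
    also have "\<dots> = (\<integral>\<^sup>+x. ennreal (indicator X (?T x) * h (?T x)) \<partial>lborel)"
      using that T by (subst nn_integral_distr) auto
    also have "\<dots> = (\<integral>\<^sup>+x\<in>?T -` X. ennreal (h (?T x)) \<partial>lborel)"
      by (intro nn_integral_cong) (auto simp: indicator_def)
    finally show ?thesis .
  qed
  let ?p = "\<lambda>x. ?C (\<phi> (?T x))" and ?p' = "\<lambda>x v. ?C (\<phi>' (?T x) (?T v))"
  have img: "?p ` (?T -` B) = ?T -` (\<phi> ` B)"
  proof (intro equalityI subsetI)
    fix x assume "x \<in> ?T -` (\<phi> ` B)"
    then obtain b where b: "?T x = \<phi> b" "b \<in> B" by auto
    have "x = ?C (?T x)" by simp
    also have "\<dots> = ?p (?C b)" using b(1) by simp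
    finally show "x \<in> ?p ` (?T -` B)" by (rule image_eqI) (simp add: b)
  qed auto
  have det: "det (matrix (?p' x)) = det (matrix (\<phi>' (?T x)))" for x
  proof -
    have Te: "?T (axis j 1) = axis (orig j) 1" for j
      by (auto simp: from_copy_def axis_def vec_eq_iff) (metis copy_inverse orig_inverse UNIV_I)+
    have "matrix (?p' x) = (\<chi> i j. matrix (\<phi>' (?T x)) $ orig i $ orig j)"
      by (simp add: matrix_def to_copy_def vec_eq_iff[of "vec_lambda _"] Te)
    then show ?thesis by (simp add: det_copy)
  qed
  have "(\<integral>\<^sup>+y\<in>?p ` (?T -` B). ennreal (f (?T y)) \<partial>lborel) =
      (\<integral>\<^sup>+x\<in>?T -` B. ennreal (\<bar>det (matrix (?p' x))\<bar> * f (?T (?p x))) \<partial>lborel)"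
  proof (rule nn_integral_change_of_variables_ordered)
    show "?T -` B \<in> sets borel" using measurable_sets[OF T B] by simp
    show "(?p has_derivative ?p' x) (at x)" if "x \<in> ?T -` B" for x
    proof -
      have "(\<phi> has_derivative \<phi>' (?T x)) (at (?T x))" using der that by simp
      from diff_chain_at[OF bounded_linear_imp_has_derivative[OF bounded_linear_copy(2)] this]
      have "((\<lambda>x. \<phi> (?T x)) has_derivative (\<lambda>v. \<phi>' (?T x) (?T v))) (at x)" by (simp add: o_def)
      then show ?thesis by (rule bounded_linear.has_derivative[OF bounded_linear_copy(1)])
    qed
    show "inj_on ?p (?T -` B)"
    proof (rule inj_onI)
      fix x y assume "x \<in> ?T -` B" "y \<in> ?T -` B" "?p x = ?p y"
      then have "\<phi> (?T x) = \<phi> (?T y)" by (metis from_to_copy(1))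
      then have "?T x = ?T y" using inj \<open>x \<in> _\<close> \<open>y \<in> _\<close> by (auto dest: inj_onD)
      then show "x = y" by (metis from_to_copy(2))
    qed
    show "f (?T y) \<ge> 0" if "y \<in> ?p ` (?T -` B)" for y using that f by (auto simp: img)
    have "(\<lambda>y. indicator (\<phi> ` B) (?T y) * f (?T y)) \<in> borel_measurable borel"
      using measurable_compose[OF T m1] .
    moreover have "indicator (\<phi> ` B) (?T y) = (indicator (?p ` (?T -` B)) y :: real)" for y
      unfolding img by (simp add: indicator_def)
    ultimately show "(\<lambda>y. indicator (?p ` (?T -` B)) y * f (?T y)) \<in> borel_measurable borel" by simp
    have "(\<lambda>y. indicator B (?T y) * (\<bar>det (matrix (\<phi>' (?T y)))\<bar> * f (\<phi> (?T y)))) \<in> borel_measurable borel"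
      using measurable_compose[OF T m2] .
    moreover have "indicator B (?T y) = (indicator (?T -` B) y :: real)" for y
      by (simp add: indicator_def)
    ultimately show "(\<lambda>x. indicator (?T -` B) x * (\<bar>det (matrix (?p' x))\<bar> * f (?T (?p x)))) \<in> borel_measurable borel"
      by (simp add: det)
  qed
  then show ?thesis
    unfolding transfer[OF m1] transfer[OF m2] by (simp add: img det)
qed

section \<open>The integral of a derivative with compact support\<close>

text \<open>By translation invariance the difference quotients of \<open>V\<close> have integral zero, and they
  converge to the derivative, uniformly bounded and with support in a fixed ball.\<close>

lemma compact_support_pd:
  fixes V :: "real^'n \<Rightarrow> real"
  assumes V: "smooth_on UNIV V" and K: "compact K" "\<And>x. x \<notin> K \<Longrightarrow> V x = 0"
  shows integrable_pd: "integrable lborel (pd a V)" and integral_pd_eq_0: "(\<integral>x. pd a V x \<partial>lborel) = 0"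
proof -
  let ?e = "axis a 1 :: real^'n"
  obtain R where R: "R > 0" "K \<subseteq> ball 0 R" using compact_imp_bounded[OF K(1)] bounded_subset_ballD by blast
  have V0: "V x = 0" if "norm x \<ge> R" for x using that R K(2) by (metis mem_ball_0 not_le subsetD)
  have Vc: "continuous_on UNIV V" and Dc: "continuous_on UNIV (pd a V)"
    using V smooth_on_pd[OF V] smooth_on_continuous by auto
  obtain C where "\<forall>x\<in>cball 0 R. \<bar>pd a V x\<bar> \<le> C"
    using compact_imp_bounded[OF compact_continuous_image[OF continuous_on_subset[OF Dc] compact_cball[of 0 R]]]
    by (auto simp: bounded_iff)
  then have C: "\<bar>pd a V x\<bar> \<le> C" if "x \<in> cball 0 R" for x using that by blast
  have D0: "pd a V x = 0" if "norm x > R" for x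
    using pd_cong[of "- cball 0 R" x V "\<lambda>_. 0" a] that V0 by auto
  have C0: "C \<ge> 0" using C[of 0] R(1) by force
  then have C': "\<bar>pd a V x\<bar> \<le> C" for x using C[of x] D0[of x] by (cases "norm x \<le> R") auto
  have int: "integrable lborel (\<lambda>x. indicator (cball 0 r) x * f x)" if "continuous_on UNIV f" for f :: "real^'n \<Rightarrow> real" and r
    using borel_integrable_compact[OF compact_cball[of 0 r] continuous_on_subset[OF that]]
    by (simp add: indicator_def if_distrib mult.commute cong: if_cong)
  have "pd a V = (\<lambda>x. indicator (cball 0 R) x * pd a V x)" using D0 by (auto simp: indicator_def fun_eq_iff)
  then show "integrable lborel (pd a V)" using int[OF Dc, of R] by simp
  have "V = (\<lambda>x. indicator (cball 0 R) x * V x)" using V0 by (auto simp: indicator_def fun_eq_iff)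
  then have intV: "integrable lborel V" using int[OF Vc, of R] by simp
  let ?F = "\<lambda>n x. (V (x + inverse (real (Suc n)) *\<^sub>R ?e) - V x) * real (Suc n)"
  have shift: "integrable lborel (\<lambda>x. V (x + c))" "(\<integral>x. V (x + c) \<partial>lborel) = (\<integral>x. V x \<partial>lborel)" for c
  proof -
    have m: "(+) c \<in> lborel \<rightarrow>\<^sub>M borel" by simp
    have "integrable (distr lborel borel ((+) c)) V" using intV by (simp add: lborel_distr_plus)
    then show "integrable lborel (\<lambda>x. V (x + c))"
      using integrable_distr[OF m, of V] by (simp add: add.commute)
    have "(\<integral>x. V x \<partial>distr lborel borel ((+) c)) = (\<integral>x. V (c + x) \<partial>lborel)"
      using Vc by (intro integral_distr m borel_measurable_continuous_onI)
    then show "(\<integral>x. V (x + c) \<partial>lborel) = (\<integral>x. V x \<partial>lborel)"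
      by (simp add: lborel_distr_plus add.commute)
  qed
  have F0: "(\<integral>x. ?F n x \<partial>lborel) = 0" for n
    by (simp add: shift intV del: of_nat_Suc)
  have "(\<lambda>n. \<integral>x. ?F n x \<partial>lborel) \<longlonglongrightarrow> (\<integral>x. pd a V x \<partial>lborel)"
  proof (rule integral_dominated_convergence[where w="\<lambda>x. indicator (cball 0 (R + 1)) x * C"])
    show "pd a V \<in> borel_measurable lborel" using borel_measurable_continuous_onI[OF Dc] by simp
    show "?F n \<in> borel_measurable lborel" for n
      using Vc by (intro borel_measurable_times borel_measurable_diff borel_measurable_const)
        (auto intro!: borel_measurable_continuous_onI continuous_on_compose2[OF Vc] continuous_intros)
    show "integrable lborel (\<lambda>x :: real^'n. indicator (cball 0 (R + 1)) x * C)"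
      using int[OF continuous_on_const[of UNIV C], of "R + 1"] by simp
    show "AE x in lborel. (\<lambda>n. ?F n x) \<longlonglongrightarrow> pd a V x"
    proof (rule AE_I2)
      fix x
      have "((\<lambda>s. V (x + s *\<^sub>R ?e)) has_real_derivative pd a V x) (at 0)"
        using has_real_derivative_along_line[of V _ x 0 ?e] smooth_on_has_derivative[OF V, of x] by (simp add: pd_def)
      then have "((\<lambda>h. (V (x + h *\<^sub>R ?e) - V x) / h) \<longlongrightarrow> pd a V x) (at 0)"
        by (simp add: DERIV_def)
      moreover have "filterlim (\<lambda>n. inverse (real (Suc n))) (at 0) sequentially"
        unfolding filterlim_at using LIMSEQ_inverse_real_of_nat by (auto simp del: of_nat_Suc)
      ultimately have "(\<lambda>n. (V (x + inverse (real (Suc n)) *\<^sub>R ?e) - V x) / inverse (real (Suc n))) \<longlonglongrightarrow> pd a V x"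
        by (rule filterlim_compose)
      then show "(\<lambda>n. ?F n x) \<longlonglongrightarrow> pd a V x" by (simp add: divide_inverse del: of_nat_Suc)
    qed
    show "AE x in lborel. norm (?F n x) \<le> indicator (cball 0 (R + 1)) x * C" for n
    proof (rule AE_I2)
      fix x
      let ?h = "inverse (real (Suc n))"
      have h: "0 < ?h" "?h \<le> 1" by (auto simp: field_simps)
      show "norm (?F n x) \<le> indicator (cball 0 (R + 1)) x * C"
      proof (cases "norm x \<le> R + 1")
        case True
        have "((\<lambda>s. V (x + s *\<^sub>R ?e)) has_real_derivative pd a V (x + s *\<^sub>R ?e)) (at s)" for s
          unfolding pd_def by (rule has_real_derivative_along_line) (rule smooth_on_has_derivative[OF V UNIV_I])
        from MVT2[OF h(1) this] obtain z where "V (x + ?h *\<^sub>R ?e) - V (x + 0 *\<^sub>R ?e) = (?h - 0) * pd a V (x + z *\<^sub>R ?e)"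
          by blast
        then have "?F n x = pd a V (x + z *\<^sub>R ?e)" by (simp add: field_simps)
        then show ?thesis using True C' by (simp add: indicator_def)
      next
        case False
        have "norm (?h *\<^sub>R ?e) \<le> 1" using h by (simp add: norm_axis_1)
        then have "norm (x + ?h *\<^sub>R ?e) \<ge> R" using False norm_diff_ineq[of x "?h *\<^sub>R ?e"] by linarith
        then show ?thesis using V0 False by (simp add: C0)
      qed
    qed
  qed
  then show "(\<integral>x. pd a V x \<partial>lborel) = 0" unfolding F0 using LIMSEQ_unique[OF tendsto_const] by metis
qed

section \<open>Charts and tensor fields on a compact manifold\<close>

definition Jac :: "('m, 'n::finite) chart \<Rightarrow> ('m, 'n) chart \<Rightarrow> real^'n \<Rightarrow> real^'n^'n" where
  "Jac c d x = matrix (frechet_derivative (transition c d) (at x))"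

definition overlap :: "('m, 'n::finite) chart \<Rightarrow> ('m, 'n) chart \<Rightarrow> (real^'n) set" where
  "overlap c d = cmap c ` (cdom c \<inter> cdom d)"

lemma posdef_congruence:
  fixes B J :: "real^'n^'n"
  assumes "posdef B" "det J \<noteq> 0"
  shows "posdef (transpose J ** B ** J)"
  unfolding posdef_def
proof (intro conjI allI impI)
  show "transpose (transpose J ** B ** J) = transpose J ** B ** J"
    using assms(1) by (simp add: posdef_def matrix_transpose_mul matrix_mul_assoc)
  fix v :: "real^'n" assume "v \<noteq> 0"
  have "matrix_inv J *v (J *v v) = v" by (simp add: matrix_vector_mul_assoc matrix_inv_det[OF assms(2)])
  then have "J *v v \<noteq> 0" using \<open>v \<noteq> 0\<close> by (metis matrix_vector_mult_0_right)
  then have "0 < (J *v v) \<bullet> (B *v (J *v v))" using assms(1) by (simp add: posdef_def)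
  also have "\<dots> = v \<bullet> (transpose J *v (B *v (J *v v)))"
    by (metis dot_lmul_matrix inner_commute transpose_matrix_vector transpose_transpose)
  finally show "0 < v \<bullet> (transpose J ** B ** J *v v)" by (simp add: matrix_vector_mul_assoc matrix_mul_assoc)
qed

locale compact_manifold =
  fixes M :: "'m::t2_space set" and A :: "('m, 'n::finite) chart set"
  assumes manifold: "smooth_manifold M A" and compact: "compact M"
begin

lemma cover: "(\<Union>c\<in>A. cdom c) = M"
  using manifold by (simp add: smooth_manifold_def)

lemma chart:
  assumes "c \<in> A"
  shows cdom_sub: "cdom c \<subseteq> M" and cdom_open: "openin (top_of_set M) (cdom c)"
    and cimg_open: "open (cimg c)" and cmap_homeo: "homeomorphism (cdom c) (cimg c) (cmap c) (cinv c)"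
  using manifold assms by (auto simp: smooth_manifold_def)

lemma cinv_cmap [simp]: "c \<in> A \<Longrightarrow> q \<in> cdom c \<Longrightarrow> cinv c (cmap c q) = q"
  and cmap_cinv [simp]: "c \<in> A \<Longrightarrow> x \<in> cimg c \<Longrightarrow> cmap c (cinv c x) = x"
  and cinv_cdom [simp]: "c \<in> A \<Longrightarrow> x \<in> cimg c \<Longrightarrow> cinv c x \<in> cdom c"
  and cmap_cimg [simp]: "c \<in> A \<Longrightarrow> q \<in> cdom c \<Longrightarrow> cmap c q \<in> cimg c"
  using cmap_homeo[of c] by (auto simp: homeomorphism_def)

lemma chart_at: "q \<in> M \<Longrightarrow> \<exists>c\<in>A. q \<in> cdom c"
  using cover by auto

lemma cinv_cont: "c \<in> A \<Longrightarrow> continuous_on (cimg c) (cinv c)"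
  and cmap_cont: "c \<in> A \<Longrightarrow> continuous_on (cdom c) (cmap c)"
  using cmap_homeo[of c] by (auto simp: homeomorphism_def)

lemma cinv_M: "c \<in> A \<Longrightarrow> x \<in> cimg c \<Longrightarrow> cinv c x \<in> M"
  using cdom_sub[of c] cinv_cdom[of c x] by blast

lemma overlap_iff: "c \<in> A \<Longrightarrow> x \<in> overlap c d \<longleftrightarrow> x \<in> cimg c \<and> cinv c x \<in> cdom d"
  unfolding overlap_def by (auto simp: image_iff intro!: bexI[of _ "cinv c x"])

lemma overlap_self: "c \<in> A \<Longrightarrow> overlap c c = cimg c"
  by (auto simp: overlap_iff)

lemma open_preimage:
  assumes c: "c \<in> A" and U: "openin (top_of_set M) U"
  shows "open {x \<in> cimg c. cinv c x \<in> U}"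
proof -
  obtain W where W: "open W" "U = M \<inter> W" using U by (auto simp: openin_open)
  have "openin (top_of_set (cimg c)) (cimg c \<inter> cinv c -` W)"
    by (rule continuous_openin_preimage_gen[OF cinv_cont[OF c] W(1)])
  then have "open (cimg c \<inter> cinv c -` W)" using cimg_open[OF c] openin_open_eq by blast
  moreover have "{x \<in> cimg c. cinv c x \<in> U} = cimg c \<inter> cinv c -` W" using W(2) cinv_M[OF c] by auto
  ultimately show ?thesis by simp
qed

lemma open_overlap: "c \<in> A \<Longrightarrow> d \<in> A \<Longrightarrow> open (overlap c d)"
proof -
  assume "c \<in> A" "d \<in> A"
  moreover have "overlap c d = {x \<in> cimg c. cinv c x \<in> cdom d}" using \<open>c \<in> A\<close> by (auto simp: overlap_iff)
  ultimately show ?thesis using open_preimage cdom_open by simp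
qed

lemma transition_smooth: "c \<in> A \<Longrightarrow> d \<in> A \<Longrightarrow> smooth_on (overlap c d) (transition c d)"
  using manifold by (auto simp: smooth_manifold_def overlap_def)

lemma transition_eq: "transition c d x = cmap d (cinv c x)"
  by (simp add: transition_def)

lemma transition_overlap: "c \<in> A \<Longrightarrow> d \<in> A \<Longrightarrow> x \<in> overlap c d \<Longrightarrow> transition c d x \<in> overlap d c"
  by (simp add: overlap_iff transition_eq)

lemma cinv_transition: "c \<in> A \<Longrightarrow> d \<in> A \<Longrightarrow> x \<in> overlap c d \<Longrightarrow> cinv d (transition c d x) = cinv c x"
  by (simp add: overlap_iff transition_eq)

lemma Jac_chain:
  assumes "c \<in> A" "d \<in> A" "e \<in> A" "x \<in> overlap c d" "x \<in> overlap c e"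
  shows "Jac c e x = Jac d e (transition c d x) ** Jac c d x"
proof -
  have y: "transition c d x \<in> overlap d e" using assms by (simp add: overlap_iff transition_eq)
  have "((transition d e \<circ> transition c d) has_derivative
      (frechet_derivative (transition d e) (at (transition c d x)) \<circ> frechet_derivative (transition c d) (at x))) (at x)"
    by (intro diff_chain_at smooth_on_has_derivative[OF transition_smooth] assms y)
  moreover have "open (overlap c d \<inter> overlap c e)" "x \<in> overlap c d \<inter> overlap c e"
    using assms open_overlap[of c d] open_overlap[of c e] by auto
  moreover have "(transition d e \<circ> transition c d) z = transition c e z" if "z \<in> overlap c d \<inter> overlap c e" for z
    using that assms(1-3) by (simp add: overlap_iff transition_eq)
  ultimately have "(transition c e has_derivative
      (frechet_derivative (transition d e) (at (transition c d x)) \<circ> frechet_derivative (transition c d) (at x))) (at x)"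
    by (rule has_derivative_transform_within_open)
  then have "frechet_derivative (transition c e) (at x) =
      frechet_derivative (transition d e) (at (transition c d x)) \<circ> frechet_derivative (transition c d) (at x)"
    by (rule frechet_derivative_at[symmetric])
  then show ?thesis
    unfolding Jac_def
    using linear_frechet_derivative[OF smooth_on_differentiable[OF transition_smooth[OF assms(1,2)] assms(4)]]
      linear_frechet_derivative[OF smooth_on_differentiable[OF transition_smooth[OF assms(2,3)] y]]
    by (simp add: matrix_compose)
qed

lemma Jac_self: "c \<in> A \<Longrightarrow> x \<in> cimg c \<Longrightarrow> Jac c c x = mat 1"
proof -
  assume c: "c \<in> A" "x \<in> cimg c"
  have "frechet_derivative (transition c c) (at x) = frechet_derivative (\<lambda>y. y) (at x)"
    by (rule frechet_derivative_cong_open[OF cimg_open[OF c(1)] c(2)]) (simp add: transition_eq c)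
  then show ?thesis by (simp add: Jac_def matrix_id_mat_1[unfolded id_def])
qed

lemma Jac_det: "c \<in> A \<Longrightarrow> d \<in> A \<Longrightarrow> x \<in> overlap c d \<Longrightarrow> det (Jac c d x) \<noteq> 0"
proof -
  assume a: "c \<in> A" "d \<in> A" "x \<in> overlap c d"
  then have "x \<in> cimg c" by (simp add: overlap_iff)
  then have "Jac d c (transition c d x) ** Jac c d x = mat 1"
    using Jac_chain[of c d c x] Jac_self[of c x] a by (simp add: overlap_self)
  then have "det (Jac d c (transition c d x)) * det (Jac c d x) = 1" by (metis det_I det_mul)
  then show ?thesis by auto
qed

lemma Jac_smooth: "c \<in> A \<Longrightarrow> d \<in> A \<Longrightarrow> smooth_on (overlap c d) (Jac c d)"
proof -
  assume a: "c \<in> A" "d \<in> A"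
  have "smooth_on (overlap c d) (\<lambda>x. frechet_derivative (transition c d) (at x) v $ i)" for v i
    using smooth_on_derivative[OF transition_smooth[OF a]] by (simp add: smooth_on_vec_iff[OF open_overlap[OF a]])
  then show ?thesis
    unfolding smooth_on_matrix_iff[OF open_overlap[OF a]] Jac_def matrix_def by simp
qed

abbreviation "\<T> \<equiv> sym_tensors A"
abbreviation "\<M> \<equiv> riem_metrics A"

lemma tensorI:
  assumes "\<And>c. c \<in> A \<Longrightarrow> smooth_on (cimg c) (h c)" "\<And>c x. c \<in> A \<Longrightarrow> x \<in> cimg c \<Longrightarrow> transpose (h c x) = h c x"
    "\<And>c d x. c \<in> A \<Longrightarrow> d \<in> A \<Longrightarrow> x \<in> overlap c d \<Longrightarrow>
      h c x = transpose (Jac c d x) ** h d (transition c d x) ** Jac c d x"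
    "\<And>c x. \<not> (c \<in> A \<and> x \<in> cimg c) \<Longrightarrow> h c x = 0"
  shows "h \<in> \<T>"
  using assms unfolding sym_tensors_def overlap_def[symmetric] Jac_def[symmetric] Let_def
  by (simp del: split_paired_All)

lemma tensor:
  assumes "h \<in> \<T>"
  shows tensor_smooth: "\<And>c. c \<in> A \<Longrightarrow> smooth_on (cimg c) (h c)"
    and tensor_sym: "\<And>c x. c \<in> A \<Longrightarrow> x \<in> cimg c \<Longrightarrow> transpose (h c x) = h c x"
    and tensor_transform: "\<And>c d x. c \<in> A \<Longrightarrow> d \<in> A \<Longrightarrow> x \<in> overlap c d \<Longrightarrow>
      h c x = transpose (Jac c d x) ** h d (transition c d x) ** Jac c d x"
    and tensor_zero: "\<And>c x. \<not> (c \<in> A \<and> x \<in> cimg c) \<Longrightarrow> h c x = 0"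
  using assms unfolding sym_tensors_def overlap_def[symmetric] Jac_def[symmetric] Let_def
  by (simp_all del: split_paired_All)

lemma tensor_eqI:
  assumes "h \<in> \<T>" "k \<in> \<T>" "\<And>c x. c \<in> A \<Longrightarrow> x \<in> cimg c \<Longrightarrow> h c x = k c x"
  shows "h = k"
proof (intro ext)
  fix c x show "h c x = k c x" using assms tensor_zero[OF assms(1)] tensor_zero[OF assms(2)] by (cases "c \<in> A \<and> x \<in> cimg c") auto
qed

lemma metric_tensor: "g \<in> \<M> \<Longrightarrow> g \<in> \<T>"
  by (simp add: riem_metrics_def)

lemma metric_posdef: "g \<in> \<M> \<Longrightarrow> c \<in> A \<Longrightarrow> x \<in> cimg c \<Longrightarrow> posdef (g c x)"
  using tensor_sym[OF metric_tensor] by (simp add: riem_metrics_def posdef_def)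

lemma metricI: "g \<in> \<T> \<Longrightarrow> (\<And>c x. c \<in> A \<Longrightarrow> x \<in> cimg c \<Longrightarrow> posdef (g c x)) \<Longrightarrow> g \<in> \<M>"
  by (simp add: riem_metrics_def posdef_def)

lemma zero_tensor: "(\<lambda>c x. 0) \<in> \<T>"
  by (rule tensorI) (auto simp: smooth_on_const transpose_def vec_eq_iff)

lemma tadd_tensor:
  assumes h: "h \<in> \<T>" and k: "k \<in> \<T>"
  shows "tadd h k \<in> \<T>"
proof (rule tensorI)
  show "tadd h k c x = transpose (Jac c d x) ** tadd h k d (transition c d x) ** Jac c d x"
    if "c \<in> A" "d \<in> A" "x \<in> overlap c d" for c d x
    unfolding tadd_def tensor_transform[OF h that] tensor_transform[OF k that]
    by (simp add: matrix_mult.add_left matrix_mult.add_right)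
qed (use tensor_smooth[OF h] tensor_smooth[OF k] tensor_sym[OF h] tensor_sym[OF k] tensor_zero[OF h] tensor_zero[OF k] in
    \<open>auto simp: tadd_def transpose_linear_simps intro!: smooth_on_add cimg_open\<close>)

definition smooth_fun :: "('m \<Rightarrow> real) \<Rightarrow> bool" where
  "smooth_fun u \<longleftrightarrow> (\<forall>c\<in>A. smooth_on (cimg c) (\<lambda>x. u (cinv c x)))"

definition function_times :: "('m \<Rightarrow> real) \<Rightarrow> ('m, 'n) tensor \<Rightarrow> ('m, 'n) tensor" where
  "function_times u h = (\<lambda>c x. u (cinv c x) *\<^sub>R h c x)"

lemma function_times_tensor:
  assumes u: "smooth_fun u" and h: "h \<in> \<T>"
  shows "function_times u h \<in> \<T>"
proof (rule tensorI)
  show "function_times u h c x = transpose (Jac c d x) ** function_times u h d (transition c d x) ** Jac c d x"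
    if "c \<in> A" "d \<in> A" "x \<in> overlap c d" for c d x
    unfolding function_times_def tensor_transform[OF h that] cinv_transition[OF that]
    by (simp add: matrix_mult.scaleR_left matrix_mult.scaleR_right)
qed (use u tensor_smooth[OF h] tensor_sym[OF h] tensor_zero[OF h] in
    \<open>auto simp: function_times_def smooth_fun_def transpose_linear_simps intro!: smooth_on_scaleR cimg_open\<close>)

lemma smooth_fun_const: "smooth_fun (\<lambda>q. r)"
  by (simp add: smooth_fun_def smooth_on_const)

lemma tscale_tensor: "h \<in> \<T> \<Longrightarrow> tscale r h \<in> \<T>"
  using function_times_tensor[OF smooth_fun_const] by (simp add: function_times_def tscale_def)

lemma smooth_fun_sum: "(\<And>i. i \<in> I \<Longrightarrow> smooth_fun (u i)) \<Longrightarrow> smooth_fun (\<lambda>q. \<Sum>i\<in>I. u i q)"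
  by (auto simp: smooth_fun_def intro!: smooth_on_sum cimg_open)

lemma smooth_fun_divide: "smooth_fun u \<Longrightarrow> smooth_fun v \<Longrightarrow> (\<And>q. q \<in> M \<Longrightarrow> v q \<noteq> 0) \<Longrightarrow> smooth_fun (\<lambda>q. u q / v q)"
  using cinv_M by (auto simp: smooth_fun_def intro!: smooth_on_divide cimg_open)

lemma smooth_fun_continuous:
  assumes u: "smooth_fun u"
  shows "continuous_on M u"
proof -
  have "continuous_on (cdom c) u" if c: "c \<in> A" for c
  proof -
    have "continuous_on (cdom c) (\<lambda>q. u (cinv c (cmap c q)))"
      using u c by (intro continuous_on_compose2[OF smooth_on_continuous[of "cimg c" "\<lambda>x. u (cinv c x)"] cmap_cont[OF c]])
        (auto simp: smooth_fun_def)
    then show ?thesis by (simp add: c cong: continuous_on_cong)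
  qed
  then have 1: "openin (top_of_set (cdom c)) (cdom c \<inter> u -` B)" if "open B" "c \<in> A" for B c
    using that by (simp add: continuous_openin_preimage_gen)
  have "openin (top_of_set M) (\<Union>c\<in>A. cdom c \<inter> u -` B)" if B: "open B" for B
  proof (rule openin_Union)
    fix U assume "U \<in> (\<lambda>c. cdom c \<inter> u -` B) ` A"
    then obtain c where c: "c \<in> A" "U = cdom c \<inter> u -` B" by blast
    show "openin (top_of_set M) U" unfolding c(2) by (rule openin_trans[OF 1[OF B c(1)] cdom_open[OF c(1)]])
  qed
  moreover have "M \<inter> u -` B = (\<Union>c\<in>A. cdom c \<inter> u -` B)" for B
    unfolding cover[symmetric] by blast
  ultimately show ?thesis by (simp add: continuous_openin_preimage_eq)
qed

section \<open>Bump functions and existence of metrics\<close>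

lemma closed_coordinate_ball:
  assumes c: "c \<in> A" and K: "compact K" "K \<subseteq> cimg c"
  shows "openin (top_of_set M) (M - cinv c ` K)"
proof -
  have "compact (cinv c ` K)"
    by (rule compact_continuous_image[OF continuous_on_subset[OF cinv_cont[OF c] K(2)] K(1)])
  then have "closed (cinv c ` K)" by (rule compact_imp_closed)
  then have "openin (top_of_set M) (M \<inter> (- cinv c ` K))" by (intro openin_open_Int) auto
  then show ?thesis by (simp add: Diff_eq)
qed

text \<open>A function that is smooth in the overlap with a chart \<open>c\<close> and vanishes off a compact subset of
  it is smooth.\<close>

lemma smooth_on_extend:
  assumes c: "c \<in> A" and d: "d \<in> A" and K: "compact K" "K \<subseteq> cimg c"
    and f: "smooth_on (overlap d c) f" and zero: "\<And>x. x \<in> cimg d \<Longrightarrow> cinv d x \<notin> cinv c ` K \<Longrightarrow> f x = 0"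
  shows "smooth_on (cimg d) f"
proof (rule smooth_on_open_cover)
  fix x assume x: "x \<in> cimg d"
  let ?U = "{x \<in> cimg d. cinv d x \<in> M - cinv c ` K}"
  show "\<exists>T. open T \<and> x \<in> T \<and> smooth_on T f"
  proof (cases "cinv d x \<in> cinv c ` K")
    case True
    then have "x \<in> overlap d c" using x K(2) c d by (auto simp: overlap_iff)
    then show ?thesis using open_overlap[OF d c] f by blast
  next
    case False
    have U: "open ?U" by (rule open_preimage[OF d closed_coordinate_ball[OF c K]])
    have "smooth_on ?U f"
      by (rule smooth_on_cong[OF U _ smooth_on_const[of _ 0]]) (simp add: zero)
    then show ?thesis using U False x cinv_M[OF d x] by blast
  qed
qed

definition chart_bump :: "('m, 'n) chart \<times> (real^'n) \<times> real \<Rightarrow> 'm \<Rightarrow> real" where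
  "chart_bump = (\<lambda>(c, a, r) q. if q \<in> cdom c then bump a r (cmap c q) else 0)"

text \<open>The closed ball is required to lie in the image of the chart, because functions supported there
  extend by zero to smooth functions on \<open>M\<close>.\<close>

definition good_ball :: "('m, 'n) chart \<times> (real^'n) \<times> real \<Rightarrow> bool" where
  "good_ball = (\<lambda>(c, a, r). c \<in> A \<and> r > 0 \<and> cball a r \<subseteq> cimg c)"

lemma bump_zero: "r > 0 \<Longrightarrow> x \<notin> cball a r \<Longrightarrow> bump a r x = 0"
  using bump_pos_iff[of r a x] bump_nonneg[of a r x] ball_subset_cball[of a r] by force

lemma chart_bump_smooth: "good_ball b \<Longrightarrow> smooth_fun (chart_bump b)"
proof -
  assume b: "good_ball b"
  obtain c a r where e: "b = (c, a, r)" by (cases b)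
  have c: "c \<in> A" and r: "r > 0" "cball a r \<subseteq> cimg c" using b by (auto simp: e good_ball_def)
  show ?thesis unfolding smooth_fun_def
  proof
    fix d assume d: "d \<in> A"
    show "smooth_on (cimg d) (\<lambda>x. chart_bump b (cinv d x))"
    proof (rule smooth_on_extend[OF c d compact_cball r(2)])
      have "smooth_on (overlap d c) (\<lambda>x. bump a r (transition d c x))"
        by (rule smooth_on_compose[OF open_overlap[OF d c] open_UNIV transition_smooth[OF d c] smooth_on_bump]) simp
      then show "smooth_on (overlap d c) (\<lambda>x. chart_bump b (cinv d x))"
        by (rule smooth_on_cong[OF open_overlap[OF d c], rotated])
          (use d in \<open>auto simp: e chart_bump_def overlap_iff transition_eq\<close>)
      fix x assume x: "x \<in> cimg d" "cinv d x \<notin> cinv c ` cball a r"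
      show "chart_bump b (cinv d x) = 0"
      proof (cases "cinv d x \<in> cdom c")
        case True
        have "cinv d x = cinv c (cmap c (cinv d x))" using True c by simp
        then have "cmap c (cinv d x) \<notin> cball a r" using x(2) by blast
        then show ?thesis by (simp add: e chart_bump_def bump_zero[OF r(1)])
      qed (simp add: e chart_bump_def)
    qed
  qed
qed

lemma finite_ball_cover:
  obtains F where "finite F" "\<And>b. b \<in> F \<Longrightarrow> good_ball b" "M = (\<Union>(c, a, r)\<in>F. cinv c ` ball a r)"
proof -
  let ?O = "\<lambda>(c, a, r). cinv c ` ball a r :: 'm set"
  have op: "openin (top_of_set M) (?O b)" if b: "good_ball b" for b
  proof -
    obtain c a r where e: "b = (c, a, r)" by (cases b)
    have c: "c \<in> A" and r: "ball a r \<subseteq> cimg c"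
      using b ball_subset_cball[of a r] by (auto simp: e good_ball_def)
    have "openin (top_of_set (cimg c)) (ball a r)" using r by (simp add: open_openin_trans open_subset)
    then have "openin (top_of_set (cdom c)) (cinv c ` ball a r)"
      by (rule homeomorphism_imp_open_map[OF homeomorphism_symD[OF cmap_homeo[OF c]]])
    then show ?thesis using openin_trans cdom_open[OF c] by (auto simp: e)
  qed
  have ex: "\<exists>b. good_ball b \<and> q \<in> ?O b" if qM: "q \<in> M" for q
  proof -
    obtain c where c: "c \<in> A" "q \<in> cdom c" using chart_at[OF qM] by blast
    then obtain r where r: "r > 0" "cball (cmap c q) r \<subseteq> cimg c"
      using cimg_open[OF c(1)] cmap_cimg[OF c] unfolding open_contains_cball by blast
    have "q = cinv c (cmap c q)" using c by simp
    then have "q \<in> ?O (c, cmap c q, r)" using r by (auto intro!: image_eqI)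
    then show ?thesis using c r by (intro exI[of _ "(c, cmap c q, r)"]) (simp add: good_ball_def)
  qed
  have "compactin (top_of_set M) M" using compact by (simp add: compactin_subtopology)
  then have *: "\<And>\<U>. (\<forall>U\<in>\<U>. openin (top_of_set M) U) \<Longrightarrow> M \<subseteq> \<Union>\<U> \<Longrightarrow> \<exists>\<F>. finite \<F> \<and> \<F> \<subseteq> \<U> \<and> M \<subseteq> \<Union>\<F>"
    unfolding compactin_def by blast
  have "\<exists>\<F>. finite \<F> \<and> \<F> \<subseteq> ?O ` Collect good_ball \<and> M \<subseteq> \<Union>\<F>"
    by (rule *) (use op ex in blast)+
  then obtain \<F> where fF: "finite \<F>" "\<F> \<subseteq> ?O ` Collect good_ball" "M \<subseteq> \<Union>\<F>"
    by (elim exE conjE)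
  obtain F where F: "F \<subseteq> Collect good_ball" "finite F" "\<F> = ?O ` F"
    using finite_subset_image[OF fF(1,2)] by (elim exE conjE)
  have "M = (\<Union>(c, a, r)\<in>F. cinv c ` ball a r)"
  proof
    show "M \<subseteq> (\<Union>(c, a, r)\<in>F. cinv c ` ball a r)" using fF(3) F(3) by simp
    have "?O b \<subseteq> M" if "b \<in> F" for b
      using openin_imp_subset[OF op] F(1) that by blast
    then show "(\<Union>(c, a, r)\<in>F. cinv c ` ball a r) \<subseteq> M" by (rule UN_least)
  qed
  moreover have "good_ball b" if "b \<in> F" for b using F(1) that by blast
  ultimately show ?thesis using that[of F] F(2) by simp
qed

lemma chart_bump_nonneg: "chart_bump b q \<ge> 0"
  by (cases b) (simp add: chart_bump_def bump_nonneg)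

lemma chart_bump_pos: "good_ball (c, a, r) \<Longrightarrow> q \<in> cinv c ` ball a r \<Longrightarrow> chart_bump (c, a, r) q > 0"
proof -
  assume b: "good_ball (c, a, r)" and "q \<in> cinv c ` ball a r"
  then obtain x where x: "x \<in> ball a r" "q = cinv c x" by blast
  then have "x \<in> cimg c" using b ball_subset_cball[of a r] by (auto simp: good_ball_def)
  then show ?thesis using b x by (simp add: good_ball_def chart_bump_def bump_pos_iff)
qed

text \<open>The Euclidean metric of the chart \<open>c\<close>, cut off by a bump function.\<close>

definition local_euclidean :: "('m, 'n) chart \<times> (real^'n) \<times> real \<Rightarrow> ('m, 'n) tensor" where
  "local_euclidean = (\<lambda>(c, a, r) d x. if d \<in> A \<and> x \<in> overlap d c
    then chart_bump (c, a, r) (cinv d x) *\<^sub>R (transpose (Jac d c x) ** Jac d c x) else 0)"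

lemma local_euclidean_tensor: "good_ball b \<Longrightarrow> local_euclidean b \<in> \<T>"
proof -
  assume b: "good_ball b"
  obtain c a r where e: "b = (c, a, r)" by (cases b)
  have c: "c \<in> A" and r: "r > 0" "cball a r \<subseteq> cimg c" using b by (auto simp: e good_ball_def)
  show ?thesis
  proof (rule tensorI)
    fix d assume d: "d \<in> A"
    show "smooth_on (cimg d) (local_euclidean b d)"
    proof (rule smooth_on_extend[OF c d compact_cball r(2)])
      note o = open_overlap[OF d c]
      have "overlap d c \<subseteq> cimg d" using d by (auto simp: overlap_iff)
      then have "smooth_on (overlap d c) (\<lambda>x. chart_bump b (cinv d x))"
        using chart_bump_smooth[OF b] d smooth_on_subset unfolding smooth_fun_def by blast
      then have "smooth_on (overlap d c) (\<lambda>x. chart_bump b (cinv d x) *\<^sub>R (transpose (Jac d c x) ** Jac d c x))"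
        by (intro smooth_on_scaleR smooth_on_matrix_mult smooth_on_transpose Jac_smooth o c d)
      then show "smooth_on (overlap d c) (local_euclidean b d)"
        by (rule smooth_on_cong[OF o, rotated]) (use d in \<open>simp add: local_euclidean_def e\<close>)
      fix x assume x: "x \<in> cimg d" "cinv d x \<notin> cinv c ` cball a r"
      have "chart_bump b (cinv d x) = 0" if "x \<in> overlap d c"
      proof -
        have "cinv d x \<in> cdom c" using that d by (simp add: overlap_iff)
        then have "cinv d x = cinv c (cmap c (cinv d x))" using c by simp
        then have "cmap c (cinv d x) \<notin> cball a r" using x(2) by blast
        then show ?thesis by (simp add: e chart_bump_def bump_zero[OF r(1)])
      qed
      then show "local_euclidean b d x = 0" by (simp add: local_euclidean_def e)
    qed
  next
    fix d x show "transpose (local_euclidean b d x) = local_euclidean b d x"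
      by (simp add: local_euclidean_def e transpose_linear_simps matrix_transpose_mul)
        (simp add: transpose_def vec_eq_iff)
  next
    fix d d' x assume d: "d \<in> A" "d' \<in> A" "x \<in> overlap d d'"
    then have iff: "transition d d' x \<in> overlap d' c \<longleftrightarrow> x \<in> overlap d c"
      by (simp add: overlap_iff transition_eq)
    show "local_euclidean b d x = transpose (Jac d d' x) ** local_euclidean b d' (transition d d' x) ** Jac d d' x"
    proof (cases "x \<in> overlap d c")
      case True
      show ?thesis
        using d True iff
        by (simp add: local_euclidean_def e cinv_transition Jac_chain[OF d(1,2) c d(3) True]
            matrix_transpose_mul matrix_mult.scaleR_left matrix_mult.scaleR_right matrix_mul_assoc)
    qed (simp add: local_euclidean_def e iff)
  next
    fix d x show "\<not> (d \<in> A \<and> x \<in> cimg d) \<Longrightarrow> local_euclidean b d x = 0"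
      by (auto simp: local_euclidean_def e overlap_iff)
  qed
qed

lemma tsum_tensor:
  assumes "\<And>i. i \<in> I \<Longrightarrow> h i \<in> \<T>"
  shows "(\<lambda>c x. \<Sum>i\<in>I. h i c x) \<in> \<T>"
  using assms
proof (induction I rule: infinite_finite_induct)
  case (insert i I)
  then show ?case using tadd_tensor[of "h i" "\<lambda>c x. \<Sum>i\<in>I. h i c x"] by (simp add: tadd_def)
qed (auto simp: zero_tensor)

text \<open>The cut-off Euclidean metrics are positive semidefinite, and each point has one that is definite
  there.\<close>

lemma metric_exists: "\<M> \<noteq> {}"
proof -
  obtain F where F: "finite F" "\<And>b. b \<in> F \<Longrightarrow> good_ball b" "M = (\<Union>(c, a, r)\<in>F. cinv c ` ball a r)"
    using finite_ball_cover by metis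
  let ?g = "\<lambda>d x. \<Sum>b\<in>F. local_euclidean b d x"
  have g: "?g \<in> \<T>" by (rule tsum_tensor) (rule local_euclidean_tensor[OF F(2)])
  have "?g \<in> \<M>"
  proof (rule metricI[OF g])
    fix d x assume d: "d \<in> A" "x \<in> cimg d"
    show "posdef (?g d x)"
      unfolding posdef_def
    proof (intro conjI allI impI)
      show "transpose (?g d x) = ?g d x" by (rule tensor_sym[OF g d])
      fix v :: "real^'n" assume v: "v \<noteq> 0"
      have nonneg: "v \<bullet> (local_euclidean b d x *v v) \<ge> 0" for b
      proof -
        obtain c a r where e: "b = (c, a, r)" by (cases b)
        have "v \<bullet> ((transpose (Jac d c x) ** Jac d c x) *v v) = (Jac d c x *v v) \<bullet> (Jac d c x *v v)"
          by (metis dot_lmul_matrix matrix_vector_mul_assoc transpose_matrix_vector transpose_transpose inner_commute)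
        then show ?thesis
          by (simp add: local_euclidean_def e scaleR_matrix_vector_assoc[symmetric] chart_bump_nonneg)
      qed
      have "cinv d x \<in> M" using cinv_M d by blast
      then obtain c a r where b: "(c, a, r) \<in> F" "cinv d x \<in> cinv c ` ball a r" using F(3) by auto
      then have gb: "good_ball (c, a, r)" using F(2) by blast
      then have c: "c \<in> A" and "ball a r \<subseteq> cimg c" using ball_subset_cball[of a r] by (auto simp: good_ball_def)
      then have o: "x \<in> overlap d c" using b d by (auto simp: overlap_iff)
      have "posdef (mat 1 :: real^'n^'n)" by (simp add: posdef_def transpose_mat)
      then have "posdef (transpose (Jac d c x) ** mat 1 ** Jac d c x)"
        by (rule posdef_congruence) (rule Jac_det[OF d(1) c o])
      then have "v \<bullet> (local_euclidean (c, a, r) d x *v v) > 0"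
        using v o d chart_bump_pos[OF gb b(2)]
        by (simp add: local_euclidean_def posdef_def scaleR_matrix_vector_assoc[symmetric])
      then have "0 < (\<Sum>b\<in>F. v \<bullet> (local_euclidean b d x *v v))"
        by (intro sum_pos2[OF F(1) b(1)]) (auto simp: nonneg)
      also have "\<dots> = v \<bullet> (?g d x *v v)"
      proof -
        have "(\<Sum>b\<in>F. local_euclidean b d x) *v v = (\<Sum>b\<in>F. local_euclidean b d x *v v)"
          by (induction F rule: infinite_finite_induct) (auto simp: matrix_vector_mult_add_rdistrib)
        then show ?thesis by (simp add: inner_sum_right)
      qed
      finally show "0 < v \<bullet> (?g d x *v v)" .
    qed
  qed
  then show ?thesis by blast
qed

end

section \<open>The Bochner Laplacian on tensor fields\<close>

lemma bochner_local_cong: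
  assumes S: "open S" "x \<in> S" and hk: "\<And>y. y \<in> S \<Longrightarrow> h y = k y"
  shows "bochner_local g h x = bochner_local g k x"
proof -
  have c1: "cov1 g h b i j y = cov1 g k b i j y" if "y \<in> S" for b i j y
    using pd_cong[OF S(1) that, of "\<lambda>y. h y $ i $ j" "\<lambda>y. k y $ i $ j" b] hk that by (simp add: cov1_def)
  have "cov2 g h a b i j x = cov2 g k a b i j x" for a b i j
    using pd_cong[OF S, of "cov1 g h b i j" "cov1 g k b i j" a] c1 S(2) by (simp add: cov2_def)
  then show ?thesis by (simp add: bochner_local_def)
qed

lemma (in local_metric) subset: "open U \<Longrightarrow> U \<subseteq> S \<Longrightarrow> local_metric U g"
  using smooth_metric posdef_metric smooth_on_subset by unfold_locales blast+

lemma (in local_metric) bochner_zero: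
  assumes "\<And>y. y \<in> S \<Longrightarrow> h y = 0" "x \<in> S"
  shows "bochner_local g h x = 0"
  using bochner_local_cong[OF open_domain assms(2), of h "\<lambda>y. 0 *\<^sub>R g y" g] bochner_metric[OF assms(2), of 0] assms(1) by simp

context coordinate_change begin

lemma fibre_metric_pull:
  assumes "x \<in> S" "h x = transpose (J x) ** h' (\<phi> x) ** J x" "k x = transpose (J x) ** k' (\<phi> x) ** J x"
  shows "fibre_metric g h k x = fibre_metric g' h' k' (\<phi> x)"
proof -
  let ?J = "J x" and ?i = "matrix_inv (g x)"
  have "fibre_metric g h k x = trace ((?i ** transpose ?J ** h' (\<phi> x) ** (?J ** ?i ** transpose ?J) ** k' (\<phi> x)) ** ?J)"
    unfolding fibre_metric_def assms(2,3) by (simp add: matrix_mul_assoc)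
  also have "\<dots> = trace (?J ** (?i ** transpose ?J ** h' (\<phi> x) ** (?J ** ?i ** transpose ?J) ** k' (\<phi> x)))"
    by (rule trace_mul_sym)
  also have "\<dots> = trace ((?J ** ?i ** transpose ?J) ** h' (\<phi> x) ** (?J ** ?i ** transpose ?J) ** k' (\<phi> x))"
    by (simp add: matrix_mul_assoc)
  finally show ?thesis unfolding metric_inv_pull[OF assms(1)] by (simp add: fibre_metric_def)
qed

lemma sqrt_det_pull: "x \<in> S \<Longrightarrow> \<bar>det (J x)\<bar> * sqrt (det (g' (\<phi> x))) = sqrt (det (g x))"
  by (simp add: metric_pull det_mul real_sqrt_mult mult.commute[of "det (J x)"])

end

context compact_manifold begin

lemma local_metric_chart: "g \<in> \<M> \<Longrightarrow> c \<in> A \<Longrightarrow> local_metric (cimg c) (g c)"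
  using metric_posdef[of g c] tensor_smooth[OF metric_tensor, of g c] cimg_open[of c] by unfold_locales auto

lemma overlap_sub: "c \<in> A \<Longrightarrow> overlap c d \<subseteq> cimg c"
  by (auto simp: overlap_iff)

text \<open>All invariance statements for tensor fields are obtained from the coordinate computations through
  this interpretation.\<close>

lemma coordinate_change_charts:
  assumes g: "g \<in> \<M>" and c: "c \<in> A" and d: "d \<in> A"
  shows "coordinate_change (overlap c d) (g c) (overlap d c) (g d) (transition c d) (Jac c d)"
proof -
  interpret src: local_metric "overlap c d" "g c"
    by (rule local_metric.subset[OF local_metric_chart[OF g c] open_overlap[OF c d] overlap_sub[OF c]])
  interpret tgt: local_metric "overlap d c" "g d"
    by (rule local_metric.subset[OF local_metric_chart[OF g d] open_overlap[OF d c] overlap_sub[OF d]])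
  show ?thesis
    by unfold_locales
      (use transition_smooth[OF c d] transition_overlap[OF c d] Jac_det[OF c d] tensor_transform[OF metric_tensor[OF g] c d] in
        \<open>auto simp: Jac_def\<close>)
qed

lemma bochner_tensor:
  assumes g: "g \<in> \<M>" and h: "h \<in> \<T>"
  shows "bochner_laplacian A g h \<in> \<T>"
proof (rule tensorI)
  fix c assume c: "c \<in> A"
  interpret local_metric "cimg c" "g c" by (rule local_metric_chart[OF g c])
  show "smooth_on (cimg c) (bochner_laplacian A g h c)"
    by (rule smooth_on_cong[OF cimg_open[OF c] _ smooth_bochner[OF tensor_smooth[OF h c]]])
      (simp add: bochner_laplacian_def c)
  show "transpose (bochner_laplacian A g h c x) = bochner_laplacian A g h c x" if "x \<in> cimg c" for x
    using bochner_sym[OF tensor_smooth[OF h c] tensor_sym[OF h c] that] that c by (simp add: bochner_laplacian_def)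
next
  fix c d x assume c: "c \<in> A" "d \<in> A" and x: "x \<in> overlap c d"
  interpret coordinate_change "overlap c d" "g c" "overlap d c" "g d" "transition c d" "Jac c d"
    by (rule coordinate_change_charts[OF g c])
  have "bochner_local (g c) (h c) x =
      transpose (Jac c d x) ** bochner_local (g d) (h d) (transition c d x) ** Jac c d x"
    by (rule bochner_pull[OF smooth_on_subset[OF tensor_smooth[OF h c(2)] overlap_sub[OF c(2)]] tensor_transform[OF h c] x])
  then show "bochner_laplacian A g h c x =
      transpose (Jac c d x) ** bochner_laplacian A g h d (transition c d x) ** Jac c d x"
    using x c overlap_sub[of c d] overlap_sub[of d c] transition_overlap[OF c x] by (auto simp: bochner_laplacian_def)
qed (auto simp: bochner_laplacian_def)

lemma sobolev_op_tensor: "g \<in> \<M> \<Longrightarrow> h \<in> \<T> \<Longrightarrow> sobolev_op A p g h \<in> \<T>"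
  unfolding sobolev_op_def by (induction p) (auto intro: tadd_tensor bochner_tensor)

lemma bochner_linear:
  assumes g: "g \<in> \<M>" and h: "h \<in> \<T>" and k: "k \<in> \<T>"
  shows "bochner_laplacian A g (tadd h (tscale r k)) = tadd (bochner_laplacian A g h) (tscale r (bochner_laplacian A g k))"
proof (intro ext)
  fix c x
  show "bochner_laplacian A g (tadd h (tscale r k)) c x = tadd (bochner_laplacian A g h) (tscale r (bochner_laplacian A g k)) c x"
  proof (cases "c \<in> A \<and> x \<in> cimg c")
    case True
    then interpret local_metric "cimg c" "g c" by (intro local_metric_chart[OF g]) simp
    show ?thesis
      using bochner_add_scale[of "h c" "k c" x r] True tensor_smooth[OF h] tensor_smooth[OF k]
      by (simp add: bochner_laplacian_def tadd_def tscale_def)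
  qed (auto simp: bochner_laplacian_def tadd_def tscale_def)
qed

lemma sobolev_op_linear:
  assumes g: "g \<in> \<M>" and h: "h \<in> \<T>" and k: "k \<in> \<T>"
  shows "sobolev_op A p g (tadd h (tscale r k)) = tadd (sobolev_op A p g h) (tscale r (sobolev_op A p g k))"
proof (induction p)
  case (Suc p)
  have "sobolev_op A (Suc p) g h = tadd (sobolev_op A p g h) (bochner_laplacian A g (sobolev_op A p g h))" for h
    by (simp add: sobolev_op_def)
  then show ?case
    by (simp add: Suc bochner_linear[OF g sobolev_op_tensor[OF g h] sobolev_op_tensor[OF g k]])
      (simp add: tadd_def tscale_def fun_eq_iff algebra_simps)
qed (simp add: sobolev_op_def)

lemma bochner_scaled_metric:
  assumes g: "g \<in> \<M>"
  shows "bochner_laplacian A g (tscale r g) = (\<lambda>c x. 0)"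
proof (intro ext)
  fix c x show "bochner_laplacian A g (tscale r g) c x = 0"
  proof (cases "c \<in> A \<and> x \<in> cimg c")
    case True
    then interpret local_metric "cimg c" "g c" by (intro local_metric_chart[OF g]) simp
    show ?thesis using bochner_metric[of x r] True by (simp add: bochner_laplacian_def tscale_def)
  qed (auto simp: bochner_laplacian_def)
qed

text \<open>The reason why all Sobolev metrics have the same geodesics along the ray.\<close>

lemma sobolev_op_scaled_metric: "g \<in> \<M> \<Longrightarrow> sobolev_op A p g (tscale r g) = tscale r g"
  unfolding sobolev_op_def
  by (induction p) (simp_all add: bochner_scaled_metric, simp add: tadd_def)

section \<open>The fibre metric on tensor fields\<close>

lemma g02_local_fibre_metric: "g02_local g h k c = fibre_metric (g c) (h c) (k c)"
  by (simp add: g02_local_def fibre_metric_def fun_eq_iff)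

lemma g02_eq:
  assumes g: "g \<in> \<M>" and h: "h \<in> \<T>" and k: "k \<in> \<T>" and c: "c \<in> A" "q \<in> cdom c"
  shows "g02 A g h k q = fibre_metric (g c) (h c) (k c) (cmap c q)"
proof -
  define d where "d = (SOME c. c \<in> A \<and> q \<in> cdom c)"
  have d: "d \<in> A" "q \<in> cdom d" unfolding d_def using someI[of "\<lambda>c. c \<in> A \<and> q \<in> cdom c" c] c by auto
  interpret coordinate_change "overlap c d" "g c" "overlap d c" "g d" "transition c d" "Jac c d"
    by (rule coordinate_change_charts[OF g c(1) d(1)])
  have x: "cmap c q \<in> overlap c d" using c d by (simp add: overlap_iff)
  have "fibre_metric (g c) (h c) (k c) (cmap c q) = fibre_metric (g d) (h d) (k d) (transition c d (cmap c q))"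
    by (rule fibre_metric_pull[where h="h c" and h'="h d" and k="k c" and k'="k d",
          OF x tensor_transform[OF h c(1) d(1) x] tensor_transform[OF k c(1) d(1) x]])
  also have "transition c d (cmap c q) = cmap d q" using c by (simp add: transition_eq)
  finally show ?thesis by (simp add: g02_def Let_def g02_local_fibre_metric d_def)
qed

lemma g02_smooth:
  assumes g: "g \<in> \<M>" and h: "h \<in> \<T>" and k: "k \<in> \<T>"
  shows "smooth_fun (g02 A g h k)"
  unfolding smooth_fun_def
proof
  fix c assume c: "c \<in> A"
  interpret lm: local_metric "cimg c" "g c" by (rule local_metric_chart[OF g c])
  show "smooth_on (cimg c) (\<lambda>x. g02 A g h k (cinv c x))"
    by (rule smooth_on_cong[OF cimg_open[OF c] _ lm.smooth_fibre_metric[OF tensor_smooth[OF h c] tensor_smooth[OF k c]]])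
      (simp add: g02_eq[OF g h k c] c)
qed

lemma g02_tadd: "g02 A g (tadd h h') k q = g02 A g h k q + g02 A g h' k q"
  by (simp add: g02_def Let_def g02_local_def tadd_def matrix_mult_linear_simps trace_linear_simps)

lemma g02_tscale: "g02 A g (tscale r h) k q = r * g02 A g h k q" "g02 A g h (tscale r k) q = r * g02 A g h k q"
  by (simp_all add: g02_def Let_def g02_local_def tscale_def matrix_mult_linear_simps trace_linear_simps)

lemma g02_nonneg: "g \<in> \<M> \<Longrightarrow> h \<in> \<T> \<Longrightarrow> q \<in> M \<Longrightarrow> g02 A g h h q \<ge> 0"
  and g02_zero: "g \<in> \<M> \<Longrightarrow> h \<in> \<T> \<Longrightarrow> (\<And>q. q \<in> M \<Longrightarrow> g02 A g h h q = 0) \<Longrightarrow> h = (\<lambda>c x. 0)"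
proof -
  assume g: "g \<in> \<M>" and h: "h \<in> \<T>"
  { assume "q \<in> M"
    then obtain c where c: "c \<in> A" "q \<in> cdom c" using chart_at by blast
    then show "g02 A g h h q \<ge> 0"
      using posdef_trace_pos(1)[OF metric_posdef[OF g c(1)] tensor_sym[OF h c(1)], of "cmap c q" "cmap c q"]
      by (simp add: g02_eq[OF g h h c] fibre_metric_def) }
  assume *: "\<And>q. q \<in> M \<Longrightarrow> g02 A g h h q = 0"
  show "h = (\<lambda>c x. 0)"
  proof (rule tensor_eqI[OF h zero_tensor])
    fix c x assume c: "c \<in> A" "x \<in> cimg c"
    have "g02 A g h h (cinv c x) = 0" using * cinv_M[OF c] by blast
    then have "trace (matrix_inv (g c x) ** h c x ** matrix_inv (g c x) ** h c x) = 0"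
      using c by (simp add: g02_eq[OF g h h c(1)] fibre_metric_def)
    then show "h c x = 0" by (rule posdef_trace_pos(2)[OF metric_posdef[OF g c] tensor_sym[OF h c]])
  qed
qed

section \<open>The Riemannian volume\<close>

abbreviation "\<B> \<equiv> restrict_space borel M"

lemma space_B: "space \<B> = M" by (simp add: space_restrict_space)

lemma sets_B_sub: "B \<in> sets \<B> \<Longrightarrow> B \<subseteq> M"
  using sets.sets_into_space[of B \<B>] by (simp add: space_B)

lemma openin_sets: "openin (top_of_set M) B \<Longrightarrow> B \<in> sets \<B>"
proof -
  assume "openin (top_of_set M) B"
  then obtain W where "open W" "B = M \<inter> W" unfolding openin_open by (elim exE conjE)
  then show ?thesis unfolding sets_restrict_space by (intro image_eqI[of _ _ W]) auto
qed

lemma cdom_sets: "c \<in> A \<Longrightarrow> cdom c \<in> sets \<B>"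
  using cdom_open by (rule openin_sets)

lemma cinv_measurable: "c \<in> A \<Longrightarrow> cinv c \<in> restrict_space borel (cimg c) \<rightarrow>\<^sub>M \<B>"
  using cinv_M[of c] by (intro measurable_restrict_space2 borel_measurable_continuous_on_restrict cinv_cont)
    (auto simp: space_restrict_space)

lemma cmap_image: "c \<in> A \<Longrightarrow> cmap c ` (B \<inter> cdom c) = cinv c -` B \<inter> cimg c"
proof (intro equalityI subsetI)
  assume c: "c \<in> A"
  fix x assume "x \<in> cinv c -` B \<inter> cimg c"
  then show "x \<in> cmap c ` (B \<inter> cdom c)" using c by (intro image_eqI[of _ _ "cinv c x"]) auto
qed auto

lemma cmap_image_sets: "c \<in> A \<Longrightarrow> B \<in> sets \<B> \<Longrightarrow> cmap c ` (B \<inter> cdom c) \<in> sets borel"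
proof -
  assume c: "c \<in> A" and B: "B \<in> sets \<B>"
  have "cinv c -` B \<inter> cimg c \<in> sets (restrict_space borel (cimg c))"
    using measurable_sets[OF cinv_measurable[OF c] B] by (simp add: space_restrict_space)
  then show ?thesis
    unfolding cmap_image[OF c] using cimg_open[OF c] by (subst (asm) sets_restrict_space_iff) auto
qed

definition volume_density :: "('m, 'n) tensor \<Rightarrow> ('m, 'n) chart \<Rightarrow> real^'n \<Rightarrow> real" where
  "volume_density g c x = sqrt (det (g c x))"

definition chart_vol :: "('m, 'n) tensor \<Rightarrow> ('m, 'n) chart \<Rightarrow> 'm measure" where
  "chart_vol g c = distr (density (restrict_space lborel (cimg c)) (\<lambda>x. ennreal (volume_density g c x))) \<B> (cinv c)"

lemma volume_density_cont: "g \<in> \<M> \<Longrightarrow> c \<in> A \<Longrightarrow> continuous_on (cimg c) (volume_density g c)"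
  unfolding volume_density_def
  by (intro continuous_on_real_sqrt smooth_on_continuous[OF smooth_on_det] cimg_open tensor_smooth metric_tensor)

lemma volume_density_pos: "g \<in> \<M> \<Longrightarrow> c \<in> A \<Longrightarrow> x \<in> cimg c \<Longrightarrow> volume_density g c x > 0"
  using local_metric.det_pos[OF local_metric_chart] by (simp add: volume_density_def)

lemma volume_density_measurable:
  "g \<in> \<M> \<Longrightarrow> c \<in> A \<Longrightarrow> volume_density g c \<in> borel_measurable (restrict_space lborel (cimg c))"
  using borel_measurable_continuous_on_restrict[OF volume_density_cont]
  by (simp add: measurable_cong_sets[OF sets_restrict_space_cong[OF sets_lborel] refl])

lemma cinv_measurable': "c \<in> A \<Longrightarrow> cinv c \<in> restrict_space lborel (cimg c) \<rightarrow>\<^sub>M \<B>"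
  using cinv_measurable by (simp add: measurable_cong_sets[OF sets_restrict_space_cong[OF sets_lborel] refl])

lemma emeasure_chart_vol:
  assumes g: "g \<in> \<M>" and c: "c \<in> A" and B: "B \<in> sets \<B>"
  shows "emeasure (chart_vol g c) B = (\<integral>\<^sup>+x\<in>cmap c ` (B \<inter> cdom c). ennreal (volume_density g c x) \<partial>lborel)"
proof -
  let ?R = "restrict_space lborel (cimg c)"
  have im: "cinv c -` B \<inter> cimg c \<in> sets ?R"
    using measurable_sets[OF cinv_measurable'[OF c] B] by (simp add: space_restrict_space)
  have "emeasure (chart_vol g c) B = emeasure (density ?R (\<lambda>x. ennreal (volume_density g c x))) (cinv c -` B \<inter> cimg c)"
    unfolding chart_vol_def using cinv_measurable'[OF c] B
    by (subst emeasure_distr) (auto simp: space_restrict_space)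
  also have "\<dots> = (\<integral>\<^sup>+x. ennreal (volume_density g c x) * indicator (cinv c -` B \<inter> cimg c) x \<partial>?R)"
    using volume_density_measurable[OF g c] im by (subst emeasure_density) auto
  also have "\<dots> = (\<integral>\<^sup>+x. ennreal (volume_density g c x) * indicator (cinv c -` B \<inter> cimg c) x * indicator (cimg c) x \<partial>lborel)"
    using cimg_open[OF c] by (subst nn_integral_restrict_space) auto
  also have "\<dots> = (\<integral>\<^sup>+x\<in>cmap c ` (B \<inter> cdom c). ennreal (volume_density g c x) \<partial>lborel)"
    unfolding cmap_image[OF c] by (intro nn_integral_cong) (auto simp: indicator_def)
  finally show ?thesis .
qed

text \<open>Change of variables along the transition map, with \<open>|det J| \<surd>det g' = \<surd>det g\<close>.\<close>

lemma chart_vol_compat: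
  assumes g: "g \<in> \<M>" and c: "c \<in> A" and d: "d \<in> A" and B: "B \<in> sets \<B>" "B \<subseteq> cdom c \<inter> cdom d"
  shows "emeasure (chart_vol g c) B = emeasure (chart_vol g d) B"
proof -
  interpret coordinate_change "overlap c d" "g c" "overlap d c" "g d" "transition c d" "Jac c d"
    by (rule coordinate_change_charts[OF g c d])
  have Bc: "B \<inter> cdom c = B" and Bd: "B \<inter> cdom d = B" using B by auto
  have b: "cmap c ` B \<in> sets borel" "cmap d ` B \<in> sets borel"
    using cmap_image_sets[OF c B(1)] cmap_image_sets[OF d B(1)] by (simp_all add: Bc Bd)
  have sub: "cmap c ` B \<subseteq> overlap c d" using B by (auto simp: overlap_def)
  have img: "transition c d ` cmap c ` B = cmap d ` B"
    using B c by (auto simp: transition_eq image_image intro!: image_cong)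
  have cont: "(\<lambda>x. indicator (cmap e ` B) x * volume_density g e x) \<in> borel_measurable borel"
    if "e \<in> A" "B \<subseteq> cdom e" "cmap e ` B \<in> sets borel" for e
  proof -
    have "cmap e ` B \<subseteq> cimg e" using that(2) cmap_cimg[OF that(1)] by blast
    from borel_measurable_continuous_on_indicator[OF that(3) continuous_on_subset[OF volume_density_cont[OF g that(1)] this]]
    show ?thesis by simp
  qed
  have eq: "\<bar>det (matrix (frechet_derivative (transition c d) (at x)))\<bar> * volume_density g d (transition c d x) = volume_density g c x"
    if "x \<in> cmap c ` B" for x
    using sqrt_det_pull[of x] that sub by (auto simp: volume_density_def Jac_def)
  have "(\<integral>\<^sup>+y\<in>transition c d ` cmap c ` B. ennreal (volume_density g d y) \<partial>lborel) =
      (\<integral>\<^sup>+x\<in>cmap c ` B. ennreal (\<bar>det (matrix (frechet_derivative (transition c d) (at x)))\<bar> * volume_density g d (transition c d x)) \<partial>lborel)"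
  proof (rule nn_integral_change_of_variables[OF b(1)])
    show "(transition c d has_derivative frechet_derivative (transition c d) (at x)) (at x)" if "x \<in> cmap c ` B" for x
      using smooth_on_has_derivative[OF transition_smooth[OF c d]] that sub by blast
    show "inj_on (transition c d) (cmap c ` B)"
    proof (rule inj_on_inverseI)
      show "transition d c (transition c d x) = x" if x: "x \<in> cmap c ` B" for x
      proof -
        obtain q where "x = cmap c q" "q \<in> cdom c" "q \<in> cdom d" using x B(2) by blast
        then show ?thesis using c d by (simp add: transition_eq)
      qed
    qed
    show "volume_density g d y \<ge> 0" if y: "y \<in> transition c d ` cmap c ` B" for y
    proof -
      obtain q where "y = cmap d q" "q \<in> cdom d" using y B(2) unfolding img by blast
      then show ?thesis using volume_density_pos[OF g d] d by (simp add: less_imp_le)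
    qed
    show "(\<lambda>y. indicator (transition c d ` cmap c ` B) y * volume_density g d y) \<in> borel_measurable borel"
      unfolding img using B b by (intro cont d) auto
    have "(\<lambda>x. indicator (cmap c ` B) x * (\<bar>det (matrix (frechet_derivative (transition c d) (at x)))\<bar> * volume_density g d (transition c d x)))
      = (\<lambda>x. indicator (cmap c ` B) x * volume_density g c x)"
      using eq by (auto simp: indicator_def fun_eq_iff)
    then show "(\<lambda>x. indicator (cmap c ` B) x * (\<bar>det (matrix (frechet_derivative (transition c d) (at x)))\<bar> * volume_density g d (transition c d x))) \<in> borel_measurable borel"
      using cont[OF c] B b by simp
  qed
  also have "\<dots> = (\<integral>\<^sup>+x\<in>cmap c ` B. ennreal (volume_density g c x) \<partial>lborel)"
    by (intro nn_integral_cong) (auto simp: indicator_def eq)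
  finally show ?thesis
    by (simp add: emeasure_chart_vol[OF g c B(1)] emeasure_chart_vol[OF g d B(1)] Bc Bd img)
qed

text \<open>The property by which \<open>vol\<close> is defined.\<close>

definition is_vol :: "('m, 'n) tensor \<Rightarrow> 'm measure \<Rightarrow> bool" where
  "is_vol g \<mu> \<longleftrightarrow> sets \<mu> = sets \<B> \<and> (\<forall>c\<in>A. \<forall>B\<in>sets \<mu>. B \<subseteq> cdom c \<longrightarrow>
        emeasure \<mu> B = (\<integral>\<^sup>+x\<in>cmap c ` B. ennreal (sqrt (det (g c x))) \<partial>lborel))"

lemma is_vol_iff:
  assumes g: "g \<in> \<M>"
  shows "is_vol g \<mu> \<longleftrightarrow> sets \<mu> = sets \<B> \<and> (\<forall>c\<in>A. \<forall>B\<in>sets \<B>. B \<subseteq> cdom c \<longrightarrow> emeasure \<mu> B = emeasure (chart_vol g c) B)"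
  unfolding is_vol_def
  by (intro conj_cong refl ball_cong imp_cong | simp add: emeasure_chart_vol[OF g] volume_density_def Int_absorb2)+

lemma finite_disjoint_chart_cover:
  obtains N :: nat and f P where "\<And>i. i < N \<Longrightarrow> f i \<in> A" "\<And>i. i < N \<Longrightarrow> P i \<in> sets \<B>"
    "\<And>i. i < N \<Longrightarrow> P i \<subseteq> cdom (f i)" "disjoint_family_on P {..<N}" "M = (\<Union>i<N. P i)"
proof -
  obtain F where F: "finite F" "\<And>b. b \<in> F \<Longrightarrow> good_ball b" "M = (\<Union>(c, a, r)\<in>F. cinv c ` ball a r)"
    using finite_ball_cover by metis
  let ?N = "card F"
  obtain e where e: "bij_betw e {0..<?N} F" using ex_bij_betw_nat_finite[OF F(1)] by blast
  define f where "f i = fst (e i)" for i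
  have eF: "e i \<in> F" if "i < ?N" for i using bij_betw_apply[OF e] that by simp
  have f: "f i \<in> A" if "i < ?N" for i
    using F(2)[OF eF[OF that]] by (cases "e i") (simp add: f_def good_ball_def)
  \<comment> \<open>Each point is assigned to the first chart that contains it.\<close>
  define P where "P i = cdom (f i) - (\<Union>j<i. cdom (f j))" for i
  have "P i \<in> sets \<B>" if "i < ?N" for i
    unfolding P_def using f that cdom_sets by (intro sets.Diff sets.finite_UN) auto
  moreover have "P i \<subseteq> cdom (f i)" for i by (auto simp: P_def)
  moreover have "disjoint_family_on P {..<?N}"
    unfolding disjoint_family_on_def
  proof (intro ballI impI)
    fix m n :: nat assume "m \<noteq> n"
    then consider "m < n" | "n < m" by linarith
    then show "P m \<inter> P n = {}" unfolding P_def by cases blast+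
  qed
  moreover have "M = (\<Union>i<?N. P i)"
  proof
    show "(\<Union>i<?N. P i) \<subseteq> M" using f cdom_sub by (fastforce simp: P_def)
    show "M \<subseteq> (\<Union>i<?N. P i)"
    proof
      fix q assume "q \<in> M"
      then obtain c a r where b: "(c, a, r) \<in> F" "q \<in> cinv c ` ball a r" using F(3) by auto
      then have gb: "c \<in> A" "ball a r \<subseteq> cimg c" using F(2)[OF b(1)] ball_subset_cball[of a r] by (auto simp: good_ball_def)
      have "(c, a, r) \<in> e ` {0..<?N}" using b(1) e by (simp add: bij_betw_def)
      then obtain i where i: "i < ?N" "e i = (c, a, r)" by (elim imageE) simp
      have "q \<in> cdom (f i)" using b(2) gb i by (auto simp: f_def)
      then have ex: "\<exists>i. i < ?N \<and> q \<in> cdom (f i)" using i by blast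
      define k where "k = (LEAST i. i < ?N \<and> q \<in> cdom (f i))"
      have k: "k < ?N" "q \<in> cdom (f k)" using LeastI_ex[OF ex] by (auto simp: k_def)
      have "q \<notin> cdom (f j)" if "j < k" for j
        using not_less_Least[of j "\<lambda>i. i < ?N \<and> q \<in> cdom (f i)"] that k(1) by (simp add: k_def[symmetric])
      then show "q \<in> (\<Union>i<?N. P i)" using k by (auto simp: P_def)
    qed
  qed
  ultimately show ?thesis using that[of ?N f P] f by simp
qed

text \<open>The volume is the sum of the chart volumes over finitely many disjoint pieces, each inside one chart;
  by compatibility of the chart volumes any chart may be used to measure a piece.  The same
  decomposition gives uniqueness.\<close>

lemma is_vol_vol:
  assumes g: "g \<in> \<M>"
  shows "is_vol g (vol A g)"
proof -
  obtain N :: nat and f P where f: "\<And>i. i < N \<Longrightarrow> f i \<in> A" and P: "\<And>i. i < N \<Longrightarrow> P i \<in> sets \<B>"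
    "\<And>i. i < N \<Longrightarrow> P i \<subseteq> cdom (f i)" and disj: "disjoint_family_on P {..<N}" and M: "M = (\<Union>i<N. P i)"
    using finite_disjoint_chart_cover by metis
  have cv_sets: "sets (chart_vol g c) = sets \<B>" for c by (simp add: chart_vol_def)
  have split: "emeasure \<mu> B = (\<Sum>i<N. emeasure \<mu> (B \<inter> P i))" if \<mu>: "sets \<mu> = sets \<B>" and B: "B \<in> sets \<B>" for \<mu> B
  proof -
    have "(\<Sum>i<N. emeasure \<mu> (B \<inter> P i)) = emeasure \<mu> (\<Union>i<N. B \<inter> P i)"
    proof (rule sum_emeasure)
      show "disjoint_family_on (\<lambda>i. B \<inter> P i) {..<N}" using disj unfolding disjoint_family_on_def by blast
    qed (use P B \<mu> in auto)
    moreover have "(\<Union>i<N. B \<inter> P i) = B" using sets_B_sub[OF B] M by auto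
    ultimately show ?thesis by simp
  qed
  define \<nu> where "\<nu> B = (\<Sum>i<N. emeasure (chart_vol g (f i)) (B \<inter> P i))" for B
  define \<mu> where "\<mu> = measure_of M (sets \<B>) \<nu>"
  have sa: "sigma_algebra M (sets \<B>)" using sets.sigma_algebra_axioms[of \<B>] by (simp add: space_B)
  have \<mu>_sets: "sets \<mu> = sets \<B>"
    unfolding \<mu>_def using sigma_algebra.sets_measure_of_eq[OF sa] by simp
  have "countably_additive (sets \<B>) \<nu>"
    unfolding countably_additive_def
  proof (intro allI impI)
    fix B :: "nat \<Rightarrow> 'm set" assume B: "range B \<subseteq> sets \<B>" "disjoint_family B"
    have "(\<Sum>k. \<nu> (B k)) = (\<Sum>i<N. \<Sum>k. emeasure (chart_vol g (f i)) (B k \<inter> P i))"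
      unfolding \<nu>_def by (rule suminf_sum) (rule summableI)
    also have "\<dots> = (\<Sum>i<N. emeasure (chart_vol g (f i)) (\<Union>k. B k \<inter> P i))"
    proof (intro sum.cong refl suminf_emeasure)
      show "disjoint_family (\<lambda>k. B k \<inter> P i)" for i using B(2) unfolding disjoint_family_on_def by blast
      show "range (\<lambda>k. B k \<inter> P i) \<subseteq> sets (chart_vol g (f i))" if "i \<in> {..<N}" for i
        using B(1) P(1) that by (auto simp: cv_sets)
    qed
    finally show "(\<Sum>k. \<nu> (B k)) = \<nu> (\<Union> (range B))" by (simp add: \<nu>_def)
  qed
  moreover have "positive (sets \<B>) \<nu>" by (simp add: positive_def \<nu>_def)
  ultimately have em: "emeasure \<mu> B = \<nu> B" if "B \<in> sets \<B>" for B
    unfolding \<mu>_def using emeasure_measure_of_sigma[OF sa _ _ that] by blast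
  have "is_vol g \<mu>"
    unfolding is_vol_iff[OF g]
  proof (intro conjI \<mu>_sets ballI impI)
    fix c B assume c: "c \<in> A" and B: "B \<in> sets \<B>" "B \<subseteq> cdom c"
    have "emeasure \<mu> B = (\<Sum>i<N. emeasure (chart_vol g (f i)) (B \<inter> P i))" using em[OF B(1)] by (simp add: \<nu>_def)
    also have "\<dots> = (\<Sum>i<N. emeasure (chart_vol g c) (B \<inter> P i))"
      using f P c B by (intro sum.cong refl chart_vol_compat[OF g]) auto
    also have "\<dots> = emeasure (chart_vol g c) B" using split[OF cv_sets B(1)] by simp
    finally show "emeasure \<mu> B = emeasure (chart_vol g c) B" .
  qed
  moreover have "\<mu>' = \<mu>" if "is_vol g \<mu>'" for \<mu>'
  proof (rule measure_eqI)
    have s': "sets \<mu>' = sets \<B>" using that by (simp add: is_vol_def)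
    then show "sets \<mu>' = sets \<mu>" by (simp add: \<mu>_sets)
    fix B assume "B \<in> sets \<mu>'"
    then have B: "B \<in> sets \<B>" by (simp add: s')
    have "emeasure \<mu>' (B \<inter> P i) = emeasure \<mu> (B \<inter> P i)" if i: "i < N" for i
    proof -
      have "B \<inter> P i \<in> sets \<B>" "B \<inter> P i \<subseteq> cdom (f i)" using B P i by auto
      then show ?thesis
        using \<open>is_vol g \<mu>'\<close> \<open>is_vol g \<mu>\<close> f[OF i] unfolding is_vol_iff[OF g] by simp
    qed
    then show "emeasure \<mu>' B = emeasure \<mu> B" unfolding split[OF s' B] split[OF \<mu>_sets B] by simp
  qed
  ultimately have "(THE \<mu>. is_vol g \<mu>) = \<mu>" by (intro the_equality)
  moreover have "vol A g = (THE \<mu>. is_vol g \<mu>)" unfolding vol_def is_vol_def cover ..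
  ultimately show ?thesis using \<open>is_vol g \<mu>\<close> by simp
qed

lemma sets_vol: "g \<in> \<M> \<Longrightarrow> sets (vol A g) = sets \<B>"
  using is_vol_vol is_vol_def by blast

lemma space_vol: "g \<in> \<M> \<Longrightarrow> space (vol A g) = M"
  using sets_eq_imp_space_eq[OF sets_vol] by (simp add: space_B)

lemma emeasure_vol: "g \<in> \<M> \<Longrightarrow> c \<in> A \<Longrightarrow> B \<in> sets \<B> \<Longrightarrow> B \<subseteq> cdom c \<Longrightarrow> emeasure (vol A g) B = emeasure (chart_vol g c) B"
  using is_vol_vol is_vol_iff by blast

lemma integral_chart:
  assumes g: "g \<in> \<M>" and c: "c \<in> A" and f: "f \<in> borel_measurable \<B>" "\<And>q. q \<in> M \<Longrightarrow> q \<notin> cdom c \<Longrightarrow> f q = (0::real)"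
  shows "(\<integral>q. f q \<partial>vol A g) = (\<integral>x. indicator (cimg c) x *\<^sub>R (volume_density g c x * f (cinv c x)) \<partial>lborel)"
proof -
  have ind: "(indicator (cdom c) :: 'm \<Rightarrow> real) \<in> borel_measurable (vol A g)"
    using cdom_sets[OF c] sets_vol[OF g] by (intro borel_measurable_indicator) simp
  have fv: "f \<in> borel_measurable (vol A g)" using f(1) by (simp add: measurable_cong_sets[OF sets_vol[OF g] refl])
  have eq: "density (vol A g) (\<lambda>q. ennreal (indicator (cdom c) q)) = chart_vol g c"
  proof (rule measure_eqI)
    fix B assume "B \<in> sets (density (vol A g) (\<lambda>q. ennreal (indicator (cdom c) q)))"
    then have B: "B \<in> sets \<B>" by (simp add: sets_vol[OF g])
    have B': "B \<inter> cdom c \<in> sets \<B>" using B cdom_sets[OF c] by auto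
    have "emeasure (density (vol A g) (\<lambda>q. ennreal (indicator (cdom c) q))) B =
        (\<integral>\<^sup>+q. ennreal (indicator (cdom c) q) * indicator B q \<partial>vol A g)"
      using ind B by (intro emeasure_density) (auto simp: sets_vol[OF g])
    also have "\<dots> = (\<integral>\<^sup>+q. indicator (B \<inter> cdom c) q \<partial>vol A g)"
      by (intro nn_integral_cong) (auto simp: indicator_def)
    also have "\<dots> = emeasure (vol A g) (B \<inter> cdom c)"
      using B' by (intro nn_integral_indicator) (simp add: sets_vol[OF g])
    also have "\<dots> = emeasure (chart_vol g c) B"
      by (simp add: emeasure_vol[OF g c B'] emeasure_chart_vol[OF g c B] emeasure_chart_vol[OF g c B'] Int_assoc)
    finally show "emeasure (density (vol A g) (\<lambda>q. ennreal (indicator (cdom c) q))) B = emeasure (chart_vol g c) B" .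
  qed (simp add: sets_vol[OF g] chart_vol_def)
  have "(\<integral>q. f q \<partial>vol A g) = (\<integral>q. indicator (cdom c) q *\<^sub>R f q \<partial>vol A g)"
    using f(2) by (intro Bochner_Integration.integral_cong) (auto simp: space_vol[OF g] indicator_def)
  also have "\<dots> = (\<integral>q. f q \<partial>density (vol A g) (\<lambda>q. ennreal (indicator (cdom c) q)))"
    using ind fv by (intro integral_density[symmetric]) auto
  also have "\<dots> = (\<integral>x. f (cinv c x) \<partial>density (restrict_space lborel (cimg c)) (\<lambda>x. ennreal (volume_density g c x)))"
    unfolding eq chart_vol_def using cinv_measurable'[OF c] f(1) by (intro integral_distr) auto
  also have "\<dots> = (\<integral>x. volume_density g c x *\<^sub>R f (cinv c x) \<partial>restrict_space lborel (cimg c))"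
    using volume_density_measurable[OF g c] measurable_compose[OF cinv_measurable'[OF c] f(1)] volume_density_pos[OF g c]
    by (intro integral_density) (auto simp: space_restrict_space intro!: AE_I2 less_imp_le)
  also have "\<dots> = (\<integral>x. indicator (cimg c) x *\<^sub>R (volume_density g c x * f (cinv c x)) \<partial>lborel)"
    using cimg_open[OF c] by (subst integral_restrict_space) auto
  finally show ?thesis .
qed

lemma finite_vol: "g \<in> \<M> \<Longrightarrow> finite_measure (vol A g)"
proof
  assume g: "g \<in> \<M>"
  obtain F where F: "finite F" "\<And>b. b \<in> F \<Longrightarrow> good_ball b" "M = (\<Union>(c, a, r)\<in>F. cinv c ` ball a r)"
    using finite_ball_cover by metis
  let ?O = "\<lambda>(c, a, r). cinv c ` ball a r :: 'm set"
  have fin: "?O b \<in> sets \<B> \<and> emeasure (vol A g) (?O b) < \<infinity>" if b: "b \<in> F" for b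
  proof -
    obtain c a r where e: "b = (c, a, r)" by (cases b)
    have c: "c \<in> A" and r: "cball a r \<subseteq> cimg c" using F(2)[OF b] by (auto simp: e good_ball_def)
    have br: "ball a r \<subseteq> cimg c" using r ball_subset_cball by blast
    have sub: "cinv c ` ball a r \<subseteq> cdom c" using br c by auto
    have img: "cmap c ` (cinv c ` ball a r) = ball a r" using br c by (force simp: image_iff)
    have "openin (top_of_set (cdom c)) (cinv c ` ball a r)"
      using br by (intro homeomorphism_imp_open_map[OF homeomorphism_symD[OF cmap_homeo[OF c]]]) (auto simp: open_openin_trans open_subset)
    then have s: "cinv c ` ball a r \<in> sets \<B>" by (intro openin_sets openin_trans[OF _ cdom_open[OF c]])
    obtain K where K: "\<And>x. x \<in> cball a r \<Longrightarrow> volume_density g c x \<le> K"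
    proof -
      have "compact (volume_density g c ` cball a r)"
        by (rule compact_continuous_image[OF continuous_on_subset[OF volume_density_cont[OF g c] r] compact_cball])
      then obtain K where "\<forall>y\<in>volume_density g c ` cball a r. norm y \<le> K"
        using compact_imp_bounded bounded_iff by metis
      then show ?thesis using that[of K] by force
    qed
    have "emeasure (vol A g) (cinv c ` ball a r) = (\<integral>\<^sup>+x\<in>ball a r. ennreal (volume_density g c x) \<partial>lborel)"
      by (simp add: emeasure_vol[OF g c s sub] emeasure_chart_vol[OF g c s] Int_absorb2[OF sub] img)
    also have "\<dots> \<le> (\<integral>\<^sup>+x. ennreal K * indicator (cball a r) x \<partial>lborel)"
      using K by (intro nn_integral_mono) (auto simp: indicator_def intro!: ennreal_leI)
    also have "\<dots> = ennreal K * emeasure lborel (cball a r)" by (intro nn_integral_cmult_indicator) auto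
    also have "\<dots> < \<infinity>" using emeasure_bounded_finite[of "cball a r"] by (simp add: ennreal_mult_less_top)
    finally show ?thesis using s by (simp add: e)
  qed
  have "emeasure (vol A g) M \<le> (\<Sum>b\<in>F. emeasure (vol A g) (?O b))"
    unfolding F(3) using fin F(1) by (intro emeasure_subadditive_finite) (auto simp: sets_vol[OF g])
  also have "\<dots> < \<infinity>" using fin F(1) by (simp add: ennreal_sum_less_top)
  finally show "emeasure (vol A g) (space (vol A g)) \<noteq> \<infinity>" by (simp add: space_vol[OF g])
qed

lemma measurable_continuous: "continuous_on M (f :: 'm \<Rightarrow> real) \<Longrightarrow> f \<in> borel_measurable \<B>"
  by (rule borel_measurable_continuous_on_restrict)

lemma integrable_continuous:
  assumes g: "g \<in> \<M>" and f: "continuous_on M (f :: 'm \<Rightarrow> real)"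
  shows "integrable (vol A g) f"
proof -
  obtain K where "\<forall>y\<in>f ` M. norm y \<le> K"
    using compact_imp_bounded[OF compact_continuous_image[OF f compact]] bounded_iff by metis
  then show ?thesis
    using measurable_continuous[OF f]
    by (intro finite_measure.integrable_const_bound[OF finite_vol[OF g], of _ K])
      (auto simp: space_vol[OF g] measurable_cong_sets[OF sets_vol[OF g] refl])
qed

text \<open>Where \<open>f\<close> is positive there is an open set of volume zero; in a chart this is an open null set of
  Lebesgue measure, hence empty.\<close>

lemma integral_zero_imp_zero:
  assumes g: "g \<in> \<M>" and f: "continuous_on M (f :: 'm \<Rightarrow> real)" "\<And>q. q \<in> M \<Longrightarrow> f q \<ge> 0"
    and int: "(\<integral>q. f q \<partial>vol A g) \<le> 0" and q: "q \<in> M"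
  shows "f q = 0"
proof (rule ccontr)
  assume "f q \<noteq> 0"
  obtain c where c: "c \<in> A" "q \<in> cdom c" using chart_at[OF q] by blast
  have opM: "openin (top_of_set M) (M \<inter> f -` {0<..})"
    by (rule continuous_openin_preimage_gen[OF f(1)]) simp
  define B where "B = (M \<inter> f -` {0<..}) \<inter> cdom c"
  have B: "openin (top_of_set M) B" "B \<subseteq> cdom c" "q \<in> B"
    using opM cdom_open[OF c(1)] c \<open>f q \<noteq> 0\<close> f(2)[OF q] q by (auto simp: B_def)
  have Bs: "B \<in> sets \<B>" using B(1) by (rule openin_sets)
  have "AE q in vol A g. 0 \<le> f q" using f(2) by (intro AE_I2) (simp add: space_vol[OF g])
  then have "integral\<^sup>L (vol A g) f = 0 \<longleftrightarrow> (AE q in vol A g. f q = 0)"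
    by (rule integral_nonneg_eq_0_iff_AE[OF integrable_continuous[OF g f(1)]])
  moreover have "integral\<^sup>L (vol A g) f \<ge> 0" by (rule integral_nonneg_AE) fact
  ultimately have "AE q in vol A g. q \<notin> B" using int by (auto simp: B_def elim!: eventually_mono)
  then have "emeasure (vol A g) B = 0"
    using AE_iff_measurable[of B "vol A g" "\<lambda>q. q \<notin> B"] Bs sets_B_sub[OF Bs] by (auto simp: sets_vol[OF g] space_vol[OF g])
  then have "(\<integral>\<^sup>+x\<in>cmap c ` B. ennreal (volume_density g c x) \<partial>lborel) = 0"
    by (simp add: emeasure_vol[OF g c(1) Bs B(2)] emeasure_chart_vol[OF g c(1) Bs] Int_absorb2[OF B(2)])
  moreover have bs: "cmap c ` B \<in> sets borel" using cmap_image_sets[OF c(1) Bs] by (simp add: Int_absorb2[OF B(2)])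
  moreover have "(\<lambda>x. ennreal (volume_density g c x) * indicator (cmap c ` B) x) \<in> borel_measurable lborel"
  proof -
    have "(\<lambda>x. indicator (cmap c ` B) x *\<^sub>R volume_density g c x) \<in> borel_measurable borel"
      using B(2) c by (intro borel_measurable_continuous_on_indicator[OF bs] continuous_on_subset[OF volume_density_cont[OF g c(1)]]) auto
    then have "(\<lambda>x. ennreal (indicator (cmap c ` B) x *\<^sub>R volume_density g c x)) \<in> borel_measurable lborel" by simp
    moreover have "ennreal (indicator (cmap c ` B) x *\<^sub>R volume_density g c x) = ennreal (volume_density g c x) * indicator (cmap c ` B) x" for x
      by (auto simp: indicator_def)
    ultimately show ?thesis by simp
  qed
  ultimately have "AE x in lborel. ennreal (volume_density g c x) * indicator (cmap c ` B) x = 0"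
    by (simp add: nn_integral_0_iff_AE)
  then have "AE x in lborel. x \<notin> cmap c ` B"
  proof eventually_elim
    case (elim x)
    show ?case
    proof
      assume x: "x \<in> cmap c ` B"
      then have "volume_density g c x > 0" using B(2) c volume_density_pos[OF g c(1)] by auto
      then show False using elim x by simp
    qed
  qed
  then have "emeasure lborel (cmap c ` B) = 0"
    using AE_iff_measurable[of "cmap c ` B" lborel "\<lambda>x. x \<notin> cmap c ` B"] bs by auto
  moreover have "open (cmap c ` B)"
  proof -
    have "cmap c ` B = {x \<in> cimg c. cinv c x \<in> B}"
      using cmap_image[OF c(1), of B] by (auto simp: Int_absorb2[OF B(2)])
    then show ?thesis using open_preimage[OF c(1) B(1)] by simp
  qed
  moreover have "cmap c ` B \<noteq> {}" using B(3) by blast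
  ultimately show False
    using open_not_negligible negligible_iff_null_sets null_sets_completionI by (metis bs null_setsI sets_lborel)
qed

end

section \<open>Integrals of the Bochner Laplacian and injectivity\<close>

context compact_manifold begin

lemma integrable_g02: "g \<in> \<M> \<Longrightarrow> h \<in> \<T> \<Longrightarrow> k \<in> \<T> \<Longrightarrow> integrable (vol A g) (g02 A g h k)"
  by (intro integrable_continuous smooth_fun_continuous g02_smooth)

lemma L2_tadd: "g \<in> \<M> \<Longrightarrow> h \<in> \<T> \<Longrightarrow> h' \<in> \<T> \<Longrightarrow> k \<in> \<T> \<Longrightarrow>
    L2_metric A g (tadd h h') k = L2_metric A g h k + L2_metric A g h' k"
  by (simp add: L2_metric_def g02_tadd integrable_g02)

lemma L2_tscale: "L2_metric A g (tscale r h) k = r * L2_metric A g h k"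
    "L2_metric A g h (tscale r k) = r * L2_metric A g h k"
  by (simp_all add: L2_metric_def g02_tscale)

lemma L2_definite: "g \<in> \<M> \<Longrightarrow> h \<in> \<T> \<Longrightarrow> L2_metric A g h h \<le> 0 \<Longrightarrow> h = (\<lambda>c x. 0)"
  unfolding L2_metric_def
  by (rule g02_zero) (auto intro!: integral_zero_imp_zero smooth_fun_continuous g02_smooth g02_nonneg)

lemma diff_zero_iff: "tadd s (tscale (-1) s') = (\<lambda>c x. 0) \<longleftrightarrow> s = s'"
  by (simp add: tadd_def tscale_def fun_eq_iff)

lemma L2_cancel:
  assumes g: "g \<in> \<M>" and s: "s \<in> \<T>" "s' \<in> \<T>" and eq: "\<And>k. k \<in> \<T> \<Longrightarrow> L2_metric A g s k = L2_metric A g s' k"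
  shows "s = s'"
proof -
  let ?d = "tadd s (tscale (-1) s')"
  have d: "?d \<in> \<T>" by (intro tadd_tensor tscale_tensor s)
  have "L2_metric A g ?d ?d = L2_metric A g s ?d - L2_metric A g s' ?d"
    using s d by (simp add: L2_tadd[OF g] tscale_tensor L2_tscale)
  then have "L2_metric A g ?d ?d \<le> 0" using eq[OF d] by simp
  then show ?thesis using L2_definite[OF g d] diff_zero_iff by blast
qed

text \<open>In the chart the integrand is \<open>-\<Sum>\<^sub>a \<partial>\<^sub>a V\<^sup>a\<close> with \<open>V\<^sup>a = \<surd>det g W\<^sup>a\<close> and \<open>W\<^sub>b = \<langle>\<nabla>\<^sub>b h, g\<rangle>\<close>, because \<open>\<nabla>g = 0\<close>.
  The components \<open>V\<^sup>a\<close> have compact support.\<close>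

lemma L2_bochner_supported:
  assumes g: "g \<in> \<M>" and h: "h \<in> \<T>" and c: "c \<in> A" and K: "compact K" "K \<subseteq> cimg c"
    and zero: "\<And>d x. d \<in> A \<Longrightarrow> x \<in> cimg d \<Longrightarrow> cinv d x \<notin> cinv c ` K \<Longrightarrow> h d x = 0"
  shows "L2_metric A g (bochner_laplacian A g h) g = 0"
proof -
  interpret lm: local_metric "cimg c" "g c" by (rule local_metric_chart[OF g c])
  let ?C = "cov_deriv (christoffel_matrix (g c))"
  define W where "W b = fibre_metric (g c) (?C (h c) b) (g c)" for b
  define V where "V a x = (if x \<in> cimg c then lm.vector_density W a x else 0)" for a x
  have gT: "g \<in> \<T>" by (rule metric_tensor[OF g])
  have bT: "bochner_laplacian A g h \<in> \<T>" by (rule bochner_tensor[OF g h])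
  have Hs: "smooth_on (cimg c) (h c)" by (rule tensor_smooth[OF h c])
  have Ws: "smooth_on (cimg c) (W b)" for b
    unfolding W_def by (rule lm.smooth_fibre_metric[OF lm.smooth_cov_deriv[OF Hs] lm.smooth_metric])
  have vs: "smooth_on (cimg c) (lm.vector_density W a)" for a
    unfolding lm.vector_density_def
    using lm.smooth_inv[unfolded smooth_on_matrix_iff[OF lm.open_domain]]
    by (intro smooth_on_mult smooth_on_sqrt smooth_on_det smooth_on_sum Ws lm.open_domain lm.smooth_metric lm.det_pos) auto
  have U: "open (cimg c - K)" using lm.open_domain compact_imp_closed[OF K(1)] by blast
  have H0: "h c y = 0" if y: "y \<in> cimg c - K" for y
  proof (rule zero[OF c])
    show "cinv c y \<notin> cinv c ` K"
    proof
      assume "cinv c y \<in> cinv c ` K"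
      then obtain z where "z \<in> K" "cinv c y = cinv c z" by blast
      then have "y = z" using cmap_cinv[OF c, of y] cmap_cinv[OF c, of z] y K(2) by auto
      then show False using y \<open>z \<in> K\<close> by simp
    qed
  qed (use y in simp)
  have V0: "V a x = 0" if x: "x \<notin> K" for a x
  proof (cases "x \<in> cimg c")
    case True
    then have "?C (h c) b x = ?C (\<lambda>_. 0) b x" for b
      by (intro cov_deriv_cong[OF U] H0) (use x in auto)
    then have "?C (h c) b x = 0" for b by (simp add: cov_deriv_def)
    then have "W b x = 0" for b by (simp add: W_def fibre_metric_def trace_linear_simps)
    then show ?thesis by (simp add: V_def lm.vector_density_def)
  qed (simp add: V_def)
  have Kc: "open (- K)" using compact_imp_closed[OF K(1)] by blast
  have Vs: "smooth_on UNIV (V a)" for a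
  proof (rule smooth_on_open_cover)
    fix x
    show "\<exists>T. open T \<and> x \<in> T \<and> smooth_on T (V a)"
    proof (cases "x \<in> K")
      case True
      have "smooth_on (cimg c) (V a)" by (rule smooth_on_cong[OF lm.open_domain _ vs[of a]]) (simp add: V_def)
      then show ?thesis using True K(2) lm.open_domain by blast
    next
      case False
      have "smooth_on (- K) (V a)" by (rule smooth_on_cong[OF Kc _ smooth_on_const[of _ 0]]) (simp add: V0)
      then show ?thesis using False Kc by blast
    qed
  qed
  have key: "indicator (cimg c) x *\<^sub>R (volume_density g c x * g02 A g (bochner_laplacian A g h) g (cinv c x)) =
      - (\<Sum>a\<in>UNIV. pd a (V a) x)" for x
  proof (cases "x \<in> cimg c")
    case True
    have "g02 A g (bochner_laplacian A g h) g (cinv c x) = fibre_metric (g c) (bochner_local (g c) (h c)) (g c) x"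
      using g02_eq[OF g bT gT c cinv_cdom[OF c True]] True c by (simp add: fibre_metric_def bochner_laplacian_def)
    also have "\<dots> = - lm.div_cov W x"
      unfolding W_def lm.div_fibre_metric[OF Hs lm.smooth_metric True]
      by (simp add: fibre_metric_def[of _ _ "?C (g c) _"] lm.cov_deriv_metric[OF True] trace_linear_simps)
    finally have "volume_density g c x * g02 A g (bochner_laplacian A g h) g (cinv c x) =
        - (\<Sum>a\<in>UNIV. pd a (lm.vector_density W a) x)"
      unfolding lm.div_vector_density[OF smooth_on_differentiable[OF Ws True] True] by (simp add: volume_density_def)
    moreover have "pd a (V a) x = pd a (lm.vector_density W a) x" for a
      by (rule pd_cong[OF lm.open_domain True]) (simp add: V_def)
    ultimately show ?thesis using True by simp
  next
    case False
    have "pd a (V a) x = pd a (\<lambda>_. 0) x" for a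
      by (rule pd_cong[OF Kc]) (use False K(2) V0 in auto)
    then show ?thesis using False by simp
  qed
  have "g02 A g (bochner_laplacian A g h) g q = 0" if q: "q \<in> M" "q \<notin> cdom c" for q
  proof -
    obtain d where d: "d \<in> A" "q \<in> cdom d" using chart_at[OF q(1)] by blast
    interpret ld: local_metric "cimg d" "g d" by (rule local_metric_chart[OF g d(1)])
    let ?U = "{x \<in> cimg d. cinv d x \<in> M - cinv c ` K}"
    have "open ?U" by (rule open_preimage[OF d(1) closed_coordinate_ball[OF c K]])
    then interpret lU: local_metric ?U "g d" by (rule ld.subset) auto
    have "cinv c ` K \<subseteq> cdom c" using K(2) cinv_cdom[OF c] by blast
    then have "cmap d q \<in> ?U" using d q by auto
    moreover have "h d y = 0" if "y \<in> ?U" for y by (rule zero[OF d(1)]) (use that in auto)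
    ultimately have "bochner_local (g d) (h d) (cmap d q) = 0" by (intro lU.bochner_zero)
    then show ?thesis
      using g02_eq[OF g bT gT d] d by (simp add: fibre_metric_def bochner_laplacian_def trace_linear_simps)
  qed
  then have "L2_metric A g (bochner_laplacian A g h) g = (\<integral>x. - (\<Sum>a\<in>UNIV. pd a (V a) x) \<partial>lborel)"
    unfolding L2_metric_def key[symmetric]
    by (intro integral_chart[OF g c] measurable_continuous smooth_fun_continuous g02_smooth g bT gT)
  also have "\<dots> = - (\<Sum>a\<in>UNIV. \<integral>x. pd a (V a) x \<partial>lborel)"
    using integrable_pd[OF Vs K(1) V0] by simp
  also have "\<dots> = 0" using integral_pd_eq_0[OF Vs K(1) V0] by simp
  finally show ?thesis .
qed

lemma bochner_tadd:
  "g \<in> \<M> \<Longrightarrow> h \<in> \<T> \<Longrightarrow> k \<in> \<T> \<Longrightarrow> bochner_laplacian A g (tadd h k) = tadd (bochner_laplacian A g h) (bochner_laplacian A g k)"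
  using bochner_linear[of g h k 1] by (simp add: tscale_def)

text \<open>A partition of unity made of bump functions reduces this to compact supports in charts.\<close>

lemma L2_bochner:
  assumes g: "g \<in> \<M>" and h: "h \<in> \<T>"
  shows "L2_metric A g (bochner_laplacian A g h) g = 0"
proof -
  have gT: "g \<in> \<T>" by (rule metric_tensor[OF g])
  obtain F where F: "finite F" "\<And>b. b \<in> F \<Longrightarrow> good_ball b" "M = (\<Union>(c, a, r)\<in>F. cinv c ` ball a r)"
    using finite_ball_cover by metis
  define \<sigma> where "\<sigma> q = (\<Sum>b\<in>F. chart_bump b q)" for q
  have \<sigma>: "\<sigma> q > 0" if q: "q \<in> M" for q
  proof -
    obtain c a r where b: "(c, a, r) \<in> F" "q \<in> cinv c ` ball a r" using q F(3) by auto
    show ?thesis unfolding \<sigma>_def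
      by (rule sum_pos2[OF F(1) b(1), of "\<lambda>b. chart_bump b q", OF chart_bump_pos[OF F(2)[OF b(1)] b(2)]])
        (rule chart_bump_nonneg)
  qed
  define k where "k b = function_times (\<lambda>q. chart_bump b q / \<sigma> q) h" for b
  have \<sigma>s: "smooth_fun \<sigma>" unfolding \<sigma>_def by (rule smooth_fun_sum) (rule chart_bump_smooth[OF F(2)])
  have k: "k b \<in> \<T> \<and> L2_metric A g (bochner_laplacian A g (k b)) g = 0" if b: "b \<in> F" for b
  proof
    have gb: "good_ball b" by (rule F(2)[OF b])
    have "\<sigma> q \<noteq> 0" if "q \<in> M" for q using \<sigma>[OF that] by simp
    then show kT: "k b \<in> \<T>" unfolding k_def
      by (intro function_times_tensor smooth_fun_divide chart_bump_smooth gb \<sigma>s h)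
    obtain c a r where e: "b = (c, a, r)" by (cases b)
    have c: "c \<in> A" and r: "r > 0" "cball a r \<subseteq> cimg c" using gb by (auto simp: e good_ball_def)
    show "L2_metric A g (bochner_laplacian A g (k b)) g = 0"
    proof (rule L2_bochner_supported[OF g kT c compact_cball r(2)])
      fix d x assume d: "d \<in> A" "x \<in> cimg d" "cinv d x \<notin> cinv c ` cball a r"
      have "chart_bump b (cinv d x) = 0"
      proof (cases "cinv d x \<in> cdom c")
        case True
        have "cinv d x = cinv c (cmap c (cinv d x))" using True c by simp
        then have "cmap c (cinv d x) \<notin> cball a r" using d(3) by blast
        then show ?thesis by (simp add: e chart_bump_def bump_zero[OF r(1)])
      qed (simp add: e chart_bump_def)
      then show "k b d x = 0" by (simp add: k_def function_times_def)
    qed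
  qed
  have sum: "L2_metric A g (bochner_laplacian A g (\<lambda>c x. \<Sum>b\<in>B. k b c x)) g = 0" if "B \<subseteq> F" for B
    using finite_subset[OF that F(1)] that
  proof (induction B rule: finite_induct)
    case empty
    have "bochner_laplacian A g (\<lambda>c x. 0) = (\<lambda>c x. 0)"
      using bochner_scaled_metric[OF g, of 0] by (simp add: tscale_def)
    then show ?case using L2_tscale(1)[of g 0 g g] by (simp add: tscale_def)
  next
    case (insert b B)
    have kB: "(\<lambda>c x. \<Sum>b\<in>B. k b c x) \<in> \<T>" using k insert.prems by (intro tsum_tensor) blast
    have kb: "k b \<in> \<T>" "L2_metric A g (bochner_laplacian A g (k b)) g = 0" using k insert.prems by blast+
    have "(\<lambda>c x. \<Sum>b\<in>insert b B. k b c x) = tadd (k b) (\<lambda>c x. \<Sum>b\<in>B. k b c x)"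
      using insert.hyps by (simp add: tadd_def)
    then show ?case
      using insert.IH insert.prems
      by (simp add: bochner_tadd[OF g kb(1) kB] L2_tadd[OF g bochner_tensor[OF g kb(1)] bochner_tensor[OF g kB] gT] kb(2))
  qed
  have "(\<lambda>c x. \<Sum>b\<in>F. k b c x) = h"
  proof (rule tensor_eqI[OF _ h])
    show "(\<lambda>c x. \<Sum>b\<in>F. k b c x) \<in> \<T>" using k by (intro tsum_tensor) blast
    fix c x assume "c \<in> A" "x \<in> cimg c"
    then have "\<sigma> (cinv c x) > 0" by (intro \<sigma> cinv_M)
    then have "(\<Sum>b\<in>F. chart_bump b (cinv c x) / \<sigma> (cinv c x)) = 1"
      by (simp add: sum_divide_distrib[symmetric] \<sigma>_def[symmetric])
    then show "(\<Sum>b\<in>F. k b c x) = h c x"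
      by (simp add: k_def function_times_def scaleR_sum_left[symmetric])
  qed
  then show ?thesis using sum[OF subset_refl] by simp
qed

lemma sobolev_op_Suc: "sobolev_op A (Suc p) g h = tadd (sobolev_op A p g h) (bochner_laplacian A g (sobolev_op A p g h))"
  by (simp add: sobolev_op_def)

lemma L2_sobolev_op: "g \<in> \<M> \<Longrightarrow> h \<in> \<T> \<Longrightarrow> L2_metric A g (sobolev_op A p g h) g = L2_metric A g h g"
proof (induction p)
  case (Suc p)
  have s: "sobolev_op A p g h \<in> \<T>" by (rule sobolev_op_tensor[OF Suc.prems])
  show ?case
    using Suc by (simp add: sobolev_op_Suc L2_tadd[OF _ s bochner_tensor metric_tensor] s L2_bochner)
qed (simp add: sobolev_op_def)

text \<open>If \<open>\<Delta>h = -h\<close> then the Bochner formula for \<open>u = |h|\<^sup>2\<close> bounds the trace of \<open>\<Delta>(ug)\<close> by \<open>-2nu\<close>,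
  while its integral vanishes by \<open>L2_bochner\<close>; so \<open>\<integral>u \<le> 0\<close>.\<close>

lemma one_plus_bochner_inj:
  assumes g: "g \<in> \<M>" and h: "h \<in> \<T>" and eq: "tadd h (bochner_laplacian A g h) = (\<lambda>c x. 0)"
  shows "h = (\<lambda>c x. 0)"
proof -
  let ?u = "g02 A g h h" and ?n = "real CARD('n)"
  let ?k = "function_times ?u g"
  have gT: "g \<in> \<T>" by (rule metric_tensor[OF g])
  have k: "?k \<in> \<T>" by (intro function_times_tensor g02_smooth g h gT)
  have bk: "bochner_laplacian A g ?k \<in> \<T>" by (rule bochner_tensor[OF g k])
  have le: "g02 A g (bochner_laplacian A g ?k) g q \<le> (- 2 * ?n) * ?u q" if q: "q \<in> M" for q
  proof -
    obtain c where c: "c \<in> A" "q \<in> cdom c" using chart_at[OF q] by blast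
    interpret lm: local_metric "cimg c" "g c" by (rule local_metric_chart[OF g c(1)])
    let ?x = "cmap c q"
    have x: "?x \<in> cimg c" using c by simp
    have kc: "?k c y = fibre_metric (g c) (h c) (h c) y *\<^sub>R g c y" if "y \<in> cimg c" for y
      using g02_eq[OF g h h c(1) cinv_cdom[OF c(1) that]] that c by (simp add: function_times_def)
    have 1: "g02 A g (bochner_laplacian A g ?k) g q = fibre_metric (g c) (bochner_local (g c) (?k c)) (g c) ?x"
      using g02_eq[OF g bk gT c] x c by (simp add: fibre_metric_def bochner_laplacian_def)
    have "bochner_local (g c) (?k c) ?x = bochner_local (g c) (\<lambda>y. fibre_metric (g c) (h c) (h c) y *\<^sub>R g c y) ?x"
      by (rule bochner_local_cong[OF lm.open_domain x kc])
    then have 2: "fibre_metric (g c) (bochner_local (g c) (?k c)) (g c) ?x =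
        fibre_metric (g c) (bochner_local (g c) (\<lambda>y. fibre_metric (g c) (h c) (h c) y *\<^sub>R g c y)) (g c) ?x"
      by (simp only: fibre_metric_def)
    have 3: "\<dots> \<le> 2 * ?n * fibre_metric (g c) (bochner_local (g c) (h c)) (h c) ?x"
      by (rule lm.bochner_norm_le[OF tensor_smooth[OF h c(1)] tensor_sym[OF h c(1)] x])
    have "bochner_local (g c) (h c) ?x = - h c ?x"
      using fun_cong[OF fun_cong[OF eq, of c], of ?x] x c by (simp add: tadd_def bochner_laplacian_def add_eq_0_iff)
    then have 4: "fibre_metric (g c) (bochner_local (g c) (h c)) (h c) ?x = - fibre_metric (g c) (h c) (h c) ?x"
      by (simp add: fibre_metric_def matrix_mult_linear_simps trace_linear_simps)
    have 5: "fibre_metric (g c) (h c) (h c) ?x = ?u q" by (rule g02_eq[OF g h h c, symmetric])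
    show ?thesis using 3 unfolding 1 2 4 5 by simp
  qed
  have "0 = (\<integral>q. g02 A g (bochner_laplacian A g ?k) g q \<partial>vol A g)"
    using L2_bochner[OF g k] by (simp add: L2_metric_def)
  also have "\<dots> \<le> (\<integral>q. (- 2 * ?n) * ?u q \<partial>vol A g)"
    using le by (intro integral_mono integrable_mult_right integrable_g02 g bk gT h) (simp add: space_vol[OF g])
  also have "\<dots> = (- 2 * ?n) * L2_metric A g h h" by (simp add: L2_metric_def)
  finally have "L2_metric A g h h \<le> 0" by (simp add: mult_le_0_iff)
  then show ?thesis by (rule L2_definite[OF g h])
qed

lemma sobolev_op_inj: "g \<in> \<M> \<Longrightarrow> h \<in> \<T> \<Longrightarrow> sobolev_op A p g h = (\<lambda>c x. 0) \<Longrightarrow> h = (\<lambda>c x. 0)"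
proof (induction p)
  case (Suc p)
  have "sobolev_op A p g h = (\<lambda>c x. 0)"
    by (rule one_plus_bochner_inj[OF Suc.prems(1) sobolev_op_tensor[OF Suc.prems(1,2)]])
      (use Suc.prems(3) in \<open>simp add: sobolev_op_Suc\<close>)
  then show ?case using Suc by blast
qed (simp add: sobolev_op_def)

lemma metric_op_sobolev:
  assumes g: "g \<in> \<M>" and h: "h \<in> \<T>"
  shows "metric_op A (sobolev_metric A p) g h = sobolev_op A p g h"
  unfolding metric_op_def
proof (rule the_equality)
  have eq: "sobolev_metric A p g h k = L2_metric A g (sobolev_op A p g h) k" for k
    by (simp add: sobolev_metric_def L2_metric_def)
  show "sobolev_op A p g h \<in> \<T> \<and> (\<forall>k\<in>\<T>. sobolev_metric A p g h k = L2_metric A g (sobolev_op A p g h) k)"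
    using sobolev_op_tensor[OF g h] eq by blast
  show "s = sobolev_op A p g h" if "s \<in> \<T> \<and> (\<forall>k\<in>\<T>. sobolev_metric A p g h k = L2_metric A g s k)" for s
    by (rule L2_cancel[OF g]) (use that sobolev_op_tensor[OF g h] eq in auto)
qed

section \<open>Derivative of the operator with respect to the metric\<close>

lemma tscale_metric: "r > 0 \<Longrightarrow> g \<in> \<M> \<Longrightarrow> tscale r g \<in> \<M>"
proof (rule metricI)
  assume r: "r > 0" and g: "g \<in> \<M>"
  show "tscale r g \<in> \<T>" by (rule tscale_tensor[OF metric_tensor[OF g]])
  show "posdef (tscale r g c x)" if "c \<in> A" "x \<in> cimg c" for c x
    using metric_posdef[OF g that] r
    by (simp add: posdef_def tscale_def transpose_linear_simps scaleR_matrix_vector_assoc[symmetric])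
qed

text \<open>On each of finitely many compact coordinate balls, \<open>g\<close> has a positive minimum \<open>\<delta>\<close> on unit vectors
  and \<open>m\<close> a bound \<open>C\<close>, so \<open>g + sm\<close> is definite for \<open>|s| < \<delta>/(C + 1)\<close>.\<close>

lemma metric_perturb:
  assumes g: "g \<in> \<M>" and m: "m \<in> \<T>"
  obtains \<epsilon> where "\<epsilon> > 0" "\<And>s. \<bar>s\<bar> < \<epsilon> \<Longrightarrow> tadd g (tscale s m) \<in> \<M>"
proof -
  have gT: "g \<in> \<T>" by (rule metric_tensor[OF g])
  obtain F where F: "finite F" "\<And>b. b \<in> F \<Longrightarrow> good_ball b" "M = (\<Union>(c, a, r)\<in>F. cinv c ` ball a r)"
    using finite_ball_cover by metis
  have T: "tadd g (tscale s m) \<in> \<T>" for s by (intro tadd_tensor tscale_tensor gT m)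
  have "\<exists>\<epsilon>>0. \<forall>s. \<bar>s\<bar> < \<epsilon> \<longrightarrow> (\<forall>x\<in>cball a r. posdef (tadd g (tscale s m) c x))" if b: "(c, a, r) \<in> F" for c a r
  proof -
    have c: "c \<in> A" and r: "r > 0" "cball a r \<subseteq> cimg c" using F(2)[OF b] by (auto simp: good_ball_def)
    let ?X = "cball a r \<times> sphere (0 :: real^'n) 1"
    have X: "compact ?X" by (intro compact_Times compact_cball compact_sphere)
    have ne: "?X \<noteq> {}"
    proof -
      have "axis undefined 1 \<in> sphere (0 :: real^'n) 1" by (simp add: norm_axis_1)
      then show ?thesis using r(1) by (auto intro!: exI[of _ a])
    qed
    have cont: "continuous_on ?X (\<lambda>(x, v). v \<bullet> (k c x *v v))" if "k \<in> \<T>" for k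
    proof -
      have "continuous_on ?X (\<lambda>z. k c (fst z))"
        by (rule continuous_on_compose2[OF smooth_on_continuous[OF tensor_smooth[OF that c]] continuous_on_fst[OF continuous_on_id]])
          (use r(2) in auto)
      then show ?thesis
        unfolding case_prod_beta inner_vec_def matrix_vector_mult_def vec_lambda_beta
        by (intro continuous_intros)
    qed
    obtain z where z: "z \<in> ?X" "\<And>y. y \<in> ?X \<Longrightarrow> (case z of (x, v) \<Rightarrow> v \<bullet> (g c x *v v)) \<le> (case y of (x, v) \<Rightarrow> v \<bullet> (g c x *v v))"
      using continuous_attains_inf[OF X ne cont[OF gT]] by blast
    define \<delta> where "\<delta> = (case z of (x, v) \<Rightarrow> v \<bullet> (g c x *v v))"
    have \<delta>: "\<delta> > 0"
    proof -
      obtain x v where e: "z = (x, v)" by (cases z)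
      then have "x \<in> cimg c" "v \<noteq> 0" using z(1) r(2) by auto
      then show ?thesis using metric_posdef[OF g c] by (simp add: \<delta>_def e posdef_def)
    qed
    obtain C where C: "\<And>x v. (x, v) \<in> ?X \<Longrightarrow> \<bar>v \<bullet> (m c x *v v)\<bar> \<le> C"
    proof -
      have "bounded ((\<lambda>(x, v). v \<bullet> (m c x *v v)) ` ?X)"
        by (rule compact_imp_bounded[OF compact_continuous_image[OF cont[OF m] X]])
      then obtain C where C: "\<forall>y\<in>(\<lambda>(x, v). v \<bullet> (m c x *v v)) ` ?X. norm y \<le> C" unfolding bounded_iff by blast
      have "\<bar>v \<bullet> (m c x *v v)\<bar> \<le> C" if "(x, v) \<in> ?X" for x v
        using bspec[OF C imageI[OF that]] by simp
      then show ?thesis using that by blast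
    qed
    have C0: "C \<ge> 0" using C[of "fst z" "snd z"] z(1) by simp
    show ?thesis
    proof (intro exI[of _ "\<delta> / (C + 1)"] conjI allI impI ballI)
      show "\<delta> / (C + 1) > 0" using \<delta> C0 by simp
      fix s x assume s: "\<bar>s\<bar> < \<delta> / (C + 1)" and x: "x \<in> cball a r"
      have xc: "x \<in> cimg c" using x r(2) by blast
      show "posdef (tadd g (tscale s m) c x)" unfolding posdef_def
      proof (intro conjI allI impI)
        show "transpose (tadd g (tscale s m) c x) = tadd g (tscale s m) c x" by (rule tensor_sym[OF T c xc])
        fix v :: "real^'n" assume v: "v \<noteq> 0"
        let ?w = "(1 / norm v) *\<^sub>R v"
        have w: "(x, ?w) \<in> ?X" using v x by simp
        have vw: "v = norm v *\<^sub>R ?w" using v by simp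
        have "\<bar>s * (?w \<bullet> (m c x *v ?w))\<bar> \<le> \<bar>s\<bar> * C"
          unfolding abs_mult by (rule mult_left_mono[OF C[OF w]]) simp
        also have "\<dots> \<le> \<bar>s\<bar> * (C + 1)" by (simp add: mult_left_mono)
        also have "\<dots> < \<delta>" using s C0 by (simp add: pos_less_divide_eq)
        also have "\<delta> \<le> ?w \<bullet> (g c x *v ?w)" using z(2)[OF w] by (simp add: \<delta>_def)
        finally have pos: "0 < ?w \<bullet> (g c x *v ?w) + s * (?w \<bullet> (m c x *v ?w))" by linarith
        have "v \<bullet> (tadd g (tscale s m) c x *v v) = norm v * norm v * (?w \<bullet> (tadd g (tscale s m) c x *v ?w))"
          using v by (simp add: matrix_vector_mult_scaleR)
        also have "?w \<bullet> (tadd g (tscale s m) c x *v ?w) = ?w \<bullet> (g c x *v ?w) + s * (?w \<bullet> (m c x *v ?w))"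
          by (simp only: tadd_def tscale_def matrix_vector_mult_add_rdistrib scaleR_matrix_vector_assoc[symmetric]
              inner_add_right inner_scaleR_right)
        finally show "0 < v \<bullet> (tadd g (tscale s m) c x *v v)" using pos v by simp
      qed
    qed
  qed
  then have "\<forall>b\<in>F. \<exists>\<epsilon>>0. \<forall>s. \<bar>s\<bar> < \<epsilon> \<longrightarrow> (\<forall>x\<in>cball (fst (snd b)) (snd (snd b)). posdef (tadd g (tscale s m) (fst b) x))"
    by (auto simp: prod_eq_iff)
  then obtain E where E: "\<And>b. b \<in> F \<Longrightarrow> E b > 0"
    "\<And>b s x. b \<in> F \<Longrightarrow> \<bar>s\<bar> < E b \<Longrightarrow> x \<in> cball (fst (snd b)) (snd (snd b)) \<Longrightarrow> posdef (tadd g (tscale s m) (fst b) x)"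
    by metis
  define \<epsilon> where "\<epsilon> = Min (insert 1 (E ` F))"
  have \<epsilon>: "\<epsilon> > 0" "\<And>b. b \<in> F \<Longrightarrow> \<epsilon> \<le> E b" using F(1) E(1) by (auto simp: \<epsilon>_def)
  show ?thesis
  proof (rule that[OF \<epsilon>(1)])
    fix s assume s: "\<bar>s\<bar> < \<epsilon>"
    show "tadd g (tscale s m) \<in> \<M>"
    proof (rule metricI[OF T])
      fix d x assume d: "d \<in> A" "x \<in> cimg d"
      then obtain c a r where b: "(c, a, r) \<in> F" "cinv d x \<in> cinv c ` ball a r" using cinv_M[OF d] F(3) by auto
      then have c: "c \<in> A" and r: "cball a r \<subseteq> cimg c" using F(2)[OF b(1)] by (auto simp: good_ball_def)
      obtain y where y: "y \<in> ball a r" "cinv d x = cinv c y" using b(2) by blast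
      have yc: "y \<in> cball a r" "y \<in> cimg c" using y(1) r ball_subset_cball[of a r] by auto
      have o: "x \<in> overlap d c" using d y(2) yc c by (simp add: overlap_iff)
      have ty: "transition d c x = y" using y(2) yc c by (simp add: transition_eq)
      have "posdef (tadd g (tscale s m) c y)"
        using E(2)[OF b(1), of s y] \<epsilon>(2)[OF b(1)] s yc by simp
      then show "posdef (tadd g (tscale s m) d x)"
        unfolding tensor_transform[OF T d(1) c o] ty by (rule posdef_congruence) (rule Jac_det[OF d(1) c o])
    qed
  qed
qed

lemma smooth_sobolev_op_param:
  assumes m: "m \<in> \<T>" and g: "g \<in> \<T>" and \<epsilon>: "\<And>s. \<bar>s\<bar> < \<epsilon> \<Longrightarrow> tadd g (tscale s m) \<in> \<M>" and c: "c \<in> A"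
  shows "smooth_on ({- \<epsilon><..<\<epsilon>} \<times> cimg c) (\<lambda>z. sobolev_op A p (tadd g (tscale (fst z) m)) m c (snd z))"
proof -
  let ?W = "{- \<epsilon><..<\<epsilon>} \<times> cimg c" and ?G = "\<lambda>s. tadd g (tscale s m)"
  have W: "open ?W" by (intro open_Times cimg_open c) auto
  have lift: "smooth_on ?W (\<lambda>z. k c (snd z))" if "k \<in> \<T>" for k
    by (rule smooth_on_compose[OF W cimg_open[OF c] smooth_on_linear[OF W bounded_linear_snd] tensor_smooth[OF that c]]) auto
  have fstW: "smooth_on ?W fst" by (rule smooth_on_linear[OF W bounded_linear_fst])
  have G: "smooth_on ?W (\<lambda>z. ?G (fst z) c (snd z))"
    unfolding tadd_def tscale_def by (intro smooth_on_add smooth_on_scaleR lift W fstW m g)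
  have met: "?G (fst z) \<in> \<M>" "snd z \<in> cimg c" if "z \<in> ?W" for z
    using that \<epsilon>[of "fst z"] by auto
  show ?thesis
  proof (induction p)
    case 0
    then show ?case using lift[OF m] by (simp add: sobolev_op_def)
  next
    case (Suc p)
    have "smooth_on ?W (\<lambda>z. bochner_local (?G (fst z) c) (sobolev_op A p (?G (fst z)) m c) (snd z))"
      by (rule smooth_on_bochner_param[OF W G Suc])
        (use local_metric.det_nz[OF local_metric_chart[OF met(1) c]] met(2) in blast)
    then have "smooth_on ?W (\<lambda>z. sobolev_op A p (?G (fst z)) m c (snd z) +
        bochner_local (?G (fst z) c) (sobolev_op A p (?G (fst z)) m c) (snd z))"
      by (intro smooth_on_add W Suc)
    then show ?case
      by (rule smooth_on_cong[OF W, rotated]) (use met(2) c in \<open>simp add: sobolev_op_Suc tadd_def bochner_laplacian_def\<close>)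
  qed
qed

text \<open>Let \<open>P(s)\<close> be the operator of \<open>g + sm\<close>.  As \<open>P(s)\<close> fixes \<open>g + sm\<close>, it maps \<open>g\<close> to
  \<open>g + s(m - P(s) m)\<close>; the factor \<open>s\<close> makes the derivative at zero available without computing that of
  \<open>P(s) m\<close>.\<close>

lemma op_deriv_metric:
  assumes g: "g \<in> \<M>" and m: "m \<in> \<T>"
  shows "op_deriv (metric_op A (sobolev_metric A p)) g m (tscale r g) =
    tscale r (tadd m (tscale (-1) (sobolev_op A p g m)))"
proof (intro ext)
  fix c x
  let ?P = "metric_op A (sobolev_metric A p)" and ?G = "\<lambda>s. tadd g (tscale s m)"
  have gT: "g \<in> \<T>" by (rule metric_tensor[OF g])
  obtain \<epsilon> where \<epsilon>: "\<epsilon> > 0" "\<And>s. \<bar>s\<bar> < \<epsilon> \<Longrightarrow> ?G s \<in> \<M>" using metric_perturb[OF g m] by blast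
  define \<Phi> where "\<Phi> s = sobolev_op A p (?G s) m c x" for s
  have P: "?P (?G s) (tscale r g) c x = r *\<^sub>R g c x + s *\<^sub>R (r *\<^sub>R (m c x - \<Phi> s))" if s: "\<bar>s\<bar> < \<epsilon>" for s
  proof -
    have gs: "?G s \<in> \<M>" by (rule \<epsilon>(2)[OF s])
    have "?P (?G s) (tscale r g) = sobolev_op A p (?G s) (tscale r g)"
      by (rule metric_op_sobolev[OF gs tscale_tensor[OF gT]])
    also have "tscale r g = tadd (tscale r (?G s)) (tscale (- r * s) m)"
      by (simp add: tadd_def tscale_def fun_eq_iff algebra_simps)
    also have "sobolev_op A p (?G s) \<dots> = tadd (tscale r (?G s)) (tscale (- r * s) (sobolev_op A p (?G s) m))"
      by (simp only: sobolev_op_linear[OF gs tscale_tensor[OF metric_tensor[OF gs]] m] sobolev_op_scaled_metric[OF gs])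
    finally show ?thesis by (simp add: tadd_def tscale_def \<Phi>_def algebra_simps)
  qed
  have "\<Phi> differentiable at 0"
  proof (cases "c \<in> A \<and> x \<in> cimg c")
    case True
    then have c: "c \<in> A" "x \<in> cimg c" by auto
    have I: "open {- \<epsilon><..<\<epsilon>}" by simp
    have W: "open ({- \<epsilon><..<\<epsilon>} \<times> cimg c)" by (intro open_Times cimg_open c I)
    have "smooth_on {- \<epsilon><..<\<epsilon>} (\<lambda>s. (s, x))"
      by (rule smooth_on_Pair[OF I smooth_on_ident[OF I] smooth_on_const])
    from smooth_on_compose[OF I W this smooth_sobolev_op_param[OF m gT \<epsilon>(2) c(1)]]
    have "smooth_on {- \<epsilon><..<\<epsilon>} (\<lambda>s. sobolev_op A p (?G (fst (s, x))) m c (snd (s, x)))" using c by auto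
    then have "smooth_on {- \<epsilon><..<\<epsilon>} \<Phi>" by (simp add: \<Phi>_def[abs_def])
    then show ?thesis by (rule smooth_on_differentiable) (use \<epsilon>(1) in simp)
  next
    case False
    have "(\<Phi> has_derivative (\<lambda>_. 0)) (at 0)"
    proof (rule has_derivative_transform_within_open[of "\<lambda>_. 0" _ _ UNIV "{- \<epsilon><..<\<epsilon>}"])
      show "0 = \<Phi> s" if "s \<in> {- \<epsilon><..<\<epsilon>}" for s
      proof -
        have "\<bar>s\<bar> < \<epsilon>" using that by auto
        from tensor_zero[OF sobolev_op_tensor[OF \<epsilon>(2)[OF this] m] False] show ?thesis by (simp add: \<Phi>_def)
      qed
    qed (use \<epsilon>(1) in auto)
    then show ?thesis by (auto simp: differentiable_def)
  qed
  then obtain \<Phi>' where "(\<Phi> has_vector_derivative \<Phi>') (at 0)" using vector_derivative_works by blast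
  then have "((\<lambda>s. r *\<^sub>R g c x + s *\<^sub>R (r *\<^sub>R (m c x - \<Phi> s))) has_vector_derivative r *\<^sub>R (m c x - \<Phi> 0)) (at 0)"
    by (auto intro!: derivative_eq_intros)
  then have "((\<lambda>s. ?P (?G s) (tscale r g) c x) has_vector_derivative r *\<^sub>R (m c x - \<Phi> 0)) (at 0)"
    by (rule has_vector_derivative_transform_within_open[where S="{- \<epsilon><..<\<epsilon>}"]) (use P \<epsilon>(1) in auto)
  then have "op_deriv ?P g m (tscale r g) c x = r *\<^sub>R (m c x - \<Phi> 0)"
    unfolding op_deriv_def by (rule vector_derivative_at)
  moreover have "?G 0 = g" by (simp add: tadd_def tscale_def)
  ultimately show "op_deriv ?P g m (tscale r g) c x = tscale r (tadd m (tscale (-1) (sobolev_op A p g m))) c x"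
    by (simp add: \<Phi>_def tscale_def tadd_def)
qed

text \<open>The derivative is \<open>a(m - P\<^sub>g m)\<close> for the multiple \<open>ag\<close>, and \<open>P\<^sub>g m\<close> has the same pairing with \<open>g\<close> as
  \<open>m\<close>.\<close>

lemma op_deriv_adjoint_metric:
  assumes g: "g \<in> \<M>"
  shows "op_deriv_adjoint A (metric_op A (sobolev_metric A p)) g (tscale r g) (tscale r g) = (\<lambda>c x. 0)"
  unfolding op_deriv_adjoint_def
proof (rule the_equality)
  let ?D = "op_deriv (metric_op A (sobolev_metric A p)) g"
  have gT: "g \<in> \<T>" by (rule metric_tensor[OF g])
  have L0: "L2_metric A g m (\<lambda>c x. 0) = 0" for m using L2_tscale(2)[of g m 0 g] by (simp add: tscale_def)
  have D: "L2_metric A g (?D m (tscale r g)) (tscale r g) = 0" if m: "m \<in> \<T>" for m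
    using m by (simp add: op_deriv_metric[OF g m] L2_tscale L2_tadd[OF g m tscale_tensor[OF sobolev_op_tensor[OF g m]] gT]
        L2_sobolev_op[OF g m])
  show "(\<lambda>c x. 0) \<in> \<T> \<and> (\<forall>m\<in>\<T>. L2_metric A g (?D m (tscale r g)) (tscale r g) = L2_metric A g m (\<lambda>c x. 0))"
    using D L0 zero_tensor by simp
  show "a = (\<lambda>c x. 0)" if "a \<in> \<T> \<and> (\<forall>m\<in>\<T>. L2_metric A g (?D m (tscale r g)) (tscale r g) = L2_metric A g m a)" for a
    by (rule L2_definite[OF g]) (use that D in auto)
qed

text \<open>With \<open>h = ag\<close> the remaining four terms are \<open>n/4\<close>, \<open>1/2\<close>, \<open>1/2\<close> and \<open>-n/2\<close> times \<open>a\<^sup>2 g\<close>.\<close>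

lemma geodesic_rhs_metric:
  assumes g: "g \<in> \<M>"
  shows "geodesic_rhs A (metric_op A (sobolev_metric A p)) g (tscale r g) = tscale (r\<^sup>2 * (1 - real CARD('n) / 4)) g"
proof (intro ext)
  fix c x
  have gT: "g \<in> \<T>" by (rule metric_tensor[OF g])
  have P: "metric_op A (sobolev_metric A p) g (tscale r g) = tscale r g"
    using metric_op_sobolev[OF g tscale_tensor[OF gT]] sobolev_op_scaled_metric[OF g] by simp
  show "geodesic_rhs A (metric_op A (sobolev_metric A p)) g (tscale r g) c x = tscale (r\<^sup>2 * (1 - real CARD('n) / 4)) g c x"
  proof (cases "c \<in> A \<and> x \<in> cimg c")
    case True
    then have inv: "matrix_inv (g c x) ** g c x = mat 1" "g c x ** matrix_inv (g c x) = mat 1"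
      using local_metric.metric_inv[OF local_metric_chart[OF g]] by auto
    have t: "trace (mat 1 :: real^'n^'n) = real CARD('n)" by (simp add: trace_I)
    show ?thesis
      unfolding geodesic_rhs_def P op_deriv_adjoint_metric[OF g] g02_local_def unfolding tscale_def
      by (simp add: matrix_mult_linear_simps trace_linear_simps inv t matrix_mul_assoc[symmetric])
        (simp add: matrix_mul_assoc inv t power2_eq_square vec_eq_iff field_simps)
  next
    case False
    have "g c x = 0" by (rule tensor_zero[OF gT False])
    then show ?thesis
      unfolding geodesic_rhs_def P op_deriv_adjoint_metric[OF g] g02_local_def unfolding tscale_def by simp
  qed
qed

text \<open>In the direction of \<open>g\<close> itself the operator does not change, so the equation reads \<open>P\<^sub>g l = bg\<close>
  with a number \<open>b\<close>; it has the solution \<open>bg\<close>, and no other since \<open>P\<^sub>g\<close> is injective.\<close>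

lemma geodesic_accel_metric:
  assumes g: "g \<in> \<M>"
  shows "geodesic_accel A (sobolev_metric A p) g (tscale r g) = tscale (r\<^sup>2 * (1 - real CARD('n) / 4)) g"
  unfolding geodesic_accel_def
proof (rule the_equality)
  let ?P = "metric_op A (sobolev_metric A p)" and ?b = "r\<^sup>2 * (1 - real CARD('n) / 4)"
  have gT: "g \<in> \<T>" by (rule metric_tensor[OF g])
  have D: "op_deriv ?P g (tscale r g) (tscale r g) c x = 0" for c x
    by (simp add: op_deriv_metric[OF g tscale_tensor[OF gT]] sobolev_op_scaled_metric[OF g]) (simp add: tscale_def tadd_def)
  have S: "sobolev_op A p g (tscale ?b g) = tscale ?b g" by (rule sobolev_op_scaled_metric[OF g])
  show "tscale ?b g \<in> \<T> \<and> (\<forall>c\<in>A. \<forall>x\<in>cimg c. ?P g (tscale ?b g) c x + op_deriv ?P g (tscale r g) (tscale r g) c x =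
      geodesic_rhs A ?P g (tscale r g) c x)"
    using tscale_tensor[OF gT] by (simp add: D geodesic_rhs_metric[OF g] metric_op_sobolev[OF g] S)
  fix l assume l: "l \<in> \<T> \<and> (\<forall>c\<in>A. \<forall>x\<in>cimg c. ?P g l c x + op_deriv ?P g (tscale r g) (tscale r g) c x =
      geodesic_rhs A ?P g (tscale r g) c x)"
  have "sobolev_op A p g l = tscale ?b g"
    by (rule tensor_eqI[OF sobolev_op_tensor[OF g] tscale_tensor[OF gT]])
      (use l in \<open>auto simp: D geodesic_rhs_metric[OF g] metric_op_sobolev[OF g]\<close>)
  then have "sobolev_op A p g (tadd l (tscale (-1) (tscale ?b g))) = (\<lambda>c x. 0)"
    using l by (simp add: sobolev_op_linear[OF g _ tscale_tensor[OF gT]] S) (simp add: tadd_def tscale_def)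
  then have "tadd l (tscale (-1) (tscale ?b g)) = (\<lambda>c x. 0)"
    by (rule sobolev_op_inj[OF g, rotated]) (intro tadd_tensor tscale_tensor gT conjunct1[OF l])
  then show "l = tscale ?b g" by (simp add: diff_zero_iff)
qed

lemma Gamma_form_metric:
  assumes g: "g \<in> \<M>"
  shows "Gamma_form A (sobolev_metric A p) g (tscale a g) (tscale b g) = tscale (a * b * (1 - real CARD('n) / 4)) g"
proof -
  have 1: "tadd (tscale a g) (tscale b g) = tscale (a + b) g"
    "tadd (tscale a g) (tscale (-1) (tscale b g)) = tscale (a - b) g"
    by (simp_all add: tadd_def tscale_def fun_eq_iff algebra_simps)
  show ?thesis
    unfolding Gamma_form_def 1 geodesic_accel_metric[OF g]
    by (simp add: tadd_def tscale_def fun_eq_iff flip: scaleR_add_left scaleR_diff_left)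
      (simp add: power2_eq_square algebra_simps)
qed

end

section \<open>The ray of multiples of a metric\<close>

lemma smooth_on_real_deriv:
  fixes r :: "real \<Rightarrow> real"
  assumes "open I" "smooth_on I r"
  shows "t \<in> I \<Longrightarrow> (r has_real_derivative deriv r t) (at t)" and "smooth_on I (deriv r)"
proof -
  have d: "(r has_real_derivative deriv r t) (at t)" if "t \<in> I" for t
    using smooth_on_differentiable[OF assms(2) that]
    by (simp add: DERIV_deriv_iff_real_differentiable)
  then show "t \<in> I \<Longrightarrow> (r has_real_derivative deriv r t) (at t)" .
  have "frechet_derivative r (at t) 1 = deriv r t" if "t \<in> I" for t
    using frechet_derivative_at[OF d[OF that, unfolded has_field_derivative_def]] by (metis mult.right_neutral)
  then show "smooth_on I (deriv r)"
    by (intro smooth_on_cong[OF assms(1) _ smooth_on_derivative[OF assms(2), of 1]])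
qed

context compact_manifold begin

lemma smooth_family_tscale:
  assumes U: "open (U :: 'e::euclidean_space set)" and r: "smooth_on U r" and g: "g \<in> \<T>"
  shows "smooth_family A U (\<lambda>u. tscale (r u) g)"
  unfolding smooth_family_def
proof (intro conjI ballI)
  show "tscale (r u) g \<in> \<T>" for u by (rule tscale_tensor[OF g])
  fix c assume c: "c \<in> A"
  have W: "open (U \<times> cimg c)" by (intro open_Times U cimg_open c)
  have "smooth_on (U \<times> cimg c) (\<lambda>z. r (fst z))"
    by (rule smooth_on_compose[OF W U smooth_on_linear[OF W bounded_linear_fst] r]) auto
  moreover have "smooth_on (U \<times> cimg c) (\<lambda>z. g c (snd z))"
    by (rule smooth_on_compose[OF W cimg_open[OF c] smooth_on_linear[OF W bounded_linear_snd] tensor_smooth[OF g c]]) auto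
  ultimately have "smooth_on (U \<times> cimg c) (\<lambda>z. r (fst z) *\<^sub>R g c (snd z))" by (rule smooth_on_scaleR[OF W])
  then show "smooth_on (U \<times> cimg c) (\<lambda>(u, x). tscale (r u) g c x)"
    by (simp add: tscale_def case_prod_unfold)
qed

lemma smooth_family_slice:
  assumes U: "open (U :: 'e::euclidean_space set)" and \<gamma>: "smooth_family A U \<gamma>" and c: "c \<in> A" "x \<in> cimg c"
  shows "smooth_on U (\<lambda>u. \<gamma> u c x)"
proof -
  have W: "open (U \<times> cimg c)" by (intro open_Times U cimg_open c)
  have p: "smooth_on U (\<lambda>u. (u, x))" by (rule smooth_on_Pair[OF U smooth_on_ident[OF U] smooth_on_const])
  have s: "smooth_on (U \<times> cimg c) (\<lambda>z. \<gamma> (fst z) c (snd z))"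
    using \<gamma> c by (simp add: smooth_family_def case_prod_unfold)
  have "smooth_on U (\<lambda>u. \<gamma> (fst (u, x)) c (snd (u, x)))"
    by (rule smooth_on_compose[OF U W p s]) (simp add: c)
  then show ?thesis by simp
qed

lemma velocity_tscale:
  assumes "(r has_real_derivative r') (at t)"
  shows "velocity (\<lambda>t. tscale (r t) g) t = tscale r' g"
proof (intro ext)
  fix c x
  have "((\<lambda>s. r s *\<^sub>R g c x) has_vector_derivative r' *\<^sub>R g c x) (at t)"
    using assms by (auto intro!: derivative_eq_intros)
  then show "velocity (\<lambda>t. tscale (r t) g) t c x = tscale r' g c x"
    by (simp add: velocity_def tscale_def vector_derivative_at)
qed

lemma metric_nonzero: "g \<in> \<M> \<Longrightarrow> c \<in> A \<Longrightarrow> x \<in> cimg c \<Longrightarrow> g c x \<noteq> 0"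
proof
  assume "g \<in> \<M>" "c \<in> A" "x \<in> cimg c" "g c x = 0"
  then have "posdef (0 :: real^'n^'n)" using metric_posdef by metis
  then have "v = 0" for v :: "real^'n" by (auto simp: posdef_def)
  from this[of "axis undefined 1"] show False by (simp add: axis_eq_0_iff)
qed

abbreviation "ray g \<equiv> {tscale r g |r. r > 0}"

lemma ray_eq: "ray g = (\<lambda>r. tscale r g) ` {0<..}"
  by auto

lemma tscale_tscale: "tscale a (tscale b g) = tscale (a * b) g"
  by (simp add: tscale_def)

text \<open>Where \<open>g\<close> is non-zero, the factor of a multiple of \<open>g\<close> can be read off by a linear functional.\<close>

definition factor :: "real^'n^'n \<Rightarrow> real^'n^'n \<Rightarrow> real" where
  "factor B H = (H \<bullet> B) / (B \<bullet> B)"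

lemma factor_scaleR: "B \<noteq> 0 \<Longrightarrow> factor B (r *\<^sub>R B) = r"
  by (simp add: factor_def)

lemma bounded_linear_factor: "bounded_linear (factor B)"
  unfolding factor_def[abs_def] by (intro bounded_linear_compose[OF bounded_linear_divide] bounded_linear_inner_left)

text \<open>A smooth curve in the ray has a smooth factor, because the factor can be read off at one point.
  Conversely \<open>(1 + ta) g\<close> has velocity \<open>ag\<close> and stays in the ray for small \<open>t\<close>.\<close>

lemma tangent_space_ray:
  assumes g: "g \<in> \<M>" and ne: "M \<noteq> {}"
  shows "tangent_space A (ray g) g = range (\<lambda>a. tscale a g)"
proof (intro equalityI subsetI)
  have gT: "g \<in> \<T>" by (rule metric_tensor[OF g])
  obtain c0 q where c0: "c0 \<in> A" "q \<in> cdom c0" using ne chart_at by blast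
  define x0 where "x0 = cmap c0 q"
  have x0: "x0 \<in> cimg c0" using c0 by (simp add: x0_def)
  have nz: "g c0 x0 \<noteq> 0" by (rule metric_nonzero[OF g c0(1) x0])
  fix h assume "h \<in> tangent_space A (ray g) g"
  then obtain \<epsilon> \<gamma> where \<gamma>: "\<epsilon> > 0" "smooth_family A {-\<epsilon><..<\<epsilon>} \<gamma>" "\<And>t. t \<in> {-\<epsilon><..<\<epsilon>} \<Longrightarrow> \<gamma> t \<in> ray g"
      "velocity \<gamma> 0 = h"
    unfolding tangent_space_def by blast
  define \<rho> where "\<rho> t = factor (g c0 x0) (\<gamma> t c0 x0)" for t
  have I: "open {-\<epsilon><..<\<epsilon>}" by simp
  have \<gamma>\<rho>: "\<gamma> t = tscale (\<rho> t) g" if t: "t \<in> {-\<epsilon><..<\<epsilon>}" for t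
  proof -
    obtain r where r: "\<gamma> t = tscale r g" using \<gamma>(3)[OF t] by blast
    then have "\<rho> t = r" by (simp add: \<rho>_def tscale_def factor_scaleR[OF nz])
    then show ?thesis using r by simp
  qed
  have "smooth_on {-\<epsilon><..<\<epsilon>} \<rho>"
    unfolding \<rho>_def[abs_def]
    by (rule smooth_on_bounded_linear[OF I bounded_linear_factor smooth_family_slice[OF I \<gamma>(2) c0(1) x0]])
  then have d: "(\<rho> has_real_derivative deriv \<rho> 0) (at 0)"
    using smooth_on_real_deriv(1)[OF I] \<gamma>(1) by simp
  have "h = tscale (deriv \<rho> 0) g"
  proof (intro ext)
    fix c x
    have "((\<lambda>s. \<rho> s *\<^sub>R g c x) has_vector_derivative deriv \<rho> 0 *\<^sub>R g c x) (at 0)"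
      using d by (auto intro!: derivative_eq_intros)
    then have "((\<lambda>s. \<gamma> s c x) has_vector_derivative deriv \<rho> 0 *\<^sub>R g c x) (at 0)"
      by (rule has_vector_derivative_transform_within_open[OF _ I]) (use \<gamma>(1) in \<open>auto simp: \<gamma>\<rho> tscale_def\<close>)
    then show "h c x = tscale (deriv \<rho> 0) g c x"
      unfolding \<gamma>(4)[symmetric] velocity_def tscale_def by (rule vector_derivative_at)
  qed
  then show "h \<in> range (\<lambda>a. tscale a g)" by blast
next
  fix h assume "h \<in> range (\<lambda>a. tscale a g)"
  then obtain a where h: "h = tscale a g" by blast
  \<comment> \<open>For \<open>|t| < 1/(|a| + 1)\<close> the factor \<open>1 + ta\<close> is positive.\<close>
  let ?e = "1 / (\<bar>a\<bar> + 1)" and ?r = "\<lambda>t. 1 + t * a"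
  have I: "open {-?e<..<?e}" by simp
  have e: "?e > 0" by simp
  have r: "smooth_on {-?e<..<?e} ?r"
    by (intro smooth_on_add smooth_on_const smooth_on_mult smooth_on_ident I)
  have pos: "?r t > 0" if t: "t \<in> {-?e<..<?e}" for t
  proof -
    have "\<bar>t\<bar> < ?e" using t by auto
    then have "\<bar>t\<bar> * (\<bar>a\<bar> + 1) < 1" by (simp add: pos_less_divide_eq)
    moreover have "\<bar>t * a\<bar> \<le> \<bar>t\<bar> * (\<bar>a\<bar> + 1)" unfolding abs_mult by (intro mult_left_mono) auto
    ultimately show ?thesis by linarith
  qed
  have "(?r has_real_derivative a) (at 0)" by (auto intro!: derivative_eq_intros)
  then have v: "velocity (\<lambda>t. tscale (?r t) g) 0 = h" unfolding h by (rule velocity_tscale)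
  show "h \<in> tangent_space A (ray g) g"
    unfolding tangent_space_def
  proof (rule CollectI, rule exI[of _ ?e], intro exI[of _ "\<lambda>t. tscale (?r t) g"] conjI ballI)
    show "smooth_family A {-?e<..<?e} (\<lambda>t. tscale (?r t) g)"
      by (rule smooth_family_tscale[OF I r metric_tensor[OF g]])
    show "tscale (?r t) g \<in> ray g" if "t \<in> {-?e<..<?e}" for t using pos[OF that] by blast
  qed (use e v in \<open>auto simp: tscale_def\<close>)
qed

lemma pds_tscale:
  assumes "open S" "smooth_on S f"
  shows "x \<in> S \<Longrightarrow> pds is (\<lambda>y. r *\<^sub>R f y) x = r *\<^sub>R pds is f x" and "smooth_on S (pds is f)"
proof -
  have s: "smooth_on S (pds is f)" for "is"
    by (induction "is") (auto intro: smooth_on_pd assms)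
  then show "smooth_on S (pds is f)" .
  show "x \<in> S \<Longrightarrow> pds is (\<lambda>y. r *\<^sub>R f y) x = r *\<^sub>R pds is f x"
  proof (induction "is" arbitrary: x)
    case (Cons i "is")
    have "pd i (pds is (\<lambda>y. r *\<^sub>R f y)) x = pd i (\<lambda>y. r *\<^sub>R pds is f y) x"
      by (rule pd_cong[OF assms(1) Cons.prems Cons.IH])
    also have "\<dots> = r *\<^sub>R pd i (pds is f) x"
      by (rule pd_cmult[OF smooth_on_differentiable[OF s Cons.prems]])
    finally show ?case by simp
  qed simp
qed

lemma topspace_Cinf: "A \<noteq> {} \<Longrightarrow> topspace (Cinf_topology A) = \<T>"
proof -
  assume "A \<noteq> {}"
  then obtain c where c: "c \<in> A" by blast
  let ?B = "{{k \<in> \<T>. \<forall>x\<in>K. norm (pds is (k c) x - pds is (h c) x) < \<epsilon>} | h c K is \<epsilon>.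
        h \<in> \<T> \<and> c \<in> A \<and> compact K \<and> K \<subseteq> cimg c \<and> \<epsilon> > (0::real)}"
  have T: "\<T> = {k \<in> \<T>. \<forall>x\<in>{}. norm (pds [] (k c) x - pds [] (\<lambda>x. 0) x) < 1}" by simp
  have "{k \<in> \<T>. \<forall>x\<in>{}. norm (pds [] (k c) x - pds [] (\<lambda>x. 0) x) < 1} \<in> ?B"
    using c zero_tensor by (intro CollectI exI[of _ "\<lambda>c x. 0"] exI[of _ c] exI[of _ "{}"] exI[of _ "[]"] exI[of _ 1]) auto
  then have "\<T> \<subseteq> \<Union>?B" by (subst T) (rule Union_upper)
  moreover have "\<Union>?B \<subseteq> \<T>" by blast
  ultimately show ?thesis unfolding Cinf_topology_def topology_generated_by_topspace by blast
qed

text \<open>Partial derivatives are linear in the factor and bounded on compact sets, so the basic open sets of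
  the \<open>C\<^sup>\<infinity>\<close>-topology meet the ray in open sets of parameters.\<close>

lemma open_ray_parameter:
  assumes g: "g \<in> \<T>" and h: "h \<in> \<T>" and c: "c \<in> A" and K: "compact K" "K \<subseteq> cimg c"
  shows "open {r. \<forall>x\<in>K. norm (pds is (tscale r g c) x - pds is (h c) x) < \<epsilon>}"
proof -
  let ?G = "pds is (g c)" and ?H = "pds is (h c)"
  have cont: "continuous_on K ?G" "continuous_on K ?H"
    using smooth_on_continuous[OF pds_tscale(2)[OF cimg_open[OF c] tensor_smooth[OF g c]]]
      smooth_on_continuous[OF pds_tscale(2)[OF cimg_open[OF c] tensor_smooth[OF h c]]] K(2) continuous_on_subset by blast+
  have eq: "pds is (tscale r g c) x = r *\<^sub>R ?G x" if "x \<in> K" for r x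
    unfolding tscale_def using K(2) that by (intro pds_tscale(1)[OF cimg_open[OF c] tensor_smooth[OF g c]]) blast
  obtain C where C: "\<And>x. x \<in> K \<Longrightarrow> norm (?G x) \<le> C" "C \<ge> 0"
  proof -
    obtain C where "\<forall>y\<in>?G ` K. norm y \<le> C"
      using compact_imp_bounded[OF compact_continuous_image[OF cont(1) K(1)]] bounded_iff by metis
    then show ?thesis using that[of "max C 0"] by force
  qed
  show ?thesis
    unfolding open_dist
  proof (intro ballI)
    fix r assume "r \<in> {r. \<forall>x\<in>K. norm (pds is (tscale r g c) x - pds is (h c) x) < \<epsilon>}"
    then have r: "\<And>x. x \<in> K \<Longrightarrow> norm (r *\<^sub>R ?G x - ?H x) < \<epsilon>" by (simp add: eq)
    obtain \<delta> where \<delta>: "\<delta> > 0" "\<And>x. x \<in> K \<Longrightarrow> norm (r *\<^sub>R ?G x - ?H x) \<le> \<epsilon> - \<delta>"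
    proof (cases "K = {}")
      case False
      have "continuous_on K (\<lambda>x. norm (r *\<^sub>R ?G x - ?H x))" by (intro continuous_intros cont)
      then obtain z where z: "z \<in> K" "\<And>y. y \<in> K \<Longrightarrow> norm (r *\<^sub>R ?G y - ?H y) \<le> norm (r *\<^sub>R ?G z - ?H z)"
        using continuous_attains_sup[OF K(1) False] by blast
      then show ?thesis using that[of "\<epsilon> - norm (r *\<^sub>R ?G z - ?H z)"] r by simp
    qed (use that[of 1] in auto)
    show "\<exists>e>0. \<forall>s. dist s r < e \<longrightarrow> s \<in> {r. \<forall>x\<in>K. norm (pds is (tscale r g c) x - pds is (h c) x) < \<epsilon>}"
    proof (intro exI[of _ "\<delta> / (C + 1)"] conjI allI impI CollectI ballI)
      show "\<delta> / (C + 1) > 0" using \<delta>(1) C(2) by simp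
      fix s x assume s: "dist s r < \<delta> / (C + 1)" and x: "x \<in> K"
      have "norm ((s - r) *\<^sub>R ?G x) \<le> \<bar>s - r\<bar> * (C + 1)" using C(1)[OF x] by (simp add: mult_left_mono)
      also have "\<dots> < \<delta>" using s C(2) by (simp add: dist_real_def pos_less_divide_eq)
      finally have "norm ((s - r) *\<^sub>R ?G x) < \<delta>" .
      moreover have "s *\<^sub>R ?G x - ?H x = (s - r) *\<^sub>R ?G x + (r *\<^sub>R ?G x - ?H x)" by (simp add: algebra_simps)
      then have "norm (s *\<^sub>R ?G x - ?H x) \<le> norm ((s - r) *\<^sub>R ?G x) + norm (r *\<^sub>R ?G x - ?H x)"
        by (metis norm_triangle_ineq)
      ultimately show "norm (pds is (tscale s g c) x - pds is (h c) x) < \<epsilon>" using \<delta>(2)[OF x] by (simp add: eq[OF x])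
    qed
  qed
qed

text \<open>For the continuity of the inverse the value at a single point of \<open>M\<close> is enough.\<close>

lemma ray_homeomorphic:
  assumes g: "g \<in> \<M>" and ne: "M \<noteq> {}"
  shows "homeomorphic_map (top_of_set {0<..}) (subtopology (Cinf_topology A) (ray g)) (\<lambda>r. tscale r g)"
  unfolding homeomorphic_map_maps
proof (intro exI[of _ "\<lambda>h. SOME r. r > 0 \<and> h = tscale r g"])
  let ?inv = "\<lambda>h. SOME r. r > 0 \<and> h = tscale r g"
  have gT: "g \<in> \<T>" by (rule metric_tensor[OF g])
  obtain c0 q where c0: "c0 \<in> A" "q \<in> cdom c0" using ne chart_at by blast
  define x0 where "x0 = cmap c0 q"
  have x0: "x0 \<in> cimg c0" using c0 by (simp add: x0_def)
  have nz: "g c0 x0 \<noteq> 0" by (rule metric_nonzero[OF g c0(1) x0])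
  have inj: "r = s" if "tscale r g = tscale s g" for r s
    using fun_cong[OF fun_cong[OF that, of c0], of x0] nz by (simp add: tscale_def)
  have inv: "?inv (tscale r g) = r" if "r > 0" for r
    by (rule some_equality) (use that inj in auto)
  have top: "topspace (subtopology (Cinf_topology A) (ray g)) = ray g"
    using topspace_Cinf c0 tscale_tensor[OF gT] by auto
  have "continuous_map (top_of_set {0<..}) (Cinf_topology A) (\<lambda>r. tscale r g)"
    unfolding Cinf_topology_def
  proof (rule continuous_on_generated_topo)
    fix U assume "U \<in> {{k \<in> \<T>. \<forall>x\<in>K. norm (pds is (k c) x - pds is (h c) x) < \<epsilon>} | h c K is \<epsilon>.
        h \<in> \<T> \<and> c \<in> A \<and> compact K \<and> K \<subseteq> cimg c \<and> \<epsilon> > (0::real)}"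
    then obtain h c K "is" \<epsilon> where U: "U = {k \<in> \<T>. \<forall>x\<in>K. norm (pds is (k c) x - pds is (h c) x) < \<epsilon>}"
      "h \<in> \<T>" "c \<in> A" "compact K" "K \<subseteq> cimg c" by blast
    have "(\<lambda>r. tscale r g) -` U \<inter> topspace (top_of_set {0<..}) =
        {0<..} \<inter> {r. \<forall>x\<in>K. norm (pds is (tscale r g c) x - pds is (h c) x) < \<epsilon>}"
      using tscale_tensor[OF gT] by (auto simp: U(1))
    then show "openin (top_of_set {0<..}) ((\<lambda>r. tscale r g) -` U \<inter> topspace (top_of_set {0<..}))"
      using open_ray_parameter[OF gT U(2-5)] by (auto intro: openin_open_Int)
  next
    show "(\<lambda>r. tscale r g) ` topspace (top_of_set {0<..}) \<subseteq> \<Union>{{k \<in> \<T>. \<forall>x\<in>K. norm (pds is (k c) x - pds is (h c) x) < \<epsilon>} | h c K is \<epsilon>.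
        h \<in> \<T> \<and> c \<in> A \<and> compact K \<and> K \<subseteq> cimg c \<and> \<epsilon> > (0::real)}"
    proof (subst topspace_Cinf[unfolded Cinf_topology_def topology_generated_by_topspace])
      show "A \<noteq> {}" using c0(1) by blast
      show "(\<lambda>r. tscale r g) ` topspace (top_of_set {0<..}) \<subseteq> \<T>" using tscale_tensor[OF gT] by blast
    qed
  qed
  then have c1: "continuous_map (top_of_set {0<..}) (subtopology (Cinf_topology A) (ray g)) (\<lambda>r. tscale r g)"
    by (auto simp: continuous_map_in_subtopology)
  have c2: "continuous_map (subtopology (Cinf_topology A) (ray g)) (top_of_set {0<..}) ?inv"
    unfolding continuous_map_in_subtopology
  proof
    show "?inv \<in> topspace (subtopology (Cinf_topology A) (ray g)) \<rightarrow> {0<..}"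
      unfolding top using inv by auto
    show "continuous_map (subtopology (Cinf_topology A) (ray g)) euclidean ?inv"
      unfolding continuous_map_def top
    proof (intro conjI allI impI)
      fix U :: "real set" assume "openin euclidean U"
      then have U: "open U" by simp
      show "openin (subtopology (Cinf_topology A) (ray g)) {h \<in> ray g. ?inv h \<in> U}"
      proof (subst openin_subopen, intro ballI)
        fix h assume "h \<in> {h \<in> ray g. ?inv h \<in> U}"
        then obtain r where r: "r > 0" "h = tscale r g" "r \<in> U" using inv by auto
        then obtain \<delta> where \<delta>: "\<delta> > 0" "ball r \<delta> \<subseteq> U" using U openE by blast
        let ?\<epsilon> = "\<delta> * norm (g c0 x0)"
        let ?V = "{k \<in> \<T>. \<forall>x\<in>{x0}. norm (pds [] (k c0) x - pds [] (h c0) x) < ?\<epsilon>}"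
        have "?\<epsilon> > 0" using \<delta>(1) nz by simp
        then have "openin (Cinf_topology A) ?V"
          unfolding Cinf_topology_def using c0(1) x0 tscale_tensor[OF gT] r(2)
          by (intro topology_generated_by_Basis CollectI exI[of _ h] exI[of _ c0] exI[of _ "{x0}"] exI[of _ "[]"] exI[of _ ?\<epsilon>]) auto
        then have op: "openin (subtopology (Cinf_topology A) (ray g)) (ray g \<inter> ?V)" by (rule openin_subtopology_Int2)
        have "ray g \<inter> ?V \<subseteq> {h \<in> ray g. ?inv h \<in> U}"
        proof
          fix k assume "k \<in> ray g \<inter> ?V"
          then obtain s where s: "s > 0" "k = tscale s g" "norm (s *\<^sub>R g c0 x0 - r *\<^sub>R g c0 x0) < ?\<epsilon>"
            by (auto simp: r(2) tscale_def)
          have "\<bar>s - r\<bar> * norm (g c0 x0) < \<delta> * norm (g c0 x0)"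
            using s(3) by (simp add: scaleR_diff_left[symmetric])
          then have "s \<in> ball r \<delta>" using nz by (simp add: dist_real_def abs_minus_commute)
          then show "k \<in> {h \<in> ray g. ?inv h \<in> U}" using s inv[OF s(1)] \<delta>(2) by auto
        qed
        moreover have "h \<in> ray g \<inter> ?V" using r \<open>?\<epsilon> > 0\<close> tscale_tensor[OF gT] by auto
        ultimately show "\<exists>T. openin (subtopology (Cinf_topology A) (ray g)) T \<and> h \<in> T \<and> T \<subseteq> {h \<in> ray g. ?inv h \<in> U}"
          using op by blast
      qed
    qed auto
  qed
  show "homeomorphic_maps (top_of_set {0<..}) (subtopology (Cinf_topology A) (ray g)) (\<lambda>r. tscale r g) ?inv"
    unfolding homeomorphic_maps_def top using c1 c2 inv by auto
qed

lemma ray_submanifold: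
  assumes g: "g \<in> \<M>" and ne: "M \<noteq> {}"
  shows "submanifold_of_metrics TYPE(real) A (ray g)"
  unfolding submanifold_of_metrics_def
proof (intro conjI ballI)
  have gT: "g \<in> \<T>" by (rule metric_tensor[OF g])
  obtain c0 q where c0: "c0 \<in> A" "q \<in> cdom c0" using ne chart_at by blast
  define x0 where "x0 = cmap c0 q"
  have x0: "x0 \<in> cimg c0" using c0 by (simp add: x0_def)
  have nz: "g c0 x0 \<noteq> 0" by (rule metric_nonzero[OF g c0(1) x0])
  show "ray g \<subseteq> \<M>" using tscale_metric[OF _ g] by blast
  fix h assume h: "h \<in> ray g"
  have I: "open {0::real<..}" by simp
  have fd: "frechet_derivative (\<lambda>u. tscale u g c0 x0) (at u) v = v *\<^sub>R g c0 x0" for u v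
  proof -
    have "((\<lambda>u. u *\<^sub>R g c0 x0) has_derivative (\<lambda>v. v *\<^sub>R g c0 x0)) (at u)"
      by (auto intro!: derivative_eq_intros)
    then have "frechet_derivative (\<lambda>u. u *\<^sub>R g c0 x0) (at u) = (\<lambda>v. v *\<^sub>R g c0 x0)"
      by (rule frechet_derivative_at[symmetric])
    then show ?thesis by (simp add: tscale_def)
  qed
  have top: "topspace (subtopology (Cinf_topology A) (ray g)) = ray g"
    using topspace_Cinf c0 tscale_tensor[OF gT] by auto
  show "\<exists>(U :: real set) \<phi>. open U \<and> h \<in> \<phi> ` U \<and> openin (subtopology (Cinf_topology A) (ray g)) (\<phi> ` U) \<and>
        homeomorphic_map (top_of_set U) (subtopology (Cinf_topology A) (\<phi> ` U)) \<phi> \<and> smooth_family A U \<phi> \<and>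
        (\<forall>u\<in>U. \<forall>v. v \<noteq> 0 \<longrightarrow> (\<exists>c\<in>A. \<exists>x\<in>cimg c. frechet_derivative (\<lambda>u. \<phi> u c x) (at u) v \<noteq> 0))"
  proof (intro exI[of _ "{0<..}"] exI[of _ "\<lambda>r. tscale r g"] conjI I)
    show "h \<in> (\<lambda>r. tscale r g) ` {0<..}" using h ray_eq by blast
    show "openin (subtopology (Cinf_topology A) (ray g)) ((\<lambda>r. tscale r g) ` {0<..})"
      unfolding ray_eq[symmetric] using openin_topspace[of "subtopology (Cinf_topology A) (ray g)"] by (simp only: top)
    show "homeomorphic_map (top_of_set {0<..}) (subtopology (Cinf_topology A) ((\<lambda>r. tscale r g) ` {0<..})) (\<lambda>r. tscale r g)"
      unfolding ray_eq[symmetric] by (rule ray_homeomorphic[OF g ne])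
    show "smooth_family A {0<..} (\<lambda>r. tscale r g)"
      by (rule smooth_family_tscale[OF I smooth_on_ident[OF I] gT])
    show "\<forall>u\<in>{0<..}. \<forall>v. v \<noteq> 0 \<longrightarrow> (\<exists>c\<in>A. \<exists>x\<in>cimg c. frechet_derivative (\<lambda>u. tscale u g c x) (at u) v \<noteq> 0)"
      using c0(1) x0 nz fd by (metis scaleR_eq_0_iff)
  qed
qed

text \<open>Each point of the ray generates the same ray, so the formulas at \<open>g\<close> in direction \<open>ag\<close> apply
  everywhere on it.\<close>

lemma ray_totally_geodesic:
  assumes g0: "g0 \<in> \<M>" and ne: "M \<noteq> {}"
  shows "totally_geodesic TYPE(real) A (sobolev_metric A p) (ray g0)"
  unfolding totally_geodesic_def
proof (intro conjI ray_submanifold[OF g0 ne] ballI)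
  fix g h k assume g: "g \<in> ray g0" and h: "h \<in> tangent_space A (ray g0) g" and k: "k \<in> tangent_space A (ray g0) g"
  obtain r where r: "r > 0" "g = tscale r g0" using g by blast
  have gM: "g \<in> \<M>" unfolding r(2) by (rule tscale_metric[OF r(1) g0])
  have "ray g0 = ray g"
  proof (intro equalityI subsetI)
    fix h assume "h \<in> ray g0"
    then obtain s where s: "s > 0" "h = tscale s g0" by blast
    then have "h = tscale (s / r) g" using r by (simp add: tscale_tscale)
    then show "h \<in> ray g" using s r by (auto intro!: exI[of _ "s / r"])
  next
    fix h assume "h \<in> ray g"
    then obtain s where s: "s > 0" "h = tscale s g" by blast
    then show "h \<in> ray g0" using r by (auto simp: tscale_tscale intro!: exI[of _ "s * r"])
  qed
  then have T: "tangent_space A (ray g0) g = range (\<lambda>a. tscale a g)" using tangent_space_ray[OF gM ne] by simp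
  obtain a b where "h = tscale a g" "k = tscale b g" using h k unfolding T by blast
  then have "Gamma_form A (sobolev_metric A p) g h k = tscale (a * b * (1 - real CARD('n) / 4)) g"
    by (simp add: Gamma_form_metric[OF gM])
  then show "Gamma_form A (sobolev_metric A p) g h k \<in> tangent_space A (ray g0) g" unfolding T by blast
qed

section \<open>Geodesics along the ray\<close>

text \<open>Along \<open>r(t) g\<close> the momentum \<open>P g\<^sub>t\<close> is \<open>r' g\<close>, and the velocity is \<open>r'/r\<close> times the current metric.\<close>

lemma geodesic_on_ray:
  assumes g: "g \<in> \<M>" and ne: "M \<noteq> {}" and I: "open I" "is_interval I" "I \<noteq> {}"
    and r: "smooth_on I r" "\<And>t. t \<in> I \<Longrightarrow> r t > 0"
  shows "geodesic_on A (sobolev_metric A p) I (\<lambda>t. tscale (r t) g) \<longleftrightarrow>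
    (\<forall>t\<in>I. deriv (deriv r) t = (deriv r t)\<^sup>2 / r t * (1 - real CARD('n) / 4))"
proof -
  let ?P = "metric_op A (sobolev_metric A p)" and ?\<gamma> = "\<lambda>t. tscale (r t) g"
  let ?rhs = "\<lambda>t. (deriv r t)\<^sup>2 / r t * (1 - real CARD('n) / 4)"
  have gT: "g \<in> \<T>" by (rule metric_tensor[OF g])
  obtain c0 q where c0: "c0 \<in> A" "q \<in> cdom c0" using ne chart_at by blast
  define x0 where "x0 = cmap c0 q"
  have x0: "x0 \<in> cimg c0" using c0 by (simp add: x0_def)
  have nz: "g c0 x0 \<noteq> 0" by (rule metric_nonzero[OF g c0(1) x0])
  note d = smooth_on_real_deriv[OF I(1) r(1)]
  note dd = smooth_on_real_deriv(1)[OF I(1) d(2)]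
  have M: "?\<gamma> t \<in> \<M>" if "t \<in> I" for t by (rule tscale_metric[OF r(2)[OF that] g])
  have v: "velocity ?\<gamma> t = tscale (deriv r t / r t) (?\<gamma> t)" "velocity ?\<gamma> t = tscale (deriv r t) g" if "t \<in> I" for t
    using velocity_tscale[OF d(1)[OF that], of g] r(2)[OF that] by (simp_all add: tscale_tscale)
  have P: "?P (?\<gamma> t) (velocity ?\<gamma> t) = tscale (deriv r t) g" if t: "t \<in> I" for t
  proof -
    have "?P (?\<gamma> t) (velocity ?\<gamma> t) = velocity ?\<gamma> t"
      unfolding v(1)[OF t] metric_op_sobolev[OF M[OF t] tscale_tensor[OF metric_tensor[OF M[OF t]]]]
      by (rule sobolev_op_scaled_metric[OF M[OF t]])
    then show ?thesis using v(2)[OF t] by simp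
  qed
  have R: "geodesic_rhs A ?P (?\<gamma> t) (velocity ?\<gamma> t) = tscale (?rhs t) g" if t: "t \<in> I" for t
    unfolding v(1)[OF t] geodesic_rhs_metric[OF M[OF t]]
    using r(2)[OF t] by (simp add: tscale_tscale power2_eq_square)
  have eq: "((\<lambda>s. ?P (?\<gamma> s) (velocity ?\<gamma> s) c x) has_vector_derivative geodesic_rhs A ?P (?\<gamma> t) (velocity ?\<gamma> t) c x) (at t)
      \<longleftrightarrow> deriv (deriv r) t *\<^sub>R g c x = ?rhs t *\<^sub>R g c x" (is "?L \<longleftrightarrow> _") if t: "t \<in> I" for t c x
  proof -
    have D: "((\<lambda>s. ?P (?\<gamma> s) (velocity ?\<gamma> s) c x) has_vector_derivative deriv (deriv r) t *\<^sub>R g c x) (at t)"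
    proof (rule has_vector_derivative_transform_within_open[OF _ I(1) t])
      show "((\<lambda>s. deriv r s *\<^sub>R g c x) has_vector_derivative deriv (deriv r) t *\<^sub>R g c x) (at t)"
        using dd[OF t] by (auto intro!: derivative_eq_intros)
      show "deriv r s *\<^sub>R g c x = ?P (?\<gamma> s) (velocity ?\<gamma> s) c x" if "s \<in> I" for s
        unfolding P[OF that] by (simp add: tscale_def)
    qed
    have e: "tscale (?rhs t) g c x = ?rhs t *\<^sub>R g c x" by (simp add: tscale_def)
    show ?thesis
      unfolding R[OF t] e
    proof
      assume "((\<lambda>s. ?P (?\<gamma> s) (velocity ?\<gamma> s) c x) has_vector_derivative ?rhs t *\<^sub>R g c x) (at t)"
      then show "deriv (deriv r) t *\<^sub>R g c x = ?rhs t *\<^sub>R g c x" by (rule vector_derivative_unique_at[OF D])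
    next
      assume "deriv (deriv r) t *\<^sub>R g c x = ?rhs t *\<^sub>R g c x"
      with D show "((\<lambda>s. ?P (?\<gamma> s) (velocity ?\<gamma> s) c x) has_vector_derivative ?rhs t *\<^sub>R g c x) (at t)"
        by (rule back_subst)
    qed
  qed
  have fam: "smooth_family A I ?\<gamma>" by (rule smooth_family_tscale[OF I(1) r(1) gT])
  have "geodesic_on A (sobolev_metric A p) I ?\<gamma> \<longleftrightarrow>
      (\<forall>t\<in>I. \<forall>c\<in>A. \<forall>x\<in>cimg c. deriv (deriv r) t *\<^sub>R g c x = ?rhs t *\<^sub>R g c x)"
    unfolding geodesic_on_def using I fam M eq by blast
  also have "\<dots> \<longleftrightarrow> (\<forall>t\<in>I. deriv (deriv r) t = ?rhs t)"
    using c0(1) x0 nz by (metis scaleR_cancel_right)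
  finally show ?thesis .
qed

text \<open>The equation \<open>r'' = (r'\<^sup>2/r)(1 - n/4)\<close> says that \<open>r\<close> to the power \<open>n/4\<close> is affine, so
  \<open>r(t) = (1+t)\<close> to the power \<open>4/n\<close> is a solution that reaches zero at time \<open>-1\<close>.\<close>

lemma smooth_on_powr: "smooth_on {-1<..} (\<lambda>t::real. (1 + t) powr a)"
proof -
  have I: "open {-1::real<..}" by simp
  have "C_k_on k {-1<..} (\<lambda>t::real. (1 + t) powr a)" for k
  proof (induction k arbitrary: a)
    case 0
    show ?case by (auto intro!: continuous_intros)
  next
    case (Suc k)
    have c: "C_k_on k {-1<..} (\<lambda>_::real. c :: real)" for c
      using smooth_on_const by (auto simp: smooth_on_def)
    show ?case
    proof (rule C_k_on_SucI[OF I, where D="\<lambda>t v. (a * (1 + t) powr (a - 1)) * v"])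
      fix t :: real assume "t \<in> {-1<..}"
      then have "((\<lambda>t. (1 + t) powr a) has_real_derivative a * (1 + t) powr (a - 1)) (at t)"
        by (auto intro!: derivative_eq_intros)
      then show "((\<lambda>t. (1 + t) powr a) has_derivative (\<lambda>v. (a * (1 + t) powr (a - 1)) * v)) (at t)"
        by (simp add: has_field_derivative_def)
    next
      show "C_k_on k {-1<..} (\<lambda>t. (a * (1 + t) powr (a - 1)) * v)" for v
        by (intro C_k_on_bilinear[OF I bounded_bilinear_mult] c Suc.IH)
    qed
  qed
  then show ?thesis by (simp add: smooth_on_def)
qed

lemma deriv_powr: "t > -1 \<Longrightarrow> deriv (\<lambda>t::real. (1 + t) powr a) t = a * (1 + t) powr (a - 1)"
  by (rule DERIV_imp_deriv) (auto intro!: derivative_eq_intros)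

lemma incomplete:
  assumes ne: "M \<noteq> {}"
  shows "geodesically_incomplete A (sobolev_metric A p)"
proof -
  obtain g where g: "g \<in> \<M>" using metric_exists by blast
  obtain c0 q where c0: "c0 \<in> A" "q \<in> cdom c0" using ne chart_at by blast
  define x0 where "x0 = cmap c0 q"
  have x0: "x0 \<in> cimg c0" using c0 by (simp add: x0_def)
  \<comment> \<open>With this exponent \<open>1 - n/4 = 1 - 1/a\<close>.\<close>
  define a where "a = 4 / real CARD('n)"
  have a: "a > 0" "1 - real CARD('n) / 4 = 1 - 1 / a" by (simp_all add: a_def)
  let ?r = "\<lambda>t::real. (1 + t) powr a" and ?I = "{-1::real<..}"
  have I: "open ?I" "is_interval ?I" "?I \<noteq> {}" by (auto simp: is_interval_def)
  have ode: "deriv (deriv ?r) t = (deriv ?r t)\<^sup>2 / ?r t * (1 - real CARD('n) / 4)" if t: "t \<in> ?I" for t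
  proof -
    have p: "1 + t > 0" using t by simp
    have "((\<lambda>t. a * (1 + t) powr (a - 1)) has_real_derivative a * ((a - 1) * (1 + t) powr (a - 2))) (at t)"
      using p by (auto intro!: derivative_eq_intros)
    then have "(deriv ?r has_real_derivative a * ((a - 1) * (1 + t) powr (a - 2))) (at t)"
      by (rule has_field_derivative_transform_within_open[OF _ I(1) t]) (simp add: deriv_powr)
    then have "deriv (deriv ?r) t = a * ((a - 1) * (1 + t) powr (a - 2))" by (rule DERIV_imp_deriv)
    moreover have "(deriv ?r t)\<^sup>2 / ?r t = a\<^sup>2 * (1 + t) powr (a - 2)"
    proof -
      have "(1 + t) powr (a - 2) = (1 + t) powr ((a - 1) + (a - 1) - a)" by simp
      also have "\<dots> = (1 + t) powr (a - 1) * (1 + t) powr (a - 1) / (1 + t) powr a"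
        unfolding powr_add powr_diff ..
      finally show ?thesis using t by (simp add: deriv_powr power2_eq_square)
    qed
    moreover have "a * ((a - 1) * X) = a\<^sup>2 * X * (1 - 1 / a)" for X
      using a(1) by (simp add: field_simps power2_eq_square)
    ultimately show ?thesis unfolding a(2) by simp
  qed
  have geo: "geodesic_on A (sobolev_metric A p) ?I (\<lambda>t. tscale (?r t) g)"
    using geodesic_on_ray[OF g ne I smooth_on_powr, of a p] ode by simp
  have "\<not> (\<exists>\<gamma>'. geodesic_on A (sobolev_metric A p) UNIV \<gamma>' \<and> (\<forall>t\<in>?I. \<gamma>' t = tscale (?r t) g))"
  proof
    assume "\<exists>\<gamma>'. geodesic_on A (sobolev_metric A p) UNIV \<gamma>' \<and> (\<forall>t\<in>?I. \<gamma>' t = tscale (?r t) g)"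
    then obtain \<gamma> where \<gamma>: "smooth_family A UNIV \<gamma>" "\<gamma> (-1) \<in> \<M>" "\<And>t. t \<in> ?I \<Longrightarrow> \<gamma> t = tscale (?r t) g"
      unfolding geodesic_on_def by blast
    have "continuous_on UNIV (\<lambda>t. \<gamma> t c0 x0)"
      by (rule smooth_on_continuous[OF smooth_family_slice[OF open_UNIV \<gamma>(1) c0(1) x0]])
    then have cont: "isCont (\<lambda>t. \<gamma> t c0 x0) (-1)" by (simp add: continuous_on_eq_continuous_at)
    let ?t = "\<lambda>k. -1 + inverse (real (Suc k))"
    have z: "(\<lambda>k. inverse (real (Suc k))) \<longlonglongrightarrow> 0" by (rule LIMSEQ_inverse_real_of_nat)
    have "?t \<longlonglongrightarrow> -1" using tendsto_add[OF tendsto_const[of "-1"] z] by simp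
    then have 1: "(\<lambda>k. \<gamma> (?t k) c0 x0) \<longlonglongrightarrow> \<gamma> (-1) c0 x0" by (rule isCont_tendsto_compose[OF cont])
    have 2: "\<gamma> (?t k) c0 x0 = (inverse (real (Suc k)) powr a) *\<^sub>R g c0 x0" for k
    proof -
      have "?t k \<in> ?I" by simp
      from \<gamma>(3)[OF this] show ?thesis by (simp add: tscale_def)
    qed
    have "(\<lambda>k. inverse (real (Suc k)) powr a) \<longlonglongrightarrow> 0"
      by (rule tendsto_zero_powrI[OF z tendsto_const _ a(1)]) simp
    from tendsto_scaleR[OF this tendsto_const[of "g c0 x0"]]
    have "(\<lambda>k. \<gamma> (?t k) c0 x0) \<longlonglongrightarrow> 0" unfolding 2 by simp
    then have "\<gamma> (-1) c0 x0 = 0" using 1 LIMSEQ_unique by blast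
    then show False using metric_nonzero[OF \<gamma>(2) c0(1) x0] by simp
  qed
  then show ?thesis unfolding geodesically_incomplete_def using geo by blast
qed

text \<open>The comparison with the \<open>L\<^sup>2\<close>-metric is the case \<open>p = 0\<close>.\<close>

lemma L2_metric_sobolev: "L2_metric A = sobolev_metric A 0"
  by (simp add: fun_eq_iff L2_metric_def sobolev_metric_def sobolev_op_def)

end

theorem mainTheorem9:
  fixes M :: "'m::t2_space set" and A :: "('m, 'n::finite) chart set" and p :: nat
  assumes "smooth_manifold M A" and "compact M" and "M \<noteq> {}"
  shows "(\<forall>g0\<in>riem_metrics A.
            totally_geodesic TYPE(real) A (sobolev_metric A p) {tscale r g0 | r. r > 0} \<and>
            (\<forall>I (r :: real \<Rightarrow> real).
               open I \<and> is_interval I \<and> I \<noteq> {} \<and> smooth_on I r \<and> (\<forall>t\<in>I. r t > 0) \<longrightarrow>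
               (geodesic_on A (sobolev_metric A p) I (\<lambda>t. tscale (r t) g0) \<longleftrightarrow>
                  geodesic_on A (L2_metric A) I (\<lambda>t. tscale (r t) g0)) \<and>
               (geodesic_on A (sobolev_metric A p) I (\<lambda>t. tscale (r t) g0) \<longleftrightarrow>
                  (\<forall>t\<in>I. deriv (deriv r) t = (deriv r t)\<^sup>2 / r t * (1 - real CARD('n) / 4)))))
         \<and> geodesically_incomplete A (sobolev_metric A p)"
proof -
  interpret compact_manifold M A using assms(1,2) by unfold_locales
  show ?thesis
  proof (intro conjI ballI allI impI)
    show "geodesically_incomplete A (sobolev_metric A p)" by (rule incomplete[OF assms(3)])
    fix g0 assume g0: "g0 \<in> riem_metrics A"
    show "totally_geodesic TYPE(real) A (sobolev_metric A p) {tscale r g0 | r. r > 0}"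
      by (rule ray_totally_geodesic[OF g0 assms(3)])
    fix I and r :: "real \<Rightarrow> real"
    assume H: "open I \<and> is_interval I \<and> I \<noteq> {} \<and> smooth_on I r \<and> (\<forall>t\<in>I. r t > 0)"
    have iff: "geodesic_on A (sobolev_metric A p) I (\<lambda>t. tscale (r t) g0) \<longleftrightarrow>
        (\<forall>t\<in>I. deriv (deriv r) t = (deriv r t)\<^sup>2 / r t * (1 - real CARD('n) / 4))" for p
      using H by (intro geodesic_on_ray[OF g0 assms(3)]) auto
    show "geodesic_on A (sobolev_metric A p) I (\<lambda>t. tscale (r t) g0) \<longleftrightarrow>
        (\<forall>t\<in>I. deriv (deriv r) t = (deriv r t)\<^sup>2 / r t * (1 - real CARD('n) / 4))" by (rule iff)
    show "geodesic_on A (sobolev_metric A p) I (\<lambda>t. tscale (r t) g0) \<longleftrightarrow>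
        geodesic_on A (L2_metric A) I (\<lambda>t. tscale (r t) g0)"
      unfolding L2_metric_sobolev iff ..
  qed
qed

end
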